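(* Let $\mathfrak u$ be a compact semisimple real Lie algebra and let $(\pi,V)$ be a complex representation of $\mathfrak u_{\mathbb C}$. Assume that there is a weight $\mu_0$ of $\pi$ lying in a Weyl chamber. Set $V_1=V(\mu_0)$ and $V_2=\bigoplus_{\mu\neq\mu_0}V(\mu)$ (sum over the weights $\mu\ne\mu_0$ of $\pi$). Then the real representation of $\mathfrak u$ on $V=V_1\oplus V_2$, with the real inner product on $V$ associated to $\pi$, satisfies properties (1)–(6) listed in the context. Consequently, the real Lie algebra $\mathfrak l(\mathfrak u,\pi)$ admits an inner product with negative Ricci curvature.
   Context: All Lie algebras and representations are finite-dimensional. A real Lie algebra is compact semisimple if its Killing form is negative definite. $\mathfrak u_{\mathbb C}=\mathfrak u\otimes_{\mathbb R}\mathbb C$, with Killing form $B$, Cartan subalgebra $\mathfrak h$, root system $\Delta$, a fixed positive system $\Delta^+$, and one-dimensional root spaces $(\mathfrak u_{\mathbb C})_\alpha$. For $\alpha\in\Delta$, $H_\alpha\in\mathfrak h$ is defined by $B(H,H_\alpha)=\alpha(H)$ for all $H\in\mathfrak h$; $\mathfrak h_{\mathbb R}$ is the real span of all $H_\alpha$; the inner product on $\mathfrak h_{\mathbb R}^*$ is determined by $\langle\alpha,\beta\rangle=B(H_\alpha,H_\beta)$. Root vectors $X_\alpha\in(\mathfrak u_{\mathbb C})_\alpha$ are chosen with $[X_\alpha,X_{-\alpha}]=H_\alpha$; $[X_\alpha,X_\beta]=N_{\alpha,\beta}X_{\alpha+\beta}$ if $\alpha+\beta\in\Delta$, with $N_{\alpha,\beta}=-N_{-\alpha,-\beta}\in\mathbb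 R$; $[X_\alpha,X_\beta]=0$ if $\alpha+\beta\neq0$ and $\alpha+\beta\notin\Delta$; and such that $\mathfrak u=\sum_{\alpha\in\Delta}\mathbb R\,iH_\alpha+\sum_{\alpha\in\Delta}\mathbb R X^\alpha+\sum_{\alpha\in\Delta}\mathbb R Y^\alpha$, where $X^\alpha=X_\alpha-X_{-\alpha}$ and $Y^\alpha=i(X_\alpha+X_{-\alpha})$ (this is always possible up to isomorphism, by uniqueness of compact real forms). For a complex representation $(\pi,V)$ of $\mathfrak u_{\mathbb C}$ and $\mu\in\mathfrak h^*$, $V(\mu)=\{v\in V:\pi(H)v=\mu(H)v\ \forall H\in\mathfrak h\}$; $\mu$ is a weight of $\pi$ if $V(\mu)\ne0$. A Weyl chamber is a connected component of the complement in $\mathfrak h_{\mathbb R}^*$ of the union of the hyperplanes $\{\mu:\langle\mu,\alpha\rangle=0\}$, $\alpha\in\Delta$. $V$ is regarded as a real representation of $\mathfrak u$ by restricting $\pi$ to $\mathfrak u$ and restricting scalars. The real inner product on $V$ associated to $\pi$ is $\langle v,w\rangle=\operatorname{Re}\langle\!\langle v,w\rangle\!\rangle$, where $\langle\!\langle\cdot,\cdot\rangle\!\rangle$ is a Hermitian inner product on $V$ with $\langle\!\langle\pi(X)v,w\rangle\!\rangle=-\langle\!\langle v,\pi(X)w\rangle\!\rangle$ for all $X\in\mathfrak u$ (one exists by compactness). Properties, for a real representation $(\pi,V)$ of $\mathfrak u$ with a decomposition $V=V_1\oplus V_2$ and an inner product $\langle\cdot,\cdot\rangle$ on $V$: (1)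 $V_1$ and $V_2$ are $i\mathfrak h_{\mathbb R}$-invariant. (2) $\pi(X^\alpha)(V_1)\subset V_2$ and $\pi(Y^\alpha)(V_1)\subset V_2$ for every $\alpha\in\Delta^+$. (3) $V_1$ is orthogonal to $V_2$. (4) $\pi(H)$ is a skew-symmetric operator of $V$ for every $H\in i\mathfrak h_{\mathbb R}$. (5) $\pi(X^\alpha)|_{V_1}$ and $\pi(Y^\alpha)|_{V_1}$ are non-zero for every $\alpha\in\Delta^+$. (6) $\operatorname{tr}\big((\pi(Y)|_{V_1})^t\,\pi(X)|_{V_1}\big)=0$ whenever $X\neq Y$ are elements of $\{X^\alpha,Y^\alpha:\alpha\in\Delta^+\}$. $\mathfrak l(\mathfrak u,\pi):=(\mathbb R Z\oplus\mathfrak u)\ltimes V$ is the real Lie algebra with brackets extending that of $\mathfrak u$ and $[Z,X]=0$, $[Z,v]=v$, $[X,v]=\pi(X)v$, $[v,w]=0$ for $X\in\mathfrak u$, $v,w\in V$. An inner product on a real Lie algebra $\mathfrak g$ has negative Ricci curvature if the corresponding left-invariant Riemannian metric on the simply connected Lie group with Lie algebra $\mathfrak g$ has negative definite Ricci operator. *)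

theory Defs
  imports "HOL-Analysis.Analysis"
begin

section \<open>Linear algebra over an explicit scalar multiplication\<close>

text \<open>Real spaces use the scalar multiplication \<^const>\<open>scaleR\<close>; complex spaces carry an explicit
  multiplication by complex numbers, so that the underlying type keeps its real structure and
  restriction of scalars is implicit. When the type is of class \<^class>\<open>euclidean_space\<close>, this only
  says that the space is finite-dimensional and nonzero: the inner product of the class is never
  used, and every inner product below is an explicit function.\<close>

definition complex_structure :: "(complex \<Rightarrow> 'v::real_vector \<Rightarrow> 'v) \<Rightarrow> bool" where
  "complex_structure sc \<longleftrightarrow> vector_space sc \<and> (\<forall>r v. sc (complex_of_real r) v = r *\<^sub>R v)"

text \<open>Trace of an endomorphism \<open>f\<close> of a finite-dimensional subspace \<open>S\<close>, from an arbitrary basis.\<close>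

definition trace_on :: "('k::field \<Rightarrow> 'a::ab_group_add \<Rightarrow> 'a) \<Rightarrow> 'a set \<Rightarrow> ('a \<Rightarrow> 'a) \<Rightarrow> 'k" where
  "trace_on s S f =
    (let B = (SOME B. \<not> module.dependent s B \<and> module.span s B = S)
     in \<Sum>b\<in>B. module.representation s B (f b) b)"

definition inner_product :: "('a::real_vector \<Rightarrow> 'a \<Rightarrow> real) \<Rightarrow> bool" where
  "inner_product ip \<longleftrightarrow>
    bilinear ip \<and> (\<forall>x y. ip x y = ip y x) \<and> (\<forall>x. x \<noteq> 0 \<longrightarrow> ip x x > 0)"

text \<open>Linear in the first argument, conjugate-linear in the second.\<close>

definition hermitian_inner_product ::
    "(complex \<Rightarrow> 'v::real_vector \<Rightarrow> 'v) \<Rightarrow> ('v \<Rightarrow> 'v \<Rightarrow> complex) \<Rightarrow> bool" where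
  "hermitian_inner_product sc h \<longleftrightarrow>
    (\<forall>u v w. h (u + v) w = h u w + h v w) \<and>
    (\<forall>c v w. h (sc c v) w = c * h v w) \<and>
    (\<forall>v w. h w v = cnj (h v w)) \<and>
    (\<forall>v. v \<noteq> 0 \<longrightarrow> Re (h v v) > 0)"

text \<open>The transpose of \<open>A\<close>, regarded as an operator with domain the subspace \<open>S\<close>.\<close>

definition transpose_on ::
    "('v \<Rightarrow> 'v \<Rightarrow> real) \<Rightarrow> 'v set \<Rightarrow> ('v \<Rightarrow> 'v) \<Rightarrow> 'v \<Rightarrow> 'v" where
  "transpose_on ip S A w = (THE v. v \<in> S \<and> (\<forall>x\<in>S. ip (A x) w = ip x v))"

section \<open>Lie algebras\<close>

definition lie_algebra ::
    "('k::field \<Rightarrow> 'g::ab_group_add \<Rightarrow> 'g) \<Rightarrow> ('g \<Rightarrow> 'g \<Rightarrow> 'g) \<Rightarrow> bool" where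
  "lie_algebra s br \<longleftrightarrow>
    (\<forall>x. Vector_Spaces.linear s s (br x)) \<and>
    (\<forall>y. Vector_Spaces.linear s s (\<lambda>x. br x y)) \<and>
    (\<forall>x. br x x = 0) \<and>
    (\<forall>x y z. br x (br y z) + br y (br z x) + br z (br x y) = 0)"

definition killing_form ::
    "('k::field \<Rightarrow> 'g::ab_group_add \<Rightarrow> 'g) \<Rightarrow> ('g \<Rightarrow> 'g \<Rightarrow> 'g) \<Rightarrow> 'g \<Rightarrow> 'g \<Rightarrow> 'k" where
  "killing_form s br x y = trace_on s UNIV (\<lambda>z. br x (br y z))"

definition compact_semisimple :: "('u::real_vector \<Rightarrow> 'u \<Rightarrow> 'u) \<Rightarrow> bool" where
  "compact_semisimple br \<longleftrightarrow>
    lie_algebra scaleR br \<and> (\<exists>B. finite B \<and> span B = (UNIV :: 'u set)) \<and>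
    (\<forall>x. x \<noteq> 0 \<longrightarrow> killing_form scaleR br x x < 0)"

primrec lower_central ::
    "('k::field \<Rightarrow> 'g::ab_group_add \<Rightarrow> 'g) \<Rightarrow> ('g \<Rightarrow> 'g \<Rightarrow> 'g) \<Rightarrow> 'g set \<Rightarrow> nat \<Rightarrow> 'g set" where
  "lower_central s br \<hh> 0 = \<hh>"
| "lower_central s br \<hh> (Suc n) = module.span s {br x y | x y. x \<in> \<hh> \<and> y \<in> lower_central s br \<hh> n}"

text \<open>A Cartan subalgebra is a nilpotent, self-normalizing subalgebra.\<close>

definition cartan_subalgebra ::
    "('k::field \<Rightarrow> 'g::ab_group_add \<Rightarrow> 'g) \<Rightarrow> ('g \<Rightarrow> 'g \<Rightarrow> 'g) \<Rightarrow> 'g set \<Rightarrow> bool" where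
  "cartan_subalgebra s br \<hh> \<longleftrightarrow>
    module.subspace s \<hh> \<and> (\<forall>x\<in>\<hh>. \<forall>y\<in>\<hh>. br x y \<in> \<hh>) \<and>
    (\<exists>n. lower_central s br \<hh> n = {0}) \<and>
    {x. \<forall>y\<in>\<hh>. br x y \<in> \<hh>} = \<hh>"

definition lie_representation ::
    "('k::field \<Rightarrow> 'g::ab_group_add \<Rightarrow> 'g) \<Rightarrow> ('g \<Rightarrow> 'g \<Rightarrow> 'g) \<Rightarrow>
     ('k \<Rightarrow> 'v::ab_group_add \<Rightarrow> 'v) \<Rightarrow> ('g \<Rightarrow> 'v \<Rightarrow> 'v) \<Rightarrow> bool" where
  "lie_representation s br sc \<pi> \<longleftrightarrow>
    (\<forall>x. Vector_Spaces.linear sc sc (\<pi> x)) \<and>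
    (\<forall>v. Vector_Spaces.linear s sc (\<lambda>x. \<pi> x v)) \<and>
    (\<forall>x y v. \<pi> (br x y) v = \<pi> x (\<pi> y v) - \<pi> y (\<pi> x v))"

section \<open>Complexification and roots\<close>

text \<open>The complexification of \<open>'u\<close> is realized on \<open>'u \<times> 'u\<close>, the pair \<open>(x, y)\<close> standing for
  \<open>x \<otimes> 1 + y \<otimes> \<i>\<close>.\<close>

type_synonym 'u cplx = "'u \<times> 'u"

definition cscale :: "complex \<Rightarrow> 'u::real_vector cplx \<Rightarrow> 'u cplx" where
  "cscale c X =
    (Re c *\<^sub>R fst X - Im c *\<^sub>R snd X, Re c *\<^sub>R snd X + Im c *\<^sub>R fst X)"

lemma complex_structure_cscale: "complex_structure cscale"
  unfolding complex_structure_def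
  by (intro conjI, unfold_locales) (auto simp: cscale_def algebra_simps prod_eq_iff)

definition cbracket :: "('u::real_vector \<Rightarrow> 'u \<Rightarrow> 'u) \<Rightarrow> 'u cplx \<Rightarrow> 'u cplx \<Rightarrow> 'u cplx" where
  "cbracket br X Y =
    (br (fst X) (fst Y) - br (snd X) (snd Y), br (fst X) (snd Y) + br (snd X) (fst Y))"

definition cembed :: "'u::real_vector \<Rightarrow> 'u cplx" where
  "cembed x = (x, 0)"

abbreviation ckilling :: "('u::real_vector \<Rightarrow> 'u \<Rightarrow> 'u) \<Rightarrow> 'u cplx \<Rightarrow> 'u cplx \<Rightarrow> complex" where
  "ckilling br \<equiv> killing_form cscale (cbracket br)"

text \<open>Elements of the complex dual of \<open>\<hh>\<close> are extended by \<open>0\<close> outside \<open>\<hh>\<close>, so that equality of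
  functions is equality of functionals.\<close>

definition dual_on :: "'u::real_vector cplx set \<Rightarrow> ('u cplx \<Rightarrow> complex) set" where
  "dual_on \<hh> = {\<mu>.
    (\<forall>x\<in>\<hh>. \<forall>y\<in>\<hh>. \<mu> (x + y) = \<mu> x + \<mu> y) \<and>
    (\<forall>c. \<forall>x\<in>\<hh>. \<mu> (cscale c x) = c * \<mu> x) \<and>
    (\<forall>x. x \<notin> \<hh> \<longrightarrow> \<mu> x = 0)}"

definition root_space ::
    "('u::real_vector \<Rightarrow> 'u \<Rightarrow> 'u) \<Rightarrow> 'u cplx set \<Rightarrow> ('u cplx \<Rightarrow> complex) \<Rightarrow> 'u cplx set" where
  "root_space br \<hh> \<alpha> = {X. \<forall>H\<in>\<hh>. cbracket br H X = cscale (\<alpha> H) X}"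

definition roots ::
    "('u::real_vector \<Rightarrow> 'u \<Rightarrow> 'u) \<Rightarrow> 'u cplx set \<Rightarrow> ('u cplx \<Rightarrow> complex) set" where
  "roots br \<hh> = {\<alpha> \<in> dual_on \<hh>. \<alpha> \<noteq> (\<lambda>_. 0) \<and> root_space br \<hh> \<alpha> \<noteq> {0}}"

abbreviation (input) fneg :: "('a \<Rightarrow> complex) \<Rightarrow> 'a \<Rightarrow> complex" where
  "fneg \<alpha> \<equiv> (\<lambda>H. - \<alpha> H)"

abbreviation (input) fadd :: "('a \<Rightarrow> complex) \<Rightarrow> ('a \<Rightarrow> complex) \<Rightarrow> 'a \<Rightarrow> complex" where
  "fadd \<alpha> \<beta> \<equiv> (\<lambda>H. \<alpha> H + \<beta> H)"

definition positive_system ::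
    "('u::real_vector \<Rightarrow> 'u \<Rightarrow> 'u) \<Rightarrow> 'u cplx set \<Rightarrow> ('u cplx \<Rightarrow> complex) set \<Rightarrow> bool" where
  "positive_system br \<hh> P \<longleftrightarrow>
    P \<subseteq> roots br \<hh> \<and>
    (\<forall>\<alpha>\<in>roots br \<hh>. \<alpha> \<in> P \<longleftrightarrow> fneg \<alpha> \<notin> P) \<and>
    (\<forall>\<alpha>\<in>P. \<forall>\<beta>\<in>P. fadd \<alpha> \<beta> \<in> roots br \<hh> \<longrightarrow> fadd \<alpha> \<beta> \<in> P)"

definition dual_vector ::
    "('u::real_vector \<Rightarrow> 'u \<Rightarrow> 'u) \<Rightarrow> 'u cplx set \<Rightarrow> ('u cplx \<Rightarrow> complex) \<Rightarrow> 'u cplx" where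
  "dual_vector br \<hh> \<mu> = (THE H. H \<in> \<hh> \<and> (\<forall>H'\<in>\<hh>. ckilling br H' H = \<mu> H'))"

definition real_cartan :: "('u::real_vector \<Rightarrow> 'u \<Rightarrow> 'u) \<Rightarrow> 'u cplx set \<Rightarrow> 'u cplx set" where
  "real_cartan br \<hh> = span (dual_vector br \<hh> ` roots br \<hh>)"

text \<open>The real dual of \<^const>\<open>real_cartan\<close>, each real functional being identified with its
  complex-linear extension to \<open>\<hh>\<close>.\<close>

definition real_dual ::
    "('u::real_vector \<Rightarrow> 'u \<Rightarrow> 'u) \<Rightarrow> 'u cplx set \<Rightarrow> ('u cplx \<Rightarrow> complex) set" where
  "real_dual br \<hh> = {\<mu> \<in> dual_on \<hh>. \<forall>H\<in>real_cartan br \<hh>. \<mu> H \<in> \<real>}"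

text \<open>On the real dual, the bilinear form whose values on roots are \<open>B(H\<^sub>\<alpha>, H\<^sub>\<beta>)\<close>; these values
  are real.\<close>

definition dual_inner ::
    "('u::real_vector \<Rightarrow> 'u \<Rightarrow> 'u) \<Rightarrow> 'u cplx set \<Rightarrow>
     ('u cplx \<Rightarrow> complex) \<Rightarrow> ('u cplx \<Rightarrow> complex) \<Rightarrow> real" where
  "dual_inner br \<hh> \<mu> \<nu> = Re (ckilling br (dual_vector br \<hh> \<mu>) (dual_vector br \<hh> \<nu>))"

text \<open>Connectedness refers to the topology of pointwise convergence, which on this
  finite-dimensional space of functionals is the usual topology.\<close>

definition weyl_chamber ::
    "('u::real_vector \<Rightarrow> 'u \<Rightarrow> 'u) \<Rightarrow> 'u cplx set \<Rightarrow> ('u cplx \<Rightarrow> complex) set \<Rightarrow> bool" where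
  "weyl_chamber br \<hh> C \<longleftrightarrow>
    C \<in> components (real_dual br \<hh> -
      (\<Union>\<alpha>\<in>roots br \<hh>. {\<mu> \<in> real_dual br \<hh>. dual_inner br \<hh> \<mu> \<alpha> = 0}))"

text \<open>Root vectors normalized as usual and adapted to the compact real form \<open>'u\<close>, which is
  embedded in its complexification as the range of \<^const>\<open>cembed\<close>.\<close>

definition adapted_root_vectors ::
    "('u::real_vector \<Rightarrow> 'u \<Rightarrow> 'u) \<Rightarrow> 'u cplx set \<Rightarrow>
     (('u cplx \<Rightarrow> complex) \<Rightarrow> 'u cplx) \<Rightarrow> bool" where
  "adapted_root_vectors br \<hh> X \<longleftrightarrow>
    (\<forall>\<alpha>\<in>roots br \<hh>. X \<alpha> \<in> root_space br \<hh> \<alpha> \<and> X \<alpha> \<noteq> 0 \<and>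
      cbracket br (X \<alpha>) (X (fneg \<alpha>)) = dual_vector br \<hh> \<alpha>) \<and>
    (\<exists>N :: _ \<Rightarrow> _ \<Rightarrow> real. \<forall>\<alpha>\<in>roots br \<hh>. \<forall>\<beta>\<in>roots br \<hh>. fadd \<alpha> \<beta> \<in> roots br \<hh> \<longrightarrow>
      cbracket br (X \<alpha>) (X \<beta>) = N \<alpha> \<beta> *\<^sub>R X (fadd \<alpha> \<beta>) \<and>
      N \<alpha> \<beta> = - N (fneg \<alpha>) (fneg \<beta>)) \<and>
    (\<forall>\<alpha>\<in>roots br \<hh>. \<forall>\<beta>\<in>roots br \<hh>. fadd \<alpha> \<beta> \<noteq> (\<lambda>_. 0) \<and> fadd \<alpha> \<beta> \<notin> roots br \<hh> \<longrightarrow>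
      cbracket br (X \<alpha>) (X \<beta>) = 0) \<and>
    range cembed = span (\<Union>\<alpha>\<in>roots br \<hh>.
      {cscale \<i> (dual_vector br \<hh> \<alpha>), X \<alpha> - X (fneg \<alpha>), cscale \<i> (X \<alpha> + X (fneg \<alpha>))})"

text \<open>The vectors \<open>X\<^sup>\<alpha>\<close>, \<open>Y\<^sup>\<alpha>\<close> and the space \<open>\<i>\<hh>\<^sub>\<real>\<close> as elements, resp. as a subset, of \<open>'u\<close> itself;
  \<^const>\<open>fst\<close> inverts \<^const>\<open>cembed\<close> on its range.\<close>

definition root_X ::
    "(('u::real_vector cplx \<Rightarrow> complex) \<Rightarrow> 'u cplx) \<Rightarrow> ('u cplx \<Rightarrow> complex) \<Rightarrow> 'u" where
  "root_X X \<alpha> = fst (X \<alpha> - X (fneg \<alpha>))"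

definition root_Y ::
    "(('u::real_vector cplx \<Rightarrow> complex) \<Rightarrow> 'u cplx) \<Rightarrow> ('u cplx \<Rightarrow> complex) \<Rightarrow> 'u" where
  "root_Y X \<alpha> = fst (cscale \<i> (X \<alpha> + X (fneg \<alpha>)))"

definition compact_torus :: "('u::real_vector \<Rightarrow> 'u \<Rightarrow> 'u) \<Rightarrow> 'u cplx set \<Rightarrow> 'u set" where
  "compact_torus br \<hh> = {x. cembed x \<in> cscale \<i> ` real_cartan br \<hh>}"

section \<open>Weights\<close>

definition weight_space ::
    "(complex \<Rightarrow> 'v::real_vector \<Rightarrow> 'v) \<Rightarrow> ('u::real_vector cplx \<Rightarrow> 'v \<Rightarrow> 'v) \<Rightarrow> 'u cplx set \<Rightarrow>
     ('u cplx \<Rightarrow> complex) \<Rightarrow> 'v set" where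
  "weight_space sc \<pi> \<hh> \<mu> = {v. \<forall>H\<in>\<hh>. \<pi> H v = sc (\<mu> H) v}"

definition weights ::
    "(complex \<Rightarrow> 'v::real_vector \<Rightarrow> 'v) \<Rightarrow> ('u::real_vector cplx \<Rightarrow> 'v \<Rightarrow> 'v) \<Rightarrow> 'u cplx set \<Rightarrow>
     ('u cplx \<Rightarrow> complex) set" where
  "weights sc \<pi> \<hh> = {\<mu> \<in> dual_on \<hh>. weight_space sc \<pi> \<hh> \<mu> \<noteq> {0}}"

definition other_weight_spaces ::
    "(complex \<Rightarrow> 'v::real_vector \<Rightarrow> 'v) \<Rightarrow> ('u::real_vector cplx \<Rightarrow> 'v \<Rightarrow> 'v) \<Rightarrow> 'u cplx set \<Rightarrow>
     ('u cplx \<Rightarrow> complex) \<Rightarrow> 'v set" where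
  "other_weight_spaces sc \<pi> \<hh> \<mu>0 =
    module.span sc (\<Union>\<mu>\<in>weights sc \<pi> \<hh> - {\<mu>0}. weight_space sc \<pi> \<hh> \<mu>)"

definition direct_sum_decomposition :: "'v::real_vector set \<Rightarrow> 'v set \<Rightarrow> bool" where
  "direct_sum_decomposition V1 V2 \<longleftrightarrow>
    subspace V1 \<and> subspace V2 \<and> V1 \<inter> V2 = {0} \<and> {v + w | v w. v \<in> V1 \<and> w \<in> V2} = UNIV"

section \<open>The six properties\<close>

text \<open>Here \<open>\<rho>\<close> is a real representation of \<open>'u\<close>, \<open>T\<close> is \<open>\<i>\<hh>\<^sub>\<real>\<close>, \<open>P\<close> is the set of positive roots, and \<open>X\<close>, \<open>Y\<close>
  are the families \<open>X\<^sup>\<alpha>\<close>, \<open>Y\<^sup>\<alpha>\<close>.\<close>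

definition six_properties ::
    "('u::real_vector \<Rightarrow> 'v::real_vector \<Rightarrow> 'v) \<Rightarrow> 'v set \<Rightarrow> 'v set \<Rightarrow> ('v \<Rightarrow> 'v \<Rightarrow> real) \<Rightarrow>
     'u set \<Rightarrow> 'r set \<Rightarrow> ('r \<Rightarrow> 'u) \<Rightarrow> ('r \<Rightarrow> 'u) \<Rightarrow> bool" where
  "six_properties \<rho> V1 V2 ip T P X Y \<longleftrightarrow>
    (\<forall>H\<in>T. \<rho> H ` V1 \<subseteq> V1 \<and> \<rho> H ` V2 \<subseteq> V2) \<and>
    (\<forall>\<alpha>\<in>P. \<rho> (X \<alpha>) ` V1 \<subseteq> V2 \<and> \<rho> (Y \<alpha>) ` V1 \<subseteq> V2) \<and>
    (\<forall>v\<in>V1. \<forall>w\<in>V2. ip v w = 0) \<and>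
    (\<forall>H\<in>T. \<forall>v w. ip (\<rho> H v) w = - ip v (\<rho> H w)) \<and>
    (\<forall>\<alpha>\<in>P. (\<exists>v\<in>V1. \<rho> (X \<alpha>) v \<noteq> 0) \<and> (\<exists>v\<in>V1. \<rho> (Y \<alpha>) v \<noteq> 0)) \<and>
    (\<forall>A \<in> X ` P \<union> Y ` P. \<forall>B \<in> X ` P \<union> Y ` P. A \<noteq> B \<longrightarrow>
      trace_on scaleR V1 (\<lambda>v. transpose_on ip V1 (\<rho> B) (\<rho> A v)) = 0)"

section \<open>The semidirect product and its Ricci curvature\<close>

text \<open>The triple \<open>(a, x, v)\<close> stands for \<open>a Z + x + v\<close>.\<close>

definition semidirect_bracket ::
    "('u::real_vector \<Rightarrow> 'u \<Rightarrow> 'u) \<Rightarrow> ('u \<Rightarrow> 'v::real_vector \<Rightarrow> 'v) \<Rightarrow>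
     real \<times> 'u \<times> 'v \<Rightarrow> real \<times> 'u \<times> 'v \<Rightarrow> real \<times> 'u \<times> 'v" where
  "semidirect_bracket br \<rho> = (\<lambda>(a, x, v) (b, y, w).
    (0, br x y, a *\<^sub>R w - b *\<^sub>R v + \<rho> x w - \<rho> y v))"

text \<open>Curvature of the left-invariant metric determined by \<open>ip\<close> on the simply connected group with
  Lie algebra \<open>(\<gg>, br)\<close>, computed on left-invariant vector fields, which are identified with
  \<open>\<gg>\<close>. The covariant derivative of a left-invariant field along another one is left-invariant,
  and inner products of left-invariant fields are constant functions, so compatibility of the
  connection with the metric says that each covariant derivative is skew-symmetric.\<close>

definition levi_civita ::
    "('g::real_vector \<Rightarrow> 'g \<Rightarrow> 'g) \<Rightarrow> ('g \<Rightarrow> 'g \<Rightarrow> real) \<Rightarrow> 'g \<Rightarrow> 'g \<Rightarrow> 'g" where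
  "levi_civita br ip = (THE D. bilinear D \<and>
    (\<forall>X Y. D X Y - D Y X = br X Y) \<and>
    (\<forall>X Y Z. ip (D X Y) Z + ip Y (D X Z) = 0))"

definition curvature ::
    "('g::real_vector \<Rightarrow> 'g \<Rightarrow> 'g) \<Rightarrow> ('g \<Rightarrow> 'g \<Rightarrow> real) \<Rightarrow> 'g \<Rightarrow> 'g \<Rightarrow> 'g \<Rightarrow> 'g" where
  "curvature br ip X Y W = (let D = levi_civita br ip in
    D X (D Y W) - D Y (D X W) - D (br X Y) W)"

definition ricci_form ::
    "('g::real_vector \<Rightarrow> 'g \<Rightarrow> 'g) \<Rightarrow> ('g \<Rightarrow> 'g \<Rightarrow> real) \<Rightarrow> 'g \<Rightarrow> 'g \<Rightarrow> real" where
  "ricci_form br ip X Y = trace_on scaleR UNIV (\<lambda>W. curvature br ip W X Y)"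

definition ricci_operator ::
    "('g::real_vector \<Rightarrow> 'g \<Rightarrow> 'g) \<Rightarrow> ('g \<Rightarrow> 'g \<Rightarrow> real) \<Rightarrow> 'g \<Rightarrow> 'g" where
  "ricci_operator br ip X = (THE W. \<forall>Y. ip W Y = ricci_form br ip X Y)"

definition negative_ricci ::
    "('g::real_vector \<Rightarrow> 'g \<Rightarrow> 'g) \<Rightarrow> ('g \<Rightarrow> 'g \<Rightarrow> real) \<Rightarrow> bool" where
  "negative_ricci br ip \<longleftrightarrow> (\<forall>X. X \<noteq> 0 \<longrightarrow> ip (ricci_operator br ip X) X < 0)"

end

theory Submission
  imports Defs "HOL-Computational_Algebra.Fundamental_Theorem_Algebra"
begin

text \<open>Write \<open>T\<close> for the torus \<open>\<i>\<hh>\<^sub>\<real>\<close> inside \<open>\<uu>\<close> and \<open>Q\<close> for the real span of the vectors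
  \<open>X\<^sup>\<alpha>\<close>, \<open>Y\<^sup>\<alpha>\<close>, so that \<open>\<uu> = T \<oplus> Q\<close>.

  Structure of the representation. Compactness of \<open>\<uu>\<close> makes the Killing form of the complexification
  nondegenerate, and from this the facts on roots follow: \<open>- \<alpha>\<close> is a root together with \<open>\<alpha>\<close>
  (lemma \<open>neg_root\<close>), the vectors \<open>H\<^sub>\<alpha>\<close> span \<open>\<hh>\<close> (\<open>h_span\<close>), and \<open>\<alpha>(H\<^sub>\<alpha>) > 0\<close>. Every \<open>H\<^sub>\<alpha>\<close> is
  therefore the semisimple element of an \<open>sl2\<close>-triple, hence acts diagonalizably on \<open>V\<close>
  (\<open>sl2_diagonalizable\<close>), and \<open>V\<close> is the direct sum of its weight spaces. That \<open>\<mu>0\<close> lies in a Weyl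
  chamber means \<open>\<mu>0(H\<^sub>\<alpha>) \<noteq> 0\<close> for every root. Since \<open>H\<^sub>\<alpha> = [X\<^sub>\<alpha>, X\<^sub>-\<^sub>\<alpha>]\<close>, a nonzero vector of \<open>V(\<mu>0)\<close>
  cannot be killed by both \<open>X\<^sub>\<alpha>\<close> and \<open>X\<^sub>-\<^sub>\<alpha>\<close> (\<open>X_faithful\<close>). The six properties express this, the rule
  that \<open>X\<^sub>\<alpha>\<close> shifts weights by \<open>\<alpha>\<close>, and the orthogonality of distinct weight spaces.

  The metric. For a left-invariant metric the Ricci form is
  \<open>Ric(x, x) = - |sym (ad x)|\<^sup>2 + (1/4) \<Sum> \<langle>[e\<^sub>i, e\<^sub>j], x\<rangle>\<^sup>2 - \<langle>[H, x], x\<rangle>\<close>, where \<open>H\<close> represents the linear form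
  \<open>tr ad\<close> (\<open>Ric_formula\<close>). On the semidirect product \<open>H\<close> is a multiple of \<open>Z\<close>, and shortening \<open>Z\<close> makes
  \<open>Ric\<close> as negative as desired on \<open>V\<close>; the direction of \<open>Z\<close> is negative in any case. It remains to
  choose the metrics on \<open>\<uu>\<close> and \<open>V\<close> so that
  \<open>|sym (ad x)|\<^sup>2 + |sym \<rho>(x)|\<^sup>2 > (1/4) \<Sum> \<langle>[e\<^sub>i, e\<^sub>j], x\<rangle>\<^sup>2\<close> for \<open>x \<noteq> 0\<close> in \<open>\<uu>\<close> (\<open>negative_ricci_exists\<close>).
  On \<open>T\<close> this is arranged by giving \<open>X\<^sup>\<alpha>\<close> and \<open>Y\<^sup>\<alpha>\<close> different lengths, so that \<open>ad H\<close> is no longer skew,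
  and by shrinking \<open>T\<close>, which makes the right hand side negligible there. On \<open>Q\<close> it is arranged by
  stretching \<open>V\<^sub>2\<close> relative to \<open>V\<^sub>1\<close>: the block of \<open>\<rho>(q)\<close> from \<open>V\<^sub>1\<close> to \<open>V\<^sub>2\<close>, which determines \<open>q\<close>, then
  dominates. A version of Finsler's lemma combines the two (\<open>negative_ricci_metric\<close>).\<close>

section \<open>Traces\<close>

text \<open>A resolution of the identity of \<open>S\<close>: vectors \<open>e i\<close> with linear functionals \<open>\<phi> i\<close> on \<open>S\<close> such that
  \<open>x = \<Sum> \<phi> i x e i\<close>. Bases with their coordinates and orthonormal bases are instances, and so is the image
  of a real basis in the complexification; this lets one lemma evaluate all traces below.\<close>

definition resolves :: "('k::field \<Rightarrow> 'a::ab_group_add \<Rightarrow> 'a) \<Rightarrow> 'a set \<Rightarrow> 'i set \<Rightarrow> ('i \<Rightarrow> 'a \<Rightarrow> 'k) \<Rightarrow> ('i \<Rightarrow> 'a) \<Rightarrow> bool" where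
  "resolves s S I \<phi> e \<longleftrightarrow> finite I \<and> module.subspace s S \<and> (\<forall>i\<in>I. e i \<in> S) \<and>
    (\<forall>i\<in>I. \<forall>x\<in>S. \<forall>y\<in>S. \<phi> i (x + y) = \<phi> i x + \<phi> i y) \<and>
    (\<forall>i\<in>I. \<forall>c. \<forall>x\<in>S. \<phi> i (s c x) = c * \<phi> i x) \<and>
    (\<forall>x\<in>S. (\<Sum>i\<in>I. s (\<phi> i x) (e i)) = x)"

definition endo_on :: "('k \<Rightarrow> 'a::ab_group_add \<Rightarrow> 'a) \<Rightarrow> 'a set \<Rightarrow> ('a \<Rightarrow> 'a) \<Rightarrow> bool" where
  "endo_on s S f \<longleftrightarrow> (\<forall>x\<in>S. f x \<in> S) \<and>
    (\<forall>x\<in>S. \<forall>y\<in>S. f (x + y) = f x + f y) \<and> (\<forall>c. \<forall>x\<in>S. f (s c x) = s c (f x))"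

lemma endo_on_comp: "endo_on s S f \<Longrightarrow> endo_on s S g \<Longrightarrow> endo_on s S (\<lambda>x. f (g x))"
  by (auto simp: endo_on_def)

context vector_space
begin

lemma endo_onD:
  fixes S :: "'b set"
  assumes "endo_on scale S f"
  shows "x \<in> S \<Longrightarrow> f x \<in> S" "x \<in> S \<Longrightarrow> y \<in> S \<Longrightarrow> f (x + y) = f x + f y"
    "x \<in> S \<Longrightarrow> f (scale c x) = scale c (f x)"
  using assms by (auto simp: endo_on_def)

lemma resolvesD:
  fixes S :: "'b set"
  assumes "resolves scale S I \<phi> e"
  shows "finite I" "subspace S" "i \<in> I \<Longrightarrow> e i \<in> S"
    "i \<in> I \<Longrightarrow> x \<in> S \<Longrightarrow> y \<in> S \<Longrightarrow> \<phi> i (x + y) = \<phi> i x + \<phi> i y"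
    "i \<in> I \<Longrightarrow> x \<in> S \<Longrightarrow> \<phi> i (scale c x) = c * \<phi> i x"
    "x \<in> S \<Longrightarrow> (\<Sum>i\<in>I. scale (\<phi> i x) (e i)) = x"
  using assms by (auto simp: resolves_def)

lemma endo_on_sum:
  assumes f: "endo_on scale S f" and S: "subspace S" and J: "\<And>j. j \<in> J \<Longrightarrow> w j \<in> S"
  shows "f (\<Sum>j\<in>J. scale (c j) (w j)) = (\<Sum>j\<in>J. scale (c j) (f (w j)))"
proof (cases "finite J")
  case True
  then show ?thesis using J
  proof (induction J rule: finite_induct)
    case empty
    have "f (scale 0 0) = scale 0 (f 0)" using endo_onD(3)[OF f] subspace_0[OF S] by blast
    then show ?case by simp
  next
    case (insert j J)
    have "(\<Sum>j\<in>J. scale (c j) (w j)) \<in> S"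
      using insert.prems S by (intro subspace_sum) (auto intro: subspace_scale)
    then show ?case using insert endo_onD[OF f] S
      by (simp add: subspace_scale)
  qed
next
  case False
  have "f (scale 0 0) = scale 0 (f 0)" using endo_onD(3)[OF f] subspace_0[OF S] by blast
  then show ?thesis using False by simp
qed

lemma resolves_sum:
  assumes r: "resolves scale S I \<phi> e" and i: "i \<in> I" and J: "\<And>j. j \<in> J \<Longrightarrow> w j \<in> S"
  shows "\<phi> i (\<Sum>j\<in>J. scale (c j) (w j)) = (\<Sum>j\<in>J. c j * \<phi> i (w j))"
proof -
  note S = resolvesD(2)[OF r]
  have z: "\<phi> i 0 = 0"
    using resolvesD(5)[OF r i subspace_0[OF S], of 0] by simp
  show ?thesis
  proof (cases "finite J")
    case True
    then show ?thesis using J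
    proof (induction J rule: finite_induct)
      case (insert j J)
      have "(\<Sum>j\<in>J. scale (c j) (w j)) \<in> S"
        using insert.prems S by (intro subspace_sum) (auto intro: subspace_scale)
      then show ?case using insert resolvesD[OF r] i
        by (simp add: subspace_scale)
    qed (simp add: z)
  qed (simp add: z)
qed

lemma resolves_basis:
  assumes "finite G" "span G = UNIV" "subspace S"
  obtains B where "finite B" "independent B" "span B = S"
    "resolves scale S B (\<lambda>b x. representation B x b) (\<lambda>b. b)"
proof -
  obtain B where B: "B \<subseteq> S" "independent B" "S \<subseteq> span B"
    using maximal_independent_subset[of S] by blast
  have fin: "finite B"
    using independent_span_bound[of G B] assms B by auto
  have sp: "span B = S" using B assms(3) by (simp add: span_minimal subset_antisym)
  have "resolves scale S B (\<lambda>b x. representation B x b) (\<lambda>b. b)"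
    unfolding resolves_def using fin assms(3) B sp
    by (auto simp: representation_add representation_scale sum_representation_eq)
  then show ?thesis using that fin B(2) sp by blast
qed

text \<open>Expanding each vector of the chosen basis through the resolution and exchanging the two sums
  turns the trace in that basis into the trace read off from the resolution.\<close>

lemma trace_on_resolves:
  assumes r: "resolves scale S I \<phi> e" and f: "endo_on scale S f"
  shows "trace_on scale S f = (\<Sum>i\<in>I. \<phi> i (f (e i)))"
proof -
  note S = resolvesD(2)[OF r]
  define B where "B = (SOME B. independent B \<and> span B = S)"
  obtain B0 where "B0 \<subseteq> S" "independent B0" "S \<subseteq> span B0"
    using maximal_independent_subset[of S] by blast
  then have "\<exists>B. independent B \<and> span B = S"
    using span_minimal[OF _ S, of B0] by blast
  from someI_ex[OF this] have B: "independent B" "span B = S"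
    unfolding B_def by auto
  have BS: "b \<in> S" if "b \<in> B" for b using span_base[OF that] B(2) by simp
  have "S \<subseteq> span (e ` I)"
  proof
    fix x assume "x \<in> S"
    then have "x = (\<Sum>i\<in>I. scale (\<phi> i x) (e i))" using resolvesD(6)[OF r] by simp
    also have "\<dots> \<in> span (e ` I)" by (intro span_sum span_scale span_base) auto
    finally show "x \<in> span (e ` I)" .
  qed
  then have "B \<subseteq> span (e ` I)" using BS by blast
  then have fin: "finite B"
    using independent_span_bound[of "e ` I" B] resolvesD(1)[OF r] B(1) by simp
  have fe: "f (e i) \<in> S" if "i \<in> I" for i using that endo_onD(1)[OF f] resolvesD(3)[OF r] by blast
  have "trace_on scale S f = (\<Sum>b\<in>B. representation B (f b) b)"
    unfolding trace_on_def B_def Let_def ..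
  also have "\<dots> = (\<Sum>b\<in>B. \<Sum>i\<in>I. \<phi> i b * representation B (f (e i)) b)"
  proof (rule sum.cong[OF refl])
    fix b assume b: "b \<in> B"
    have "f b = f (\<Sum>i\<in>I. scale (\<phi> i b) (e i))" using resolvesD(6)[OF r BS[OF b]] by simp
    also have "\<dots> = (\<Sum>i\<in>I. scale (\<phi> i b) (f (e i)))"
      by (rule endo_on_sum[OF f S]) (rule resolvesD(3)[OF r])
    finally have "representation B (f b) b = representation B (\<Sum>i\<in>I. scale (\<phi> i b) (f (e i))) b" by simp
    also have "\<dots> = (\<Sum>i\<in>I. representation B (scale (\<phi> i b) (f (e i))) b)"
      using B fe S by (subst representation_sum) (auto simp: subspace_scale)
    also have "\<dots> = (\<Sum>i\<in>I. \<phi> i b * representation B (f (e i)) b)"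
      using B fe by (intro sum.cong) (auto simp: representation_scale)
    finally show "representation B (f b) b = \<dots>" .
  qed
  also have "\<dots> = (\<Sum>i\<in>I. \<Sum>b\<in>B. representation B (f (e i)) b * \<phi> i b)"
    by (subst sum.swap) (simp add: mult.commute)
  also have "\<dots> = (\<Sum>i\<in>I. \<phi> i (\<Sum>b\<in>B. scale (representation B (f (e i)) b) b))"
    by (intro sum.cong refl) (simp add: resolves_sum[OF r] BS)
  also have "\<dots> = (\<Sum>i\<in>I. \<phi> i (f (e i)))"
  proof (rule sum.cong[OF refl])
    fix i assume "i \<in> I"
    then have "f (e i) \<in> span B" using fe B(2) by simp
    from sum_representation_eq[OF B(1) this fin order_refl]
    show "\<phi> i (\<Sum>b\<in>B. scale (representation B (f (e i)) b) b) = \<phi> i (f (e i))" by simp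
  qed
  finally show ?thesis .
qed


lemma trace_on_commute:
  assumes r: "resolves scale S I \<phi> e" and f: "endo_on scale S f" and g: "endo_on scale S g"
  shows "trace_on scale S (\<lambda>x. f (g x)) = trace_on scale S (\<lambda>x. g (f x))"
proof -
  have *: "trace_on scale S (\<lambda>x. f (g x)) = (\<Sum>i\<in>I. \<Sum>j\<in>I. \<phi> j (g (e i)) * \<phi> i (f (e j)))"
    if f: "endo_on scale S f" and g: "endo_on scale S g" for f g
  proof -
    have "\<phi> i (f (g (e i))) = (\<Sum>j\<in>I. \<phi> j (g (e i)) * \<phi> i (f (e j)))" if i: "i \<in> I" for i
    proof -
      have "g (e i) \<in> S" using endo_onD(1)[OF g] resolvesD(3)[OF r i] by blast
      then have "f (g (e i)) = f (\<Sum>j\<in>I. scale (\<phi> j (g (e i))) (e j))"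
        using resolvesD(6)[OF r] by simp
      also have "\<dots> = (\<Sum>j\<in>I. scale (\<phi> j (g (e i))) (f (e j)))"
        by (rule endo_on_sum[OF f resolvesD(2)[OF r]]) (rule resolvesD(3)[OF r])
      also have "\<phi> i (\<Sum>j\<in>I. scale (\<phi> j (g (e i))) (f (e j))) = (\<Sum>j\<in>I. \<phi> j (g (e i)) * \<phi> i (f (e j)))"
        by (rule resolves_sum[OF r i]) (intro endo_onD(1)[OF f] resolvesD(3)[OF r])
      finally show ?thesis .
    qed
    then show ?thesis
      unfolding trace_on_resolves[OF r endo_on_comp[OF f g]] by simp
  qed
  show ?thesis
    unfolding *[OF f g] *[OF g f] by (subst sum.swap) (simp add: mult.commute)
qed

lemma trace_on_diff:
  assumes r: "resolves scale S I \<phi> e" and f: "endo_on scale S f" and g: "endo_on scale S g"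
  shows "trace_on scale S (\<lambda>x. f x - g x) = trace_on scale S f - trace_on scale S g"
proof -
  have l: "endo_on scale S (\<lambda>x. f x - g x)" using f g resolvesD(2)[OF r]
    by (auto simp: endo_on_def subspace_diff scale_right_diff_distrib)
  have "\<phi> i (f (e i) - g (e i)) = \<phi> i (f (e i)) - \<phi> i (g (e i))" if i: "i \<in> I" for i
  proof -
    have m: "f (e i) - g (e i) \<in> S" "g (e i) \<in> S" "f (e i) \<in> S"
      using endo_onD(1)[OF f] endo_onD(1)[OF g] resolvesD(2,3)[OF r] i by (auto intro: subspace_diff)
    have "\<phi> i ((f (e i) - g (e i)) + g (e i)) = \<phi> i (f (e i) - g (e i)) + \<phi> i (g (e i))"
      using resolvesD(4)[OF r i] m by blast
    then show ?thesis by simp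
  qed
  then show ?thesis
    by (simp add: trace_on_resolves[OF r l] trace_on_resolves[OF r f] trace_on_resolves[OF r g] sum_subtractf)
qed

lemma endo_on_UNIV: "Vector_Spaces.linear scale scale f \<Longrightarrow> endo_on scale UNIV f"
proof -
  assume "Vector_Spaces.linear scale scale f"
  then interpret Vector_Spaces.linear scale scale f .
  show ?thesis by (simp add: endo_on_def add scale)
qed

section \<open>The Killing form\<close>

lemma lie_algebraD:
  assumes "lie_algebra scale br"
  shows "br x (y + z) = br x y + br x z" "br x (scale c y) = scale c (br x y)"
    "br (x + y) z = br x z + br y z" "br (scale c x) y = scale c (br x y)"
    "br x x = 0" "br x y = - br y x" "br (br x y) z = br x (br y z) - br y (br x z)"
    "br 0 y = 0" "br x 0 = 0" "br (- x) y = - br x y" "br x (- y) = - br x y"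
    "br (x - y) z = br x z - br y z" "br x (y - z) = br x y - br x z"
    "br x (br y z) = br (br x y) z + br y (br x z)"
proof -
  interpret L: Vector_Spaces.linear scale scale "br x" for x using assms by (simp add: lie_algebra_def)
  interpret R: Vector_Spaces.linear scale scale "\<lambda>x. br x y" for y using assms by (simp add: lie_algebra_def)
  show "br x (y + z) = br x y + br x z" "br x (scale c y) = scale c (br x y)"
    by (simp_all add: L.add L.scale)
  show add: "br (x + y) z = br x z + br y z" and "br (scale c x) y = scale c (br x y)" for x y z
    by (simp_all add: R.add R.scale)
  show alt: "br x x = 0" for x using assms by (simp add: lie_algebra_def)
  have sk': "br x y + br y x = 0" for x y
    using alt[of "x + y"] unfolding add L.add by (simp add: alt add.commute)
  then show sk: "br x y = - br y x" for x y by (simp add: eq_neg_iff_add_eq_0)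
  have J: "br x (br y z) + br y (br z x) + br z (br x y) = 0"
    using assms unfolding lie_algebra_def by blast
  have "br y (br z x) = - br y (br x z)" using sk[of z x] L.neg by metis
  moreover have "br z (br x y) = - br (br x y) z" using sk by blast
  ultimately show "br (br x y) z = br x (br y z) - br y (br x z)"
    using J by (simp add: algebra_simps)
  then show "br x (br y z) = br (br x y) z + br y (br x z)" by simp
  show "br 0 y = 0" "br x 0 = 0" "br (- x) y = - br x y" "br x (- y) = - br x y"
    "br (x - y) z = br x z - br y z" "br x (y - z) = br x y - br x z"
    by (simp_all add: L.zero R.zero L.neg R.neg L.diff R.diff)
qed

lemma lie_endo_on:
  assumes "lie_algebra scale br"
  shows "endo_on scale UNIV (br x)" 
  using assms by (intro endo_on_UNIV) (simp add: lie_algebra_def)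

lemma killing_form_sym:
  assumes "lie_algebra scale br" and G: "finite G" "span G = UNIV"
  shows "killing_form scale br x y = killing_form scale br y x"
proof -
  obtain B where r: "resolves scale UNIV B (\<lambda>b x. representation B x b) (\<lambda>b. b)"
    using resolves_basis[OF G subspace_UNIV] by blast
  show ?thesis unfolding killing_form_def
    by (rule trace_on_commute[OF r lie_endo_on[OF assms(1), of x] lie_endo_on[OF assms(1), of y]])
qed

text \<open>Both sides are \<open>tr (x y z) - tr (y x z)\<close> up to a cyclic permutation of the factors.\<close>

lemma killing_form_invariant:
  assumes L: "lie_algebra scale br" and G: "finite G" "span G = UNIV"
  shows "killing_form scale br (br x y) z = killing_form scale br x (br y z)"
proof -
  obtain B where r: "resolves scale UNIV B (\<lambda>b x. representation B x b) (\<lambda>b. b)"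
    using resolves_basis[OF G subspace_UNIV] by blast
  note l = lie_endo_on[OF L] note c = endo_on_comp
  have l3: "endo_on scale UNIV (\<lambda>w. br u (br v (br z w)))" for u v z
    by (rule c[OF l[of u] c[OF l[of v] l[of z]]])
  have "killing_form scale br (br x y) z =
      trace_on scale UNIV (\<lambda>w. br x (br y (br z w)) - br y (br x (br z w)))"
    unfolding killing_form_def by (simp add: lie_algebraD(7)[OF L])
  also have "\<dots> = trace_on scale UNIV (\<lambda>w. br x (br y (br z w))) - trace_on scale UNIV (\<lambda>w. br y (br x (br z w)))"
    by (rule trace_on_diff[OF r l3 l3])
  also have "trace_on scale UNIV (\<lambda>w. br y (br x (br z w))) = trace_on scale UNIV (\<lambda>w. br x (br z (br y w)))"
    by (rule trace_on_commute[OF r l[of y] c[OF l[of x] l[of z]]])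
  also have "trace_on scale UNIV (\<lambda>w. br x (br y (br z w))) - \<dots> =
      trace_on scale UNIV (\<lambda>w. br x (br y (br z w)) - br x (br z (br y w)))"
    by (rule trace_on_diff[OF r l3 l3, symmetric])
  also have "\<dots> = killing_form scale br x (br y z)"
    unfolding killing_form_def by (simp add: lie_algebraD(7,13)[OF L])
  finally show ?thesis .
qed

lemma killing_form_linear:
  assumes L: "lie_algebra scale br" and G: "finite G" "span G = UNIV"
  shows "killing_form scale br x (y + z) = killing_form scale br x y + killing_form scale br x z"
    "killing_form scale br x (scale c y) = c * killing_form scale br x y"
proof -
  obtain B where B: "independent B" "span B = UNIV"
    and r: "resolves scale UNIV B (\<lambda>b x. representation B x b) (\<lambda>b. b)"
    by (rule resolves_basis[OF G subspace_UNIV])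
  have *: "killing_form scale br x y = (\<Sum>b\<in>B. representation B (br x (br y b)) b)" for x y
    unfolding killing_form_def
    by (rule trace_on_resolves[OF r endo_on_comp[OF lie_endo_on[OF L, of x] lie_endo_on[OF L, of y]]])
  show "killing_form scale br x (y + z) = killing_form scale br x y + killing_form scale br x z"
    "killing_form scale br x (scale c y) = c * killing_form scale br x y"
    unfolding * using B
    by (simp_all add: lie_algebraD(1-4)[OF L] representation_add representation_scale sum.distrib sum_distrib_left)
qed

end

section \<open>Bilinear forms and Parseval frames\<close>

text \<open>The Parseval identity is all that traces and Hilbert--Schmidt norms require of an orthonormal
  basis. Indexing by an arbitrary set allows frames of direct summands to be joined by a disjoint sum.\<close>

definition frame :: "('a::real_vector \<Rightarrow> 'a \<Rightarrow> real) \<Rightarrow> 'a set \<Rightarrow> 'i set \<Rightarrow> ('i \<Rightarrow> 'a) \<Rightarrow> bool" where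
  "frame b S I e \<longleftrightarrow> finite I \<and> subspace S \<and> (\<forall>i\<in>I. e i \<in> S) \<and>
    (\<forall>x\<in>S. (\<Sum>i\<in>I. b x (e i) *\<^sub>R e i) = x)"

lemma bilinear_right_sum:
  assumes "bilinear b"
  shows "b x (\<Sum>i\<in>I. c i *\<^sub>R e i) = (\<Sum>i\<in>I. c i * b x (e i))"
proof -
  interpret linear "b x" using assms by (simp add: bilinear_def)
  show ?thesis by (simp add: sum scale)
qed

lemma bilinear_left_sum:
  assumes "bilinear b"
  shows "b (\<Sum>i\<in>I. c i *\<^sub>R e i) x = (\<Sum>i\<in>I. c i * b (e i) x)"
proof -
  interpret linear "\<lambda>y. b y x" using assms by (simp add: bilinear_def)
  show ?thesis by (simp add: sum scale)
qed

lemma bilinearD: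
  assumes "bilinear b"
  shows "b (x + x') y = b x y + b x' y" "b x (y + y') = b x y + b x y'"
    "b (c *\<^sub>R x) y = c *\<^sub>R b x y" "b x (c *\<^sub>R y) = c *\<^sub>R b x y"
    "b (x - x') y = b x y - b x' y" "b x (y - y') = b x y - b x y'"
    "b 0 y = 0" "b x 0 = 0" "b (- x) y = - b x y" "b x (- y) = - b x y"
  using assms by (simp_all add: bilinear_ladd bilinear_radd bilinear_lmul bilinear_rmul
      bilinear_lsub bilinear_rsub bilinear_lzero bilinear_rzero bilinear_lneg bilinear_rneg)

lemma bilinearI:
  assumes "\<And>x x' y. b (x + x') y = b x y + b x' y" "\<And>x y y'. b x (y + y') = b x y + b x y'"
    "\<And>c x y. b (c *\<^sub>R x) y = c *\<^sub>R b x y" "\<And>c x y. b x (c *\<^sub>R y) = c *\<^sub>R b x y"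
  shows "bilinear b"
  using assms by (simp add: bilinear_def linear_iff)

lemma bilinear_alternating_skew:
  assumes b: "bilinear b" and alt: "\<And>x. b x x = 0"
  shows "b x y = - b y x"
  using alt[of "x + y"] unfolding bilinearD[OF b] by (simp add: alt add.commute eq_neg_iff_add_eq_0)

lemma bilinear_prod: "linear l \<Longrightarrow> linear m \<Longrightarrow> bilinear (\<lambda>x y. l x * m y :: real)"
  by (simp add: bilinear_def linear_iff algebra_simps)

lemma bilinear_plus: "bilinear b \<Longrightarrow> bilinear c \<Longrightarrow> bilinear (\<lambda>x y. b x y + c x y)"
  by (simp add: bilinear_def linear_iff algebra_simps)

lemma bilinear_minus: "bilinear b \<Longrightarrow> bilinear c \<Longrightarrow> bilinear (\<lambda>x y. b x y - c x y)"
  by (simp add: bilinear_def linear_iff algebra_simps)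

lemma bilinear_cmul: "bilinear b \<Longrightarrow> bilinear (\<lambda>x y. (c::real) * b x y)"
  by (simp add: bilinear_def linear_iff algebra_simps)

lemma bilinear_Sum: "(\<And>k. k \<in> K \<Longrightarrow> bilinear (b k)) \<Longrightarrow> bilinear (\<lambda>x y. \<Sum>k\<in>K. b k x y :: real)"
  by (simp add: bilinear_def linear_iff sum.distrib sum_distrib_left)

lemma frame_parseval:
  assumes "bilinear b" "frame b S I e" "x \<in> S"
  shows "(\<Sum>i\<in>I. b x (e i) * b y (e i)) = b y x"
proof -
  have "b y x = b y (\<Sum>i\<in>I. b x (e i) *\<^sub>R e i)" using assms by (simp add: frame_def)
  then show ?thesis by (simp add: bilinear_right_sum[OF assms(1)])
qed

lemma frame_resolves:
  assumes "bilinear b" "frame b S I e"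
  shows "resolves scaleR S I (\<lambda>i x. b x (e i)) e"
  using assms by (auto simp: resolves_def frame_def bilinearD subspace_raw_def)

lemma subspace_spanned_finite:
  fixes S G :: "'a::real_vector set"
  assumes "finite G" "span G = UNIV" "subspace S"
  obtains B where "finite B" "B \<subseteq> S" "span B = S"
proof -
  obtain B where B: "B \<subseteq> S" "independent B" "S \<subseteq> span B"
    using maximal_independent_subset[of S] by blast
  have "finite B" using independent_span_bound[of G B] assms B by auto
  moreover have "span B = S" using B assms(3) by (simp add: span_minimal subset_antisym)
  ultimately show ?thesis using that B by blast
qed

text \<open>The Gram--Schmidt process, adding one vector of a spanning set at a time.\<close>

lemma frame_exists:
  fixes b :: "'a::real_vector \<Rightarrow> 'a \<Rightarrow> real"
  assumes b: "bilinear b" and sym: "\<And>x y. b x y = b y x"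
    and pos: "\<And>x. x \<in> S \<Longrightarrow> x \<noteq> 0 \<Longrightarrow> b x x > 0"
    and fin: "finite G" "span G = (UNIV :: 'a set)" and S: "subspace S"
  obtains E where "frame b S E (\<lambda>e. e)"
proof -
  note bl = bilinearD[OF b]
  have "\<exists>E. frame b (span B) E (\<lambda>e. e)" if "finite B" "B \<subseteq> S" for B
    using that
  proof (induction B rule: finite_induct)
    case empty
    show ?case by (intro exI[of _ "{}"]) (simp add: frame_def)
  next
    case (insert g B)
    then obtain E where E: "frame b (span B) E (\<lambda>e. e)" by auto
    define p where "p = (\<Sum>e\<in>E. b g e *\<^sub>R e)"
    define g' where "g' = g - p"
    have EB: "e \<in> E \<Longrightarrow> e \<in> span B" and finE: "finite E" for e using E by (auto simp: frame_def)
    have pB: "p \<in> span B" unfolding p_def by (intro span_sum span_scale EB)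
    have orth: "b g' x = 0" if x: "x \<in> span B" for x
    proof -
      have "b p x = (\<Sum>e\<in>E. b g e * b x e)"
        unfolding p_def bilinear_left_sum[OF b] by (simp add: sym)
      also have "\<dots> = (\<Sum>e\<in>E. b x e * b g e)" by (simp add: mult.commute)
      also have "\<dots> = b g x" using frame_parseval[OF b E x] by simp
      finally show ?thesis by (simp add: g'_def bl)
    qed
    have sp: "span (insert g B) = span (insert g' B)"
    proof -
      have "g \<in> span (insert g' B)" 
      proof -
        have "p \<in> span (insert g' B)" using pB span_mono[of B "insert g' B"] by auto
        then have "g' + p \<in> span (insert g' B)" by (intro span_add) (auto intro: span_base)
        then show ?thesis by (simp add: g'_def)
      qed
      moreover have "g' \<in> span (insert g B)"
      proof -
        have "p \<in> span (insert g B)" using pB span_mono[of B "insert g B"] by auto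
        then show ?thesis unfolding g'_def by (intro span_diff) (auto intro: span_base)
      qed
      moreover have "B \<subseteq> span (insert g B)" "B \<subseteq> span (insert g' B)" by (auto intro: span_base)
      ultimately show ?thesis by (intro subset_antisym span_minimal) auto
    qed
    show ?case
    proof (cases "g' = 0")
      case True
      then have "span (insert g B) = span B" using sp by simp
      then show ?thesis using E by auto
    next
      case False
      have "span B \<subseteq> S" using insert.prems S by (intro span_minimal) auto
      then have "g' \<in> S" using insert.prems pB S by (auto simp: g'_def intro: subspace_diff)
      then have n: "b g' g' > 0" using pos False by blast
      define e' where "e' = (1 / sqrt (b g' g')) *\<^sub>R g'"
      have ne: "e' \<notin> E"
      proof
        assume "e' \<in> E"
        then have "b g' e' = 0" using orth EB by blast
        then show False using n by (simp add: e'_def bl)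
      qed
      have "frame b (span (insert g B)) (insert e' E) (\<lambda>e. e)"
        unfolding frame_def
      proof (intro conjI ballI)
        show "finite (insert e' E)" "subspace (span (insert g B))" using finE by auto
        show "e \<in> span (insert g B)" if "e \<in> insert e' E" for e
        proof (cases "e = e'")
          case True
          then show ?thesis unfolding sp e'_def by (simp add: span_scale span_base)
        next
          case False
          then have "e \<in> span B" using that EB by auto
          then show ?thesis using span_mono[of B "insert g B"] by auto
        qed
      next
        fix x assume "x \<in> span (insert g B)"
        then obtain k where k: "x - k *\<^sub>R g' \<in> span B" unfolding sp by (auto simp: span_insert)
        define y where "y = x - k *\<^sub>R g'"
        have x: "x = y + k *\<^sub>R g'" and y: "y \<in> span B" using k by (auto simp: y_def)
        have "b x e' *\<^sub>R e' = k *\<^sub>R g'"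
        proof -
          have "b y g' = 0" using orth[OF y] sym by metis
          then have "b x e' = k * b g' g' / sqrt (b g' g')" by (simp add: x e'_def bl)
          then have "b x e' *\<^sub>R e' = (k * (b g' g' / (sqrt (b g' g') * sqrt (b g' g')))) *\<^sub>R g'"
            by (simp add: e'_def)
          then show ?thesis using n by simp
        qed
        moreover have "(\<Sum>e\<in>E. b x e *\<^sub>R e) = (\<Sum>e\<in>E. b y e *\<^sub>R e)"
          using orth EB by (intro sum.cong) (auto simp: x bl)
        moreover have "(\<Sum>e\<in>E. b y e *\<^sub>R e) = y" using E y by (simp add: frame_def)
        ultimately show "(\<Sum>e\<in>insert e' E. b x e *\<^sub>R e) = x"
          using finE ne x by simp
      qed
      then show ?thesis by blast
    qed
  qed
  moreover obtain B where "finite B" "B \<subseteq> S" "span B = S"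
    using subspace_spanned_finite[OF fin S] by blast
  ultimately show ?thesis using that by metis
qed

text \<open>The constant is the sum of the absolute values of the matrix entries of \<open>r\<close>, because a product of two
  coordinates is at most the square of the norm.\<close>

lemma bilinear_form_bounded:
  fixes b r :: "'a::real_vector \<Rightarrow> 'a \<Rightarrow> real"
  assumes b: "bilinear b" and fr: "frame b S I e" and r: "bilinear r"
  obtains R where "R \<ge> 0" "\<And>x. x \<in> S \<Longrightarrow> \<bar>r x x\<bar> \<le> R * b x x"
proof
  define R where "R = (\<Sum>i\<in>I. \<Sum>j\<in>I. \<bar>r (e i) (e j)\<bar>)"
  show "R \<ge> 0" by (auto simp: R_def intro: sum_nonneg)
  fix x assume x: "x \<in> S"
  define c where "c i = b x (e i)" for i
  have fin: "finite I" using fr by (simp add: frame_def)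
  have "r x x = r (\<Sum>i\<in>I. c i *\<^sub>R e i) (\<Sum>i\<in>I. c i *\<^sub>R e i)"
    using fr x by (simp add: frame_def c_def)
  also have "\<dots> = (\<Sum>i\<in>I. \<Sum>j\<in>I. c i * (c j * r (e i) (e j)))"
    by (subst bilinear_left_sum[OF r]) (simp add: bilinear_right_sum[OF r] sum_distrib_left)
  finally have rx: "r x x = \<dots>" .
  have n: "b x x = (\<Sum>k\<in>I. c k * c k)"
    using frame_parseval[OF b fr x, of x] by (simp add: c_def)
  have casimir_value: "\<bar>c i * c j\<bar> \<le> b x x" if "i \<in> I" "j \<in> I" for i j
  proof -
    have "c i * c i \<le> b x x" "c j * c j \<le> b x x"
      unfolding n using that fin by (auto intro!: member_le_sum[of _ I "\<lambda>k. c k * c k"])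
    moreover have "2 * \<bar>c i * c j\<bar> \<le> c i * c i + c j * c j"
      using sum_squares_bound[of "\<bar>c i\<bar>" "\<bar>c j\<bar>"] by (simp add: abs_mult power2_eq_square)
    ultimately show ?thesis by linarith
  qed
  have "\<bar>r x x\<bar> \<le> (\<Sum>i\<in>I. \<Sum>j\<in>I. \<bar>c i * (c j * r (e i) (e j))\<bar>)"
    unfolding rx by (intro order_trans[OF sum_abs] sum_mono sum_abs)
  also have "\<dots> \<le> (\<Sum>i\<in>I. \<Sum>j\<in>I. b x x * \<bar>r (e i) (e j)\<bar>)"
  proof (intro sum_mono)
    fix i j assume "i \<in> I" "j \<in> I"
    have "\<bar>c i * (c j * r (e i) (e j))\<bar> = \<bar>c i * c j\<bar> * \<bar>r (e i) (e j)\<bar>" by (simp add: abs_mult)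
    also have "\<dots> \<le> b x x * \<bar>r (e i) (e j)\<bar>"
      using casimir_value[OF \<open>i \<in> I\<close> \<open>j \<in> I\<close>] by (intro mult_right_mono) auto
    finally show "\<bar>c i * (c j * r (e i) (e j))\<bar> \<le> b x x * \<bar>r (e i) (e j)\<bar>" .
  qed
  also have "\<dots> = R * b x x" by (simp add: R_def sum_distrib_left mult.commute)
  finally show "\<bar>r x x\<bar> \<le> R * b x x" .
qed

text \<open>A form of Finsler's lemma: if \<open>b0\<close> is positive on the null space \<open>T\<close> of the semidefinite form \<open>b1\<close>, then
  \<open>b0 + L b1\<close> is positive for large \<open>L\<close>. Completing the square in the \<open>T\<close>-component leaves the form \<open>r\<close> on
  the complement \<open>Q\<close>, and there \<open>b1\<close> dominates it.\<close>

lemma finsler: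
  fixes b0 b1 :: "'a::real_vector \<Rightarrow> 'a \<Rightarrow> real"
  assumes b0: "bilinear b0" and sym0: "\<And>x y. b0 x y = b0 y x"
    and b1: "bilinear b1" and sym1: "\<And>x y. b1 x y = b1 y x"
    and G: "finite G" "span G = (UNIV::'a set)" and T: "subspace T" and Q: "subspace Q"
    and TQ: "\<And>x. \<exists>t\<in>T. \<exists>q\<in>Q. x = t + q"
    and pos0: "\<And>x. x \<in> T \<Longrightarrow> x \<noteq> 0 \<Longrightarrow> b0 x x > 0"
    and pos1: "\<And>x. x \<in> Q \<Longrightarrow> x \<noteq> 0 \<Longrightarrow> b1 x x > 0"
    and null: "\<And>x y. x \<in> T \<Longrightarrow> b1 x y = 0"
  obtains L where "\<And>L' x. L' \<ge> L \<Longrightarrow> x \<noteq> 0 \<Longrightarrow> b0 x x + L' * b1 x x > 0"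
proof -
  obtain E where E: "frame b0 T E (\<lambda>e. e)" by (rule frame_exists[OF b0 sym0 pos0 G T])
  obtain F where F: "frame b1 Q F (\<lambda>e. e)" by (rule frame_exists[OF b1 sym1 pos1 G Q])
  define r where "r x y = b0 x y - (\<Sum>e\<in>E. b0 e x * b0 e y)" for x y
  have "bilinear r" unfolding r_def
    using b0 by (intro bilinear_minus bilinear_Sum bilinear_prod) (auto simp: bilinear_def)
  then obtain R where R: "\<And>x. x \<in> Q \<Longrightarrow> \<bar>r x x\<bar> \<le> R * b1 x x"
    using bilinear_form_bounded[OF b1 F] by blast
  have "b0 x x + L' * b1 x x > 0" if L': "L' \<ge> R + 1" and x: "x \<noteq> 0" for L' x
  proof -
    obtain t q where tq: "t \<in> T" "q \<in> Q" "x = t + q" using TQ by blast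
    have "0 \<le> (\<Sum>e\<in>E. (b0 t e + b0 e q)\<^sup>2)" by (simp add: sum_nonneg)
    also have "\<dots> = (\<Sum>e\<in>E. b0 t e * b0 t e) + 2 * (\<Sum>e\<in>E. b0 t e * b0 q e) + (\<Sum>e\<in>E. b0 e q * b0 e q)"
      by (simp add: power2_eq_square algebra_simps sum.distrib sum_distrib_left sym0)
    also have "\<dots> = b0 t t + 2 * b0 q t + (\<Sum>e\<in>E. b0 e q * b0 e q)"
      using frame_parseval[OF b0 E tq(1)] by simp
    finally have 1: "0 \<le> b0 t t + 2 * b0 q t + (b0 q q - r q q)" by (simp add: r_def)
    have 2: "b0 x x = b0 t t + 2 * b0 q t + b0 q q"
      by (simp add: tq(3) bilinearD[OF b0] sym0[of t q])
    have 3: "b1 x x = b1 q q"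
      using null[OF tq(1)] sym1 by (simp add: tq(3) bilinearD[OF b1] sym1[of q t])
    have 4: "\<bar>r q q\<bar> \<le> R * b1 q q" using R tq by blast
    show ?thesis
    proof (cases "q = 0")
      case True
      then show ?thesis using pos0[OF tq(1)] x tq by (simp add: bilinearD[OF b0] bilinearD[OF b1] null)
    next
      case False
      then have "b1 q q > 0" using pos1 tq by blast
      moreover from this have "(R + 1) * b1 q q \<le> L' * b1 q q" using L' by (intro mult_right_mono) auto
      ultimately show ?thesis using 1 2 3 4 by (simp add: algebra_simps)
    qed
  qed
  then show ?thesis using that by blast
qed

section \<open>The Ricci form of a left-invariant metric\<close>

locale metric_algebra =
  fixes br :: "'g::real_vector \<Rightarrow> 'g \<Rightarrow> 'g" and ip :: "'g \<Rightarrow> 'g \<Rightarrow> real"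
    and I :: "'i set" and e :: "'i \<Rightarrow> 'g"
  assumes br: "bilinear br" and br_alt: "br x x = 0"
    and ip: "inner_product ip" and fr: "frame ip UNIV I e"
begin

lemma ip_bilinear: "bilinear ip" and ip_sym: "ip x y = ip y x" and ip_pos: "x \<noteq> 0 \<Longrightarrow> ip x x > 0"
  using ip by (auto simp: inner_product_def)

lemmas ips = bilinearD[OF ip_bilinear]
lemmas brs = bilinearD[OF br]

lemma br_skew: "br x y = - br y x"
  by (rule bilinear_alternating_skew[OF br br_alt])

lemma expand: "(\<Sum>i\<in>I. ip x (e i) *\<^sub>R e i) = x"
  using fr by (simp add: frame_def)

lemma parseval: "(\<Sum>i\<in>I. ip x (e i) * ip y (e i)) = ip y x"
  by (rule frame_parseval[OF ip_bilinear fr]) simp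

lemma ip_ext: "(\<And>z. ip x z = ip y z) \<Longrightarrow> x = y"
  using ip_pos[of "x - y"] by (force simp: ips)

text \<open>The Riesz representation of a linear form in terms of the frame.\<close>

lemma represent: "linear l \<Longrightarrow> ip (\<Sum>i\<in>I. l (e i) *\<^sub>R e i) z = l z"
proof -
  assume l: "linear l"
  have "l z = l (\<Sum>i\<in>I. ip z (e i) *\<^sub>R e i)" by (simp add: expand)
  also have "\<dots> = (\<Sum>i\<in>I. ip z (e i) * l (e i))" by (simp add: linear_sum[OF l] linear_scale[OF l])
  also have "\<dots> = ip (\<Sum>i\<in>I. l (e i) *\<^sub>R e i) z"
    unfolding bilinear_left_sum[OF ip_bilinear] by (intro sum.cong refl) (simp add: ip_sym[of z])
  finally show ?thesis by simp
qed

text \<open>Koszul's formula for the Levi-Civita connection; the derivatives of inner products vanish on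
  left-invariant fields.\<close>

definition koszul :: "'g \<Rightarrow> 'g \<Rightarrow> 'g \<Rightarrow> real" where
  "koszul x y z = (ip (br x y) z - ip (br y z) x + ip (br z x) y) / 2"

definition conn :: "'g \<Rightarrow> 'g \<Rightarrow> 'g" where
  "conn x y = (\<Sum>i\<in>I. koszul x y (e i) *\<^sub>R e i)"

lemma ip_conn: "ip (conn x y) z = koszul x y z"
  unfolding conn_def by (rule represent) (simp add: linear_iff koszul_def ips brs field_simps)

lemma conn_bilinear: "bilinear conn"
  by (intro bilinearI ip_ext) (simp_all add: ips ip_conn koszul_def brs field_simps)

lemma conn_metric: "ip (conn x y) z = - ip y (conn x z)"
proof -
  have "ip (br x z) y = - ip (br z x) y" "ip (br z y) x = - ip (br y z) x" "ip (br y x) z = - ip (br x y) z"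
    using br_skew[of y x] br_skew[of x z] br_skew[of z y] by (simp_all add: ips)
  then show ?thesis unfolding ip_conn ip_sym[of y "conn x z"] koszul_def by (auto simp: field_simps)
qed

lemma conn_torsion: "conn x y = conn y x + br x y"
proof (rule ip_ext)
  fix z
  have "ip (br y x) z = - ip (br x y) z" "ip (br x z) y = - ip (br z x) y"
    "ip (br z y) x = - ip (br y z) x"
    using br_skew[of y x] br_skew[of x z] br_skew[of z y] by (simp_all add: ips)
  then show "ip (conn x y) z = ip (conn y x + br x y) z"
    unfolding ips ip_conn koszul_def by (auto simp: field_simps)
qed

lemma levi_civita_eq: "levi_civita br ip = conn"
  unfolding levi_civita_def
proof (rule the_equality, intro conjI allI)
  show "bilinear conn" by (rule conn_bilinear)
  show "conn x y - conn y x = br x y" for x y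
    using conn_torsion[of x y] by simp
  show "ip (conn x y) z + ip y (conn x z) = 0" for x y z
    using conn_metric[of x y z] by simp
next
  fix D assume D: "bilinear D \<and> (\<forall>x y. D x y - D y x = br x y) \<and> (\<forall>x y z. ip (D x y) z + ip y (D x z) = 0)"
  show "D = conn"
  proof (intro ext ip_ext)
    fix x y z
    have t: "ip (br x y) z = ip (D x y) z - ip (D y x) z" for x y z
      using D by (metis ips(5))
    have m: "ip (D x y) z = - ip (D x z) y" for x y z
    proof -
      have "ip (D x y) z + ip y (D x z) = 0" using D by blast
      then show ?thesis using ip_sym[of y "D x z"] by linarith
    qed
    show "ip (D x y) z = ip (conn x y) z"
      unfolding ip_conn koszul_def t
      using m[of y z x] m[of z y x] m[of x z y] by simp
  qed
qed

definition Ric :: "'g \<Rightarrow> 'g \<Rightarrow> real" where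
  "Ric x y = (\<Sum>i\<in>I. ip (conn (e i) (conn x y) - conn x (conn (e i) y) - conn (br (e i) x) y) (e i))"

lemma conns: "conn (x + y) z = conn x z + conn y z" "conn x (y + z) = conn x y + conn x z"
    "conn (c *\<^sub>R x) y = c *\<^sub>R conn x y" "conn x (c *\<^sub>R y) = c *\<^sub>R conn x y"
  using bilinearD[OF conn_bilinear] by simp_all

lemma ricci_form_eq: "ricci_form br ip x y = Ric x y"
  unfolding ricci_form_def Ric_def curvature_def levi_civita_eq Let_def
  by (rule real_vector.trace_on_resolves[OF frame_resolves[OF ip_bilinear fr]])
     (simp add: endo_on_def conns brs algebra_simps)

lemma Ric_linear: "linear (Ric x)"
  by (simp add: linear_iff Ric_def conns ips sum.distrib sum_distrib_left sum_subtractf algebra_simps)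

lemma ip_ricci_operator: "ip (ricci_operator br ip x) x = Ric x x"
proof -
  have "ricci_operator br ip x = (\<Sum>i\<in>I. Ric x (e i) *\<^sub>R e i)"
    unfolding ricci_operator_def ricci_form_eq
  proof (rule the_equality)
    show "\<forall>Y. ip (\<Sum>i\<in>I. Ric x (e i) *\<^sub>R e i) Y = Ric x Y" using represent[OF Ric_linear] by blast
    then show "W = (\<Sum>i\<in>I. Ric x (e i) *\<^sub>R e i)" if "\<forall>Y. ip W Y = Ric x Y" for W
      using that by (intro ip_ext) simp
  qed
  then show ?thesis using represent[OF Ric_linear] by simp
qed

text \<open>With \<open>a\<close> the matrix of \<open>ad x\<close>, \<open>s\<close> its symmetric part and \<open>c\<close> the skew matrix of the pairing
  \<open>\<langle>[e\<^sub>i, e\<^sub>j], x\<rangle>\<close>, the endomorphism \<open>y \<mapsto> \<nabla>\<^sub>y x\<close> has the matrix \<open>- s - c / 2\<close>. The trace defining \<open>Ric\<close>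
  becomes a quadratic expression in \<open>s\<close>, \<open>c\<close> and \<open>a\<close>, in which the mixed terms cancel by symmetry.\<close>

lemma Ric_formula:
  assumes H: "\<And>y. ip H y = (\<Sum>i\<in>I. ip (br y (e i)) (e i))"
  shows "Ric x x = - (\<Sum>i\<in>I. \<Sum>j\<in>I. ((ip (br x (e i)) (e j) + ip (br x (e j)) (e i)) / 2)\<^sup>2)
    + (\<Sum>i\<in>I. \<Sum>j\<in>I. (ip (br (e i) (e j)) x)\<^sup>2) / 4 - ip (br H x) x"
proof -
  define a where "a i j = ip (br x (e i)) (e j)" for i j
  define c where "c i j = ip (br (e i) (e j)) x" for i j
  define s where "s i j = (a i j + a j i) / 2" for i j
  have c_skew: "c i j = - c j i" for i j
    unfolding c_def using br_skew[of "e i" "e j"] by (simp add: ips)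
  have k: "ip (conn (e i) x) (e j) = - s i j - c i j / 2" for i j
    using br_skew[of "e i" x] br_skew[of "e j" "e i"]
    by (simp add: ip_conn koszul_def a_def c_def s_def ips field_simps)
  have 1: "(\<Sum>i\<in>I. ip (conn (e i) (conn x x)) (e i)) = - ip (br H x) x"
  proof -
    have "ip (conn (e i) w) (e i) = - ip (br w (e i)) (e i)" for i w
      using br_skew[of "e i" w] by (simp add: ip_conn koszul_def ips br_alt)
    then have "(\<Sum>i\<in>I. ip (conn (e i) (conn x x)) (e i)) = - ip H (conn x x)"
      by (simp add: H sum_negf)
    also have "ip H (conn x x) = ip (br H x) x"
      using br_skew[of x H] by (simp add: ip_sym[of H] ip_conn koszul_def br_alt ips)
    finally show ?thesis .
  qed
  have 2: "ip (conn x (conn (e i) x)) (e i) =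
      - (\<Sum>j\<in>I. (- s i j - c i j / 2) * (- s i j - c i j / 2) + (- s i j - c i j / 2) * a i j)" for i
  proof -
    let ?A = "conn (e i) x"
    have "ip (conn x ?A) (e i) = - ip ?A (?A + br x (e i))"
      using conn_metric[of x ?A "e i"] conn_torsion[of x "e i"] by simp
    also have "\<dots> = - (ip ?A ?A + ip ?A (br x (e i)))" by (simp add: ips)
    also have "ip ?A ?A = (\<Sum>j\<in>I. (- s i j - c i j / 2) * (- s i j - c i j / 2))"
      using parseval[of ?A ?A] by (simp add: k)
    also have "ip ?A (br x (e i)) = (\<Sum>j\<in>I. (- s i j - c i j / 2) * a i j)"
      using parseval[of "br x (e i)" ?A] by (simp add: k a_def mult.commute)
    finally show ?thesis by (simp add: sum.distrib)
  qed
  have 3: "ip (conn (br (e i) x) x) (e i) = - (\<Sum>j\<in>I. a i j * (- s i j + c i j / 2))" for i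
  proof -
    have "br (e i) x = - (\<Sum>j\<in>I. a i j *\<^sub>R e j)"
      using expand[of "br x (e i)"] br_skew[of "e i" x] by (simp add: a_def)
    moreover have l: "linear (\<lambda>u. ip (conn u x) (e i))" by (simp add: linear_iff conns ips)
    ultimately have "ip (conn (br (e i) x) x) (e i) = - (\<Sum>j\<in>I. a i j * ip (conn (e j) x) (e i))"
      by (simp add: linear_neg[OF l] linear_sum[OF l] linear_scale[OF l])
    also have "\<dots> = - (\<Sum>j\<in>I. a i j * (- s i j + c i j / 2))"
    proof -
      have "- s j i - c j i / 2 = - s i j + c i j / 2" for j
        using c_skew[of i j] by (simp add: s_def add.commute)
      then show ?thesis by (simp add: k)
    qed
    finally show ?thesis .
  qed
  have sc: "(\<Sum>i\<in>I. \<Sum>j\<in>I. s i j * c i j) = 0"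
  proof -
    have "(\<Sum>i\<in>I. \<Sum>j\<in>I. s i j * c i j) = (\<Sum>i\<in>I. \<Sum>j\<in>I. s j i * c j i)" by (rule sum.swap)
    also have "\<dots> = (\<Sum>i\<in>I. \<Sum>j\<in>I. - (s i j * c i j))"
      by (intro sum.cong refl) (subst c_skew, simp add: s_def add.commute)
    finally show ?thesis by (simp add: sum_negf)
  qed
  have sa: "(\<Sum>i\<in>I. \<Sum>j\<in>I. s i j * a i j) = (\<Sum>i\<in>I. \<Sum>j\<in>I. (s i j)\<^sup>2)"
  proof -
    have "(\<Sum>i\<in>I. \<Sum>j\<in>I. s i j * a i j) = (\<Sum>i\<in>I. \<Sum>j\<in>I. s j i * a j i)" by (rule sum.swap)
    then have "(\<Sum>i\<in>I. \<Sum>j\<in>I. s i j * a i j) =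
        ((\<Sum>i\<in>I. \<Sum>j\<in>I. s i j * a i j) + (\<Sum>i\<in>I. \<Sum>j\<in>I. s j i * a j i)) / 2" by simp
    also have "\<dots> = (\<Sum>i\<in>I. \<Sum>j\<in>I. (s i j * a i j + s j i * a j i) / 2)"
      by (simp add: sum.distrib sum_divide_distrib add_divide_distrib)
    also have "\<dots> = (\<Sum>i\<in>I. \<Sum>j\<in>I. (s i j)\<^sup>2)"
      by (intro sum.cong refl) (simp add: s_def power2_eq_square field_simps)
    finally show ?thesis .
  qed
  have "Ric x x = - ip (br H x) x + (\<Sum>i\<in>I. \<Sum>j\<in>I. (- s i j - c i j / 2) * (- s i j - c i j / 2)
      + (- s i j - c i j / 2) * a i j + a i j * (- s i j + c i j / 2))"
    by (simp add: Ric_def ips sum_subtractf 1 2 3 sum_negf sum.distrib)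
  also have "\<dots> = - ip (br H x) x + (\<Sum>i\<in>I. \<Sum>j\<in>I. (s i j)\<^sup>2 + s i j * c i j + (c i j)\<^sup>2 / 4 - 2 * (s i j * a i j))"
    by (intro arg_cong2[where f = "(+)"] sum.cong refl) (simp add: power2_eq_square field_simps)
  also have "\<dots> = - ip (br H x) x - (\<Sum>i\<in>I. \<Sum>j\<in>I. (s i j)\<^sup>2) + (\<Sum>i\<in>I. \<Sum>j\<in>I. (c i j)\<^sup>2) / 4"
    by (simp add: sum.distrib sum_subtractf sc sa sum_distrib_left[symmetric] sum_divide_distrib)
  finally show ?thesis by (simp add: s_def a_def c_def)
qed

end

section \<open>Metrics on the semidirect product\<close>

lemma sum_Inl_Inr:
  "finite A \<Longrightarrow> finite B \<Longrightarrow> (\<Sum>k\<in>A <+> B. f k) = (\<Sum>i\<in>A. f (Inl i)) + (\<Sum>j\<in>B. f (Inr j) :: real)"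
  by (simp add: sum.Plus)

text \<open>The data of a metric on \<open>\<real>Z \<oplus> \<uu> \<oplus> V\<close> with orthogonal summands, up to the length of \<open>Z\<close>, for which
  \<open>\<uu>\<close> acts on itself and on \<open>V\<close> by operators of trace zero.\<close>

locale metric_representation =
  fixes br :: "'u::real_vector \<Rightarrow> 'u \<Rightarrow> 'u" and \<rho> :: "'u \<Rightarrow> 'v::real_vector \<Rightarrow> 'v"
    and a :: "'u \<Rightarrow> 'u \<Rightarrow> real" and I :: "'i set" and e :: "'i \<Rightarrow> 'u"
    and b :: "'v \<Rightarrow> 'v \<Rightarrow> real" and J :: "'j set" and f :: "'j \<Rightarrow> 'v"
  assumes br: "bilinear br" and br_alt: "br x x = 0" and \<rho>: "bilinear \<rho>"
    and a: "inner_product a" and fra: "frame a UNIV I e"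
    and b: "inner_product b" and frb: "frame b UNIV J f"
    and tr_ad: "(\<Sum>i\<in>I. a (br x (e i)) (e i)) = 0"
    and tr_rho: "(\<Sum>j\<in>J. b (\<rho> x (f j)) (f j)) = 0"
begin

abbreviation "bracket \<equiv> semidirect_bracket br \<rho>"

definition metric :: "real \<Rightarrow> real \<times> 'u \<times> 'v \<Rightarrow> real \<times> 'u \<times> 'v \<Rightarrow> real" where
  "metric \<omega> = (\<lambda>(z, x, v) (z', x', v'). \<omega> * z * z' + a x x' + b v v')"

definition basis :: "real \<Rightarrow> unit + 'i + 'j \<Rightarrow> real \<times> 'u \<times> 'v" where
  "basis \<omega> = case_sum (\<lambda>_. (1 / sqrt \<omega>, 0, 0)) (case_sum (\<lambda>i. (0, e i, 0)) (\<lambda>j. (0, 0, f j)))"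

definition index :: "(unit + 'i + 'j) set" where
  "index = {()} <+> (I <+> J)"

definition sym_ad :: "'u \<Rightarrow> 'i \<Rightarrow> 'i \<Rightarrow> real" where
  "sym_ad x i j = (a (br x (e i)) (e j) + a (br x (e j)) (e i)) / 2"

definition sym_rho :: "'u \<Rightarrow> 'j \<Rightarrow> 'j \<Rightarrow> real" where
  "sym_rho x i j = (b (\<rho> x (f i)) (f j) + b (\<rho> x (f j)) (f i)) / 2"

text \<open>The negative of this form is the contribution of \<open>\<uu>\<close> to an upper bound for the Ricci form. Its first two terms measure
  how far \<open>\<uu>\<close> is from acting by skew operators.\<close>

definition excess :: "'u \<Rightarrow> real" where
  "excess x = (\<Sum>i\<in>I. \<Sum>j\<in>I. (sym_ad x i j)\<^sup>2) + (\<Sum>i\<in>J. \<Sum>j\<in>J. (sym_rho x i j)\<^sup>2)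
    - (\<Sum>i\<in>I. \<Sum>j\<in>I. (a (br (e i) (e j)) x)\<^sup>2) / 4"

lemma bil: "bilinear a" "bilinear b" using a b by (auto simp: inner_product_def)

lemmas as = bilinearD[OF bil(1)]
lemmas bs = bilinearD[OF bil(2)]
lemmas brs = bilinearD[OF br]
lemmas rhos = bilinearD[OF \<rho>]

lemma syms: "a x y = a y x" "b v w = b w v" using a b by (auto simp: inner_product_def)

lemma pos: "x \<noteq> 0 \<Longrightarrow> a x x > 0" "v \<noteq> 0 \<Longrightarrow> b v v > 0" using a b by (auto simp: inner_product_def)

lemma nonneg: "a x x \<ge> 0" "b v v \<ge> 0"
  using pos(1)[of x] pos(2)[of v] by (cases "x = 0", simp_all add: as) (cases "v = 0", simp_all add: bs)

lemma finI: "finite I" and finJ: "finite J" using fra frb by (auto simp: frame_def)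

lemma sum_index: "(\<Sum>k\<in>index. g k) = g (Inl ()) + (\<Sum>i\<in>I. g (Inr (Inl i))) + (\<Sum>j\<in>J. g (Inr (Inr j)) :: real)"
  by (simp add: index_def sum_Inl_Inr finI finJ)

lemma expand: "(\<Sum>i\<in>I. a x (e i) *\<^sub>R e i) = x" "(\<Sum>j\<in>J. b v (f j) *\<^sub>R f j) = v"
  using fra frb by (auto simp: frame_def)

lemma metric_inner_product: "\<omega> > 0 \<Longrightarrow> inner_product (metric \<omega>)"
  unfolding inner_product_def
proof (intro conjI allI impI)
  show "bilinear (metric \<omega>)"
    by (intro bilinearI) (auto simp: metric_def as bs algebra_simps)
  show "metric \<omega> X Y = metric \<omega> Y X" for X Y
  proof -
    obtain z x v z' x' v' where "X = (z, x, v)" "Y = (z', x', v')" by (metis prod.exhaust)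
    then show ?thesis by (simp add: metric_def syms(1)[of x x'] syms(2)[of v v'])
  qed
  fix X :: "real \<times> 'u \<times> 'v" assume "\<omega> > 0" and X: "X \<noteq> 0"
  obtain z x v where [simp]: "X = (z, x, v)" by (cases X)
  consider "z \<noteq> 0" | "x \<noteq> 0" | "v \<noteq> 0" using X by (auto simp: zero_prod_def)
  then show "metric \<omega> X X > 0"
  proof cases
    case 1
    then have "\<omega> * (z * z) > 0" using \<open>\<omega> > 0\<close> by (auto simp: zero_less_mult_iff)
    then show ?thesis using nonneg(1)[of x] nonneg(2)[of v] by (simp add: metric_def mult.assoc)
  next
    case 2
    have "\<omega> * (z * z) \<ge> 0" using \<open>\<omega> > 0\<close> by simp
    then show ?thesis using pos(1)[OF 2] nonneg(2)[of v] by (simp add: metric_def mult.assoc)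
  next
    case 3
    have "\<omega> * (z * z) \<ge> 0" using \<open>\<omega> > 0\<close> by simp
    then show ?thesis using pos(2)[OF 3] nonneg(1)[of x] by (simp add: metric_def mult.assoc)
  qed
qed

lemma metric_frame: "\<omega> > 0 \<Longrightarrow> frame (metric \<omega>) UNIV index (basis \<omega>)"
  unfolding frame_def
proof (intro conjI ballI)
  show "finite index" by (simp add: index_def finI finJ)
  fix X :: "real \<times> 'u \<times> 'v" assume \<omega>: "\<omega> > 0"
  obtain z x v where X: "X = (z, x, v)" by (cases X)
  have "(\<Sum>k\<in>index. metric \<omega> X (basis \<omega> k) *\<^sub>R basis \<omega> k) =
      metric \<omega> X (basis \<omega> (Inl ())) *\<^sub>R basis \<omega> (Inl ())
      + (\<Sum>i\<in>I. metric \<omega> X (basis \<omega> (Inr (Inl i))) *\<^sub>R basis \<omega> (Inr (Inl i)))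
      + (\<Sum>j\<in>J. metric \<omega> X (basis \<omega> (Inr (Inr j))) *\<^sub>R basis \<omega> (Inr (Inr j)))"
    by (simp add: index_def sum.Plus finI finJ)
  also have "\<dots> = (\<omega> * z * (1 / sqrt \<omega>) * (1 / sqrt \<omega>), 0, 0)
      + (\<Sum>i\<in>I. (0, a x (e i) *\<^sub>R e i, 0)) + (\<Sum>j\<in>J. (0, 0, b v (f j) *\<^sub>R f j))"
    by (simp add: X metric_def basis_def as bs)
  also have "(\<omega> * z * (1 / sqrt \<omega>) * (1 / sqrt \<omega>), 0::'u, 0::'v) = (z, 0, 0)" using \<omega> by simp
  also have "(\<Sum>i\<in>I. (0::real, a x (e i) *\<^sub>R e i, 0::'v)) = (0, x, 0)"
    by (simp add: prod_eq_iff fst_sum snd_sum expand)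
  also have "(\<Sum>j\<in>J. (0::real, 0::'u, b v (f j) *\<^sub>R f j)) = (0, 0, v)"
    by (simp add: prod_eq_iff fst_sum snd_sum expand)
  finally show "(\<Sum>k\<in>index. metric \<omega> X (basis \<omega> k) *\<^sub>R basis \<omega> k) = X" by (simp add: X)
qed auto

lemma bracket_bilinear: "bilinear bracket"
  by (intro bilinearI) (auto simp: semidirect_bracket_def brs rhos algebra_simps)

lemma bracket_alt: "bracket X X = 0"
  by (cases X) (simp add: semidirect_bracket_def br_alt zero_prod_def)

lemma metric_algebra: "\<omega> > 0 \<Longrightarrow> metric_algebra bracket (metric \<omega>) index (basis \<omega>)"
  using bracket_bilinear bracket_alt metric_inner_product metric_frame by unfold_locales auto

text \<open>The trace of the identity of \<open>V\<close>, hence the dimension.\<close>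

definition dim where "dim = (\<Sum>j\<in>J. b (f j) (f j))"

text \<open>In the Ricci formula only the diagonal blocks of \<open>sym (ad X)\<close> on \<open>\<uu>\<close> and on \<open>V\<close> are kept. On \<open>V\<close> the
  mixed terms of \<open>z + \<rho>(x)\<close> vanish because \<open>\<rho>(x)\<close> has trace zero. The mean curvature vector is
  \<open>(dim / \<omega>) Z\<close>; this gives the term \<open>- (dim / \<omega>) |v|\<^sup>2\<close>, of which the brackets of \<open>Z\<close> with \<open>V\<close> take
  back only \<open>|v|\<^sup>2 / (2 \<omega>)\<close>.\<close>

lemma ricci_bound:
  assumes \<omega>: "\<omega> > 0"
  shows "metric \<omega> (ricci_operator bracket (metric \<omega>) (z, x, v)) (z, x, v) \<le>
    - (dim * z\<^sup>2) - excess x - (dim - 1/2) / \<omega> * b v v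
    + (\<Sum>i\<in>I. \<Sum>j\<in>J. (b (\<rho> (e i) (f j)) v)\<^sup>2) / 2"
proof -
  interpret M: metric_algebra bracket "metric \<omega>" index "basis \<omega>" by (rule metric_algebra[OF \<omega>])
  define X where "X = (z, x, v)"
  define H :: "real \<times> 'u \<times> 'v" where "H = (dim / \<omega>, 0, 0)"
  define E where "E = basis \<omega>"
  define s where "s k l = ((metric \<omega> (bracket X (E k)) (E l) + metric \<omega> (bracket X (E l)) (E k)) / 2)\<^sup>2" for k l
  define c where "c k l = (metric \<omega> (bracket (E k) (E l)) X)\<^sup>2" for k l
  have arith: "r \<le> - d - (A + B - A' / 4) - w + K / 2"
    if "r = - S + C / 4 - N" "N = t" "A + (d + B) \<le> S" "C = u + A' + 2 * K" "w = t - u / 4"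
    for r S C N t A d B u A' K w :: real
    using that by (simp add: field_simps)
  have E: "E (Inl ()) = (1 / sqrt \<omega>, 0, 0)" "E (Inr (Inl i)) = (0, e i, 0)" "E (Inr (Inr j)) = (0, 0, f j)" for i j
    by (simp_all add: E_def basis_def)
  have "metric \<omega> H Y = (\<Sum>k\<in>index. metric \<omega> (bracket Y (E k)) (E k))" for Y
  proof -
    obtain r y w where Y: "Y = (r, y, w)" by (cases Y)
    have "(\<Sum>k\<in>index. metric \<omega> (bracket Y (E k)) (E k)) =
      (\<Sum>i\<in>I. a (br y (e i)) (e i)) + (\<Sum>j\<in>J. r * b (f j) (f j) + b (\<rho> y (f j)) (f j))"
      by (simp add: sum_index E Y semidirect_bracket_def metric_def as bs brs rhos)
    also have "\<dots> = r * dim" by (simp add: tr_ad tr_rho sum.distrib dim_def sum_distrib_left)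
    finally show ?thesis using \<omega> by (simp add: H_def Y metric_def as bs)
  qed
  then have "metric \<omega> (ricci_operator bracket (metric \<omega>) X) X =
      - (\<Sum>k\<in>index. \<Sum>l\<in>index. s k l) + (\<Sum>k\<in>index. \<Sum>l\<in>index. c k l) / 4 - metric \<omega> (bracket H X) X"
    unfolding M.ip_ricci_operator s_def c_def E_def by (rule M.Ric_formula)
  moreover have "metric \<omega> (bracket H X) X = dim / \<omega> * b v v"
    by (simp add: X_def H_def metric_def semidirect_bracket_def brs rhos bs as)
  moreover have "(\<Sum>k\<in>index. \<Sum>l\<in>index. s k l) \<ge>
      (\<Sum>i\<in>I. \<Sum>j\<in>I. (sym_ad x i j)\<^sup>2) + (dim * z\<^sup>2 + (\<Sum>i\<in>J. \<Sum>j\<in>J. (sym_rho x i j)\<^sup>2))"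
  proof -
    have s0: "s k l \<ge> 0" for k l by (simp add: s_def)
    have "(\<Sum>k\<in>index. \<Sum>l\<in>index. s k l) \<ge>
      (\<Sum>i\<in>I. \<Sum>j\<in>I. s (Inr (Inl i)) (Inr (Inl j))) + (\<Sum>i\<in>J. \<Sum>j\<in>J. s (Inr (Inr i)) (Inr (Inr j)))"
    proof -
      have "(\<Sum>l\<in>index. s k l) \<ge> (\<Sum>i\<in>I. s k (Inr (Inl i)))" "(\<Sum>l\<in>index. s k l) \<ge> (\<Sum>i\<in>J. s k (Inr (Inr i)))"
        "(\<Sum>l\<in>index. s k l) \<ge> 0" for k
        unfolding sum_index by (simp_all add: s0 add_nonneg_nonneg sum_nonneg)
      note le = this
      have "(\<Sum>i\<in>I. \<Sum>j\<in>I. s (Inr (Inl i)) (Inr (Inl j))) \<le> (\<Sum>i\<in>I. \<Sum>l\<in>index. s (Inr (Inl i)) l)"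
        "(\<Sum>i\<in>J. \<Sum>j\<in>J. s (Inr (Inr i)) (Inr (Inr j))) \<le> (\<Sum>i\<in>J. \<Sum>l\<in>index. s (Inr (Inr i)) l)"
        by (intro sum_mono le)+
      then show ?thesis using le(3)[of "Inl ()"] unfolding sum_index[of "\<lambda>k. \<Sum>l\<in>index. s k l"] by linarith
    qed
    moreover have "s (Inr (Inl i)) (Inr (Inl j)) = (sym_ad x i j)\<^sup>2" for i j
      by (simp add: s_def E X_def semidirect_bracket_def metric_def as bs brs rhos sym_ad_def)
    moreover have "(\<Sum>i\<in>J. \<Sum>j\<in>J. s (Inr (Inr i)) (Inr (Inr j))) = dim * z\<^sup>2 + (\<Sum>i\<in>J. \<Sum>j\<in>J. (sym_rho x i j)\<^sup>2)"
    proof -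
      have "s (Inr (Inr i)) (Inr (Inr j)) = z\<^sup>2 * (b (f i) (f j) * b (f i) (f j)) +
          z * (b (f i) (f j) * b (\<rho> x (f i)) (f j)) + z * (b (f j) (f i) * b (\<rho> x (f j)) (f i)) + (sym_rho x i j)\<^sup>2" for i j
      proof -
        define \<beta> where "\<beta> = b (f i) (f j)"
        have \<beta>: "b (f i) (f j) = \<beta>" "b (f j) (f i) = \<beta>" using syms(2)[of "f j" "f i"] by (simp_all add: \<beta>_def)
        have "s (Inr (Inr i)) (Inr (Inr j)) =
            ((z * \<beta> + b (\<rho> x (f i)) (f j) + (z * \<beta> + b (\<rho> x (f j)) (f i))) / 2)\<^sup>2"
          by (simp add: s_def E X_def semidirect_bracket_def metric_def as bs brs rhos \<beta>)
        also have "\<dots> = (z * \<beta> + sym_rho x i j)\<^sup>2" by (simp add: sym_rho_def field_simps)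
        also have "\<dots> = z\<^sup>2 * (\<beta> * \<beta>) + z * (\<beta> * (2 * sym_rho x i j)) + (sym_rho x i j)\<^sup>2"
          by (simp add: power2_eq_square algebra_simps)
        also have "2 * sym_rho x i j = b (\<rho> x (f i)) (f j) + b (\<rho> x (f j)) (f i)" by (simp add: sym_rho_def)
        finally show ?thesis unfolding \<beta> by (simp add: algebra_simps)
      qed
      moreover have "(\<Sum>i\<in>J. \<Sum>j\<in>J. b (f i) (f j) * b (f i) (f j)) = dim"
        using frame_parseval[OF bil(2) frb] by (simp add: dim_def)
      moreover have p: "(\<Sum>i\<in>J. \<Sum>j\<in>J. b (f i) (f j) * b (\<rho> x (f i)) (f j)) = 0"
        using frame_parseval[OF bil(2) frb] by (simp add: tr_rho)
      moreover have "(\<Sum>i\<in>J. \<Sum>j\<in>J. b (f j) (f i) * b (\<rho> x (f j)) (f i)) = 0"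
        by (subst sum.swap) (rule p)
      ultimately show ?thesis
        by (simp add: sum.distrib sum_distrib_left[symmetric] mult.commute)
    qed
    ultimately show ?thesis by simp
  qed
  moreover have "(\<Sum>k\<in>index. \<Sum>l\<in>index. c k l) =
      2 / \<omega> * b v v + (\<Sum>i\<in>I. \<Sum>j\<in>I. (a (br (e i) (e j)) x)\<^sup>2) + 2 * (\<Sum>i\<in>I. \<Sum>j\<in>J. (b (\<rho> (e i) (f j)) v)\<^sup>2)"
  proof -
    have c: "c (Inl ()) (Inl ()) = 0" "c (Inl ()) (Inr (Inl i)) = 0" "c (Inr (Inl i)) (Inl ()) = 0"
      "c (Inl ()) (Inr (Inr j)) = 1 / \<omega> * (b v (f j) * b v (f j))"
      "c (Inr (Inr j)) (Inl ()) = 1 / \<omega> * (b v (f j) * b v (f j))"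
      "c (Inr (Inl i)) (Inr (Inl i')) = (a (br (e i) (e i')) x)\<^sup>2"
      "c (Inr (Inl i)) (Inr (Inr j)) = (b (\<rho> (e i) (f j)) v)\<^sup>2"
      "c (Inr (Inr j)) (Inr (Inl i)) = (b (\<rho> (e i) (f j)) v)\<^sup>2"
      "c (Inr (Inr j)) (Inr (Inr j')) = 0" for i j i' j'
      using \<omega> by (simp_all add: c_def E X_def semidirect_bracket_def metric_def as bs brs rhos
          power_divide power2_eq_square syms(2)[of "f j" v])
    have "(\<Sum>j\<in>J. b v (f j) * b v (f j)) = b v v"
      by (rule frame_parseval[OF bil(2) frb]) simp
    then have d: "(\<Sum>j\<in>J. 1 / \<omega> * (b v (f j) * b v (f j))) = 1 / \<omega> * b v v"
      by (simp only: sum_distrib_left[symmetric])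
    have "(\<Sum>j\<in>J. \<Sum>i\<in>I. (b (\<rho> (e i) (f j)) v)\<^sup>2) = (\<Sum>i\<in>I. \<Sum>j\<in>J. (b (\<rho> (e i) (f j)) v)\<^sup>2)"
      by (rule sum.swap)
    then show ?thesis unfolding sum_index c sum.distrib d by simp
  qed
  moreover have "(dim - 1/2) / \<omega> * b v v = dim / \<omega> * b v v - (2 / \<omega> * b v v) / 4"
    by (simp add: diff_divide_distrib algebra_simps)
  ultimately have *: "metric \<omega> (ricci_operator bracket (metric \<omega>) X) X \<le> - (dim * z\<^sup>2)
    - ((\<Sum>i\<in>I. \<Sum>j\<in>I. (sym_ad x i j)\<^sup>2) + (\<Sum>i\<in>J. \<Sum>j\<in>J. (sym_rho x i j)\<^sup>2)
        - (\<Sum>i\<in>I. \<Sum>j\<in>I. (a (br (e i) (e j)) x)\<^sup>2) / 4)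
    - (dim - 1/2) / \<omega> * b v v + (\<Sum>i\<in>I. \<Sum>j\<in>J. (b (\<rho> (e i) (f j)) v)\<^sup>2) / 2"
    by (rule arith)
  then show ?thesis unfolding X_def excess_def .
qed

text \<open>The last term of \<open>ricci_bound\<close> is a quadratic form in \<open>v\<close> that does not involve \<open>\<omega>\<close>, so a small \<open>\<omega>\<close>
  makes the term with \<open>1 / \<omega>\<close> absorb it.\<close>

theorem negative_ricci_exists:
  assumes dim: "dim \<ge> 1" and ex: "\<And>x. x \<noteq> 0 \<Longrightarrow> excess x > 0"
  shows "\<exists>ip. inner_product ip \<and> negative_ricci bracket ip"
proof -
  define r where "r v w = (\<Sum>i\<in>I. \<Sum>j\<in>J. b (\<rho> (e i) (f j)) v * b (\<rho> (e i) (f j)) w)" for v w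
  have "bilinear r" unfolding r_def using bil by (intro bilinear_Sum bilinear_prod) (auto simp: bilinear_def)
  then obtain R where R: "R \<ge> 0" "\<And>v. \<bar>r v v\<bar> \<le> R * b v v"
    using bilinear_form_bounded[OF bil(2) frb] by (metis UNIV_I)
  define \<omega> where "\<omega> = 1 / (R + 1)"
  have \<omega>: "\<omega> > 0" using R by (simp add: \<omega>_def)
  have "metric \<omega> (ricci_operator bracket (metric \<omega>) X) X < 0" if "X \<noteq> 0" for X
  proof -
    obtain z x v where X: "X = (z, x, v)" by (cases X)
    have "metric \<omega> (ricci_operator bracket (metric \<omega>) X) X \<le>
        - (dim * z\<^sup>2) - excess x - (dim - 1/2) / \<omega> * b v v + r v v / 2"
      using ricci_bound[OF \<omega>, of z x v] by (simp add: X r_def power2_eq_square)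
    moreover have "(dim - 1/2) / \<omega> * b v v - r v v / 2 \<ge> b v v / 2"
    proof -
      have "(dim - 1/2) / \<omega> = (dim - 1/2) * (R + 1)" by (simp add: \<omega>_def)
      moreover have "(1/2) * (R + 1) \<le> (dim - 1/2) * (R + 1)"
        using dim R(1) by (intro mult_right_mono) auto
      ultimately have "(1/2) * (R + 1) * b v v \<le> (dim - 1/2) / \<omega> * b v v"
        using nonneg(2) by (intro mult_right_mono) auto
      then show ?thesis using R(2)[of v] by (simp add: field_simps)
    qed
    moreover have "dim * z\<^sup>2 \<ge> z\<^sup>2" using dim mult_right_mono[of 1 dim "z\<^sup>2"] by simp
    moreover have "excess x \<ge> 0"
      using ex[of x] by (cases "x = 0") (simp_all add: excess_def sym_ad_def sym_rho_def brs rhos as bs)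
    moreover have "z \<noteq> 0 \<or> x \<noteq> 0 \<or> v \<noteq> 0" using that by (auto simp: X zero_prod_def)
    then have "z\<^sup>2 > 0 \<or> excess x > 0 \<or> b v v > 0" using ex pos(2) by auto
    moreover have "z\<^sup>2 \<ge> 0" "b v v \<ge> 0" using nonneg by auto
    ultimately show ?thesis by argo
  qed
  then show ?thesis using metric_inner_product[OF \<omega>] unfolding negative_ricci_def by blast
qed

end

section \<open>Degenerating the metric along a splitting of the representation\<close>

definition pos_on :: "('a::real_vector \<Rightarrow> 'a \<Rightarrow> real) \<Rightarrow> 'a set \<Rightarrow> bool" where
  "pos_on \<sigma> S \<longleftrightarrow> bilinear \<sigma> \<and> (\<forall>x y. \<sigma> x y = \<sigma> y x) \<and> (\<forall>x\<in>S. x \<noteq> 0 \<longrightarrow> \<sigma> x x > 0)"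

lemma pos_onD:
  assumes "pos_on \<sigma> S"
  shows "bilinear \<sigma>" "\<sigma> x y = \<sigma> y x" "x \<in> S \<Longrightarrow> x \<noteq> 0 \<Longrightarrow> \<sigma> x x > 0"
  using assms by (auto simp: pos_on_def)

lemma pos_on_frame:
  fixes S :: "'a::real_vector set"
  assumes "pos_on \<sigma> S" "finite G" "span G = (UNIV :: 'a set)" "subspace S"
  obtains E where "frame \<sigma> S E (\<lambda>e. e)"
  using frame_exists[OF pos_onD(1)[OF assms(1)] pos_onD(2)[OF assms(1)] pos_onD(3)[OF assms(1)] assms(2,3,4)] by blast

text \<open>Two forms living on complementary subspaces combine to an inner product for which the subspaces
  are orthogonal; scaling the first form by \<open>c\<^sup>2\<close> scales its frame by \<open>1 / c\<close>.\<close>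

lemma orthogonal_sum:
  fixes S1 S2 :: "'a::real_vector set"
  assumes 1: "pos_on \<sigma>1 S1" and 2: "pos_on \<sigma>2 S2"
    and 12: "\<And>x y. y \<in> S2 \<Longrightarrow> \<sigma>1 x y = 0" and 21: "\<And>x y. y \<in> S1 \<Longrightarrow> \<sigma>2 x y = 0"
    and S: "\<And>x. \<exists>y\<in>S1. \<exists>z\<in>S2. x = y + z"
    and F1: "frame \<sigma>1 S1 F1 (\<lambda>e. e)" and F2: "frame \<sigma>2 S2 F2 (\<lambda>e. e)" and c: "c > 0"
  shows "inner_product (\<lambda>x y. c\<^sup>2 * \<sigma>1 x y + \<sigma>2 x y)"
    and "frame (\<lambda>x y. c\<^sup>2 * \<sigma>1 x y + \<sigma>2 x y) UNIV (F1 <+> F2) (case_sum (\<lambda>e. (1 / c) *\<^sub>R e) (\<lambda>e. e))"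
proof -
  note b1 = bilinearD[OF pos_onD(1)[OF 1]] and b2 = bilinearD[OF pos_onD(1)[OF 2]]
  note s1 = pos_onD(2)[OF 1] and s2 = pos_onD(2)[OF 2]
  have z1: "\<sigma>1 y x = 0" if "y \<in> S2" for x y using 12[OF that] s1 by metis
  have z2: "\<sigma>2 y x = 0" if "y \<in> S1" for x y using 21[OF that] s2 by metis
  have split: "\<sigma>1 (y + z) w = \<sigma>1 y w" "\<sigma>2 (y + z) w = \<sigma>2 z w" if "y \<in> S1" "z \<in> S2" for y z w
    using that z1 z2 by (simp_all add: b1 b2)
  have p1: "\<sigma>1 y y \<ge> 0" if "y \<in> S1" for y using that pos_onD(3)[OF 1, of y] by (cases "y = 0") (auto simp: b1)
  have p2: "\<sigma>2 y y \<ge> 0" if "y \<in> S2" for y using that pos_onD(3)[OF 2, of y] by (cases "y = 0") (auto simp: b2)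
  show "inner_product (\<lambda>x y. c\<^sup>2 * \<sigma>1 x y + \<sigma>2 x y)"
    unfolding inner_product_def
  proof (intro conjI allI impI)
    show "bilinear (\<lambda>x y. c\<^sup>2 * \<sigma>1 x y + \<sigma>2 x y)"
      by (intro bilinear_plus bilinear_cmul pos_onD(1)[OF 1] pos_onD(1)[OF 2])
    show "c\<^sup>2 * \<sigma>1 x y + \<sigma>2 x y = c\<^sup>2 * \<sigma>1 y x + \<sigma>2 y x" for x y
      by (simp add: s1[of x y] s2[of x y])
    fix x :: 'a assume x: "x \<noteq> 0"
    obtain y z where yz: "y \<in> S1" "z \<in> S2" "x = y + z" using S by blast
    have e: "\<sigma>1 x x = \<sigma>1 y y" "\<sigma>2 x x = \<sigma>2 z z"
      using split[OF yz(1,2)] s1[of y "y + z"] s2[of z "y + z"] by (simp_all add: yz(3))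
    show "c\<^sup>2 * \<sigma>1 x x + \<sigma>2 x x > 0"
    proof (cases "y = 0")
      case True
      then have "\<sigma>2 z z > 0" using x yz pos_onD(3)[OF 2] by auto
      then show ?thesis using p1[OF yz(1)] by (simp add: e add_nonneg_pos)
    next
      case False
      then have "c\<^sup>2 * \<sigma>1 y y > 0" using yz pos_onD(3)[OF 1] c by simp
      then show ?thesis using p2[OF yz(2)] by (simp add: e add_pos_nonneg)
    qed
  qed
  have fin: "finite F1" "finite F2" and F: "e \<in> F1 \<Longrightarrow> e \<in> S1" "e \<in> F2 \<Longrightarrow> e \<in> S2" for e
    using F1 F2 by (auto simp: frame_def)
  show "frame (\<lambda>x y. c\<^sup>2 * \<sigma>1 x y + \<sigma>2 x y) UNIV (F1 <+> F2) (case_sum (\<lambda>e. (1 / c) *\<^sub>R e) (\<lambda>e. e))"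
    unfolding frame_def
  proof (intro conjI ballI)
    show "finite (F1 <+> F2)" using fin by simp
    fix x :: 'a
    obtain y z where yz: "y \<in> S1" "z \<in> S2" "x = y + z" using S by blast
    have "(\<Sum>e\<in>F1. (c\<^sup>2 * \<sigma>1 x ((1 / c) *\<^sub>R e) + \<sigma>2 x ((1 / c) *\<^sub>R e)) *\<^sub>R (1 / c) *\<^sub>R e) = (\<Sum>e\<in>F1. \<sigma>1 y e *\<^sub>R e)"
      using 21 F c by (intro sum.cong refl) (simp add: yz(3) split[OF yz(1,2)] b1 b2 power2_eq_square z1[OF yz(2)])
    moreover have "(\<Sum>e\<in>F2. (c\<^sup>2 * \<sigma>1 x e + \<sigma>2 x e) *\<^sub>R e) = (\<Sum>e\<in>F2. \<sigma>2 z e *\<^sub>R e)"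
      using 12 F by (intro sum.cong refl) (simp add: yz(3) split[OF yz(1,2)])
    moreover have "(\<Sum>e\<in>F1. \<sigma>1 y e *\<^sub>R e) = y" "(\<Sum>e\<in>F2. \<sigma>2 z e *\<^sub>R e) = z"
      using F1 F2 yz by (auto simp: frame_def)
    ultimately show "(\<Sum>i\<in>F1 <+> F2. (c\<^sup>2 * \<sigma>1 x (case_sum (\<lambda>e. (1 / c) *\<^sub>R e) (\<lambda>e. e) i)
        + \<sigma>2 x (case_sum (\<lambda>e. (1 / c) *\<^sub>R e) (\<lambda>e. e) i)) *\<^sub>R case_sum (\<lambda>e. (1 / c) *\<^sub>R e) (\<lambda>e. e) i) = x"
      by (simp add: sum.Plus fin yz(3))
  qed auto
qed

lemma frame_trace:
  assumes "bilinear b" "frame b UNIV I e" "linear g"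
  shows "(\<Sum>i\<in>I. b (g (e i)) (e i)) = trace_on scaleR UNIV g"
  using real_vector.trace_on_resolves[OF frame_resolves[OF assms(1,2)], of g] assms(3)
  by (simp add: endo_on_def linear_iff)

lemma trace_on_id: "trace_on scaleR UNIV (\<lambda>x::'a::euclidean_space. x) = real DIM('a)"
proof -
  have fr: "frame inner UNIV Basis (\<lambda>i::'a. i)" by (simp add: frame_def euclidean_representation)
  have bl: "bilinear (inner :: 'a \<Rightarrow> 'a \<Rightarrow> real)" by (intro bilinearI) (simp_all add: inner_simps)
  have "real DIM('a) = (\<Sum>i\<in>Basis. id i \<bullet> (i::'a))" by simp
  also have "\<dots> = trace_on scaleR UNIV (id :: 'a \<Rightarrow> 'a)" by (rule frame_trace[OF bl fr linear_id])
  finally show ?thesis by (simp only: id_def)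
qed

text \<open>What the metric construction uses of a compact Lie algebra \<open>\<uu> = T + Q\<close> and its representation
  \<open>V = V1 \<oplus> V2\<close>. The forms \<open>\<tau>\<close> and \<open>\<kappa>\<close> are the metrics on \<open>T\<close> and \<open>Q\<close>, extended by zero; the last
  assumption says that no nonzero element of \<open>T\<close> acts on \<open>Q\<close> by a skew operator.\<close>

locale split_representation =
  fixes br :: "'u::real_vector \<Rightarrow> 'u \<Rightarrow> 'u" and \<rho> :: "'u \<Rightarrow> 'v::euclidean_space \<Rightarrow> 'v"
    and T Q :: "'u set" and V1 V2 :: "'v set" and \<tau> \<kappa> :: "'u \<Rightarrow> 'u \<Rightarrow> real" and G :: "'u set"
  assumes br: "bilinear br" and br_alt: "br x x = 0" and rho: "bilinear \<rho>"
    and G: "finite G" "span G = UNIV"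
    and tr_ad: "trace_on scaleR UNIV (br x) = 0" and tr_rho: "trace_on scaleR UNIV (\<rho> x) = 0"
    and sub: "subspace T" "subspace Q" and TQ: "\<exists>t\<in>T. \<exists>q\<in>Q. x = t + q"
    and V: "direct_sum_decomposition V1 V2"
    and T_V: "t \<in> T \<Longrightarrow> v \<in> V1 \<Longrightarrow> \<rho> t v \<in> V1" "t \<in> T \<Longrightarrow> w \<in> V2 \<Longrightarrow> \<rho> t w \<in> V2"
    and Q_V: "q \<in> Q \<Longrightarrow> v \<in> V1 \<Longrightarrow> \<rho> q v \<in> V2"
    and Q_inj: "q \<in> Q \<Longrightarrow> (\<And>v. v \<in> V1 \<Longrightarrow> \<rho> q v = 0) \<Longrightarrow> q = 0"
    and TT: "s \<in> T \<Longrightarrow> t \<in> T \<Longrightarrow> br s t = 0" and T_Q: "t \<in> T \<Longrightarrow> q \<in> Q \<Longrightarrow> br t q \<in> Q"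
    and tau: "pos_on \<tau> T" and kappa: "pos_on \<kappa> Q"
    and tau_Q: "q \<in> Q \<Longrightarrow> \<tau> x q = 0" and kappa_T: "t \<in> T \<Longrightarrow> \<kappa> x t = 0"
    and not_skew: "t \<in> T \<Longrightarrow> t \<noteq> 0 \<Longrightarrow> \<exists>q\<in>Q. \<kappa> (br t q) q \<noteq> 0"
begin

lemmas ts = bilinearD[OF pos_onD(1)[OF tau]]
lemmas ks = bilinearD[OF pos_onD(1)[OF kappa]]
lemmas brs = bilinearD[OF br]
lemmas rhos = bilinearD[OF rho]

lemma br_skew: "br x y = - br y x"
  by (rule bilinear_alternating_skew[OF br br_alt])

text \<open>Pull back the inner product of \<open>V\<close> along the two projections of the decomposition.\<close>

lemma adapted_forms:
  obtains \<beta>1 \<beta>2 :: "'v \<Rightarrow> 'v \<Rightarrow> real" where "pos_on \<beta>1 V1" "pos_on \<beta>2 V2"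
    "\<And>v w. w \<in> V2 \<Longrightarrow> \<beta>1 v w = 0" "\<And>v w. w \<in> V1 \<Longrightarrow> \<beta>2 v w = 0"
proof -
  have S: "subspace V1" "subspace V2" and I: "V1 \<inter> V2 = {0}"
    and U: "\<exists>y. y \<in> V1 \<and> v - y \<in> V2" for v
  proof -
    show "subspace V1" "subspace V2" "V1 \<inter> V2 = {0}" using V by (auto simp: direct_sum_decomposition_def)
    have "v \<in> {v + w | v w. v \<in> V1 \<and> w \<in> V2}" using V by (auto simp: direct_sum_decomposition_def)
    then show "\<exists>y. y \<in> V1 \<and> v - y \<in> V2" by auto
  qed
  define p where "p v = (SOME y. y \<in> V1 \<and> v - y \<in> V2)" for v
  have p: "p v \<in> V1" "v - p v \<in> V2" for v using someI_ex[OF U[of v]] by (auto simp: p_def)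
  have uniq: "p v = y" if "y \<in> V1" "v - y \<in> V2" for v y
  proof -
    have "p v - y \<in> V1" using subspace_diff[OF S(1) p(1) that(1)] .
    moreover have "(v - y) - (v - p v) \<in> V2" using subspace_diff[OF S(2) that(2) p(2)] .
    ultimately have "p v - y \<in> V1 \<inter> V2" by simp
    then show ?thesis using I by simp
  qed
  have lin: "linear p"
  proof (rule linearI)
    show "p (v + w) = p v + p w" for v w
    proof (rule uniq)
      show "p v + p w \<in> V1" using subspace_add[OF S(1)] p by blast
      have "(v - p v) + (w - p w) \<in> V2" using subspace_add[OF S(2)] p by blast
      then show "v + w - (p v + p w) \<in> V2" by (simp add: algebra_simps)
    qed
    show "p (c *\<^sub>R v) = c *\<^sub>R p v" for c v
    proof (rule uniq)
      show "c *\<^sub>R p v \<in> V1" using subspace_scale[OF S(1)] p by blast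
      have "c *\<^sub>R (v - p v) \<in> V2" using subspace_scale[OF S(2)] p by blast
      then show "c *\<^sub>R v - c *\<^sub>R p v \<in> V2" by (simp add: algebra_simps)
    qed
  qed
  have p1: "p v = v" if "v \<in> V1" for v using that subspace_0[OF S(2)] by (intro uniq) auto
  have p2: "p v = 0" if "v \<in> V2" for v using that subspace_0[OF S(1)] by (intro uniq) auto
  have "bilinear (\<lambda>v w. p v \<bullet> p w)" "bilinear (\<lambda>v w. (v - p v) \<bullet> (w - p w))"
    by (intro bilinearI; simp add: linear_add[OF lin] linear_scale[OF lin] inner_simps algebra_simps)+
  then show ?thesis
    by (intro that[of "\<lambda>v w. p v \<bullet> p w" "\<lambda>v w. (v - p v) \<bullet> (w - p w)"])
       (auto simp: pos_on_def p1 p2 inner_commute)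
qed

text \<open>The metric is \<open>\<epsilon>\<^sup>2 \<tau> + \<kappa>\<close> on \<open>\<uu>\<close> and \<open>s\<^sup>2 \<beta>2 + \<beta>1\<close> on \<open>V\<close>. On \<open>T\<close> the symmetric part of the adjoint
  action contributes at least \<open>\<Sigma>\<close>, whatever \<open>\<epsilon>\<close> is, while the brackets \<open>[Q, Q]\<close> contribute
  \<open>\<epsilon>\<^sup>4 W\<close>; so a small \<open>\<epsilon>\<close> makes \<open>excess\<close> positive on \<open>T\<close>. After that, \<open>s\<close> multiplies the block of \<open>\<rho>\<close> from
  \<open>V1\<close> to \<open>V2\<close>, and Finsler's lemma produces positivity on all of \<open>\<uu>\<close>.\<close>

theorem negative_ricci_metric: "\<exists>ip. inner_product ip \<and> negative_ricci (semidirect_bracket br \<rho>) ip"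
proof -
  obtain \<beta>1 \<beta>2 where \<beta>1: "pos_on \<beta>1 V1" and \<beta>2: "pos_on \<beta>2 V2"
    and \<beta>12: "\<And>v w. w \<in> V2 \<Longrightarrow> \<beta>1 v w = 0" and \<beta>21: "\<And>v w. w \<in> V1 \<Longrightarrow> \<beta>2 v w = 0"
    using adapted_forms by metis
  have S: "subspace V1" "subspace V2" using V by (auto simp: direct_sum_decomposition_def)
  have UV: "\<exists>y\<in>V2. \<exists>z\<in>V1. v = y + z" for v
  proof -
    have "v \<in> {v + w | v w. v \<in> V1 \<and> w \<in> V2}" using V by (auto simp: direct_sum_decomposition_def)
    then show ?thesis using add.commute by blast
  qed
  note bs1 = bilinearD[OF pos_onD(1)[OF \<beta>1]] and bs2 = bilinearD[OF pos_onD(1)[OF \<beta>2]]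
  have GV: "finite (Basis::'v set)" "span Basis = (UNIV::'v set)" by auto
  obtain F1 where F1: "frame \<beta>1 V1 F1 (\<lambda>e. e)" by (rule pos_on_frame[OF \<beta>1 GV S(1)])
  obtain F2 where F2: "frame \<beta>2 V2 F2 (\<lambda>e. e)" by (rule pos_on_frame[OF \<beta>2 GV S(2)])
  obtain E where E: "frame \<tau> T E (\<lambda>e. e)" by (rule pos_on_frame[OF tau G sub(1)])
  obtain F where F: "frame \<kappa> Q F (\<lambda>e. e)" by (rule pos_on_frame[OF kappa G sub(2)])
  have mem: "e \<in> E \<Longrightarrow> e \<in> T" "e \<in> F \<Longrightarrow> e \<in> Q" "v \<in> F1 \<Longrightarrow> v \<in> V1" "v \<in> F2 \<Longrightarrow> v \<in> V2" for e v
    using E F F1 F2 by (auto simp: frame_def)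
  have fin: "finite E" "finite F" "finite F1" "finite F2" using E F F1 F2 by (auto simp: frame_def)
  \<comment> \<open>The part of the Ricci form on \<open>T\<close> that does not depend on the scale of \<open>T\<close>.\<close>
  define \<sigma> where "\<sigma> t q q' = (\<kappa> (br t q) q' + \<kappa> (br t q') q) / 2" for t q q'
  define \<Sigma> where "\<Sigma> s t = (\<Sum>q\<in>F. \<Sum>q'\<in>F. \<sigma> s q q' * \<sigma> t q q')" for s t
  define W where "W s t = (\<Sum>q\<in>F. \<Sum>q'\<in>F. \<tau> (br q q') s * \<tau> (br q q') t)" for s t
  have lin_\<sigma>: "linear (\<lambda>t. \<sigma> t q q')" for q q'
    by (simp add: linear_iff \<sigma>_def brs ks field_simps)
  have \<Sigma>: "pos_on \<Sigma> T"
    unfolding pos_on_def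
  proof (intro conjI allI ballI impI)
    show "bilinear \<Sigma>" unfolding \<Sigma>_def by (intro bilinear_Sum bilinear_prod lin_\<sigma>)
    show "\<Sigma> x y = \<Sigma> y x" for x y by (simp add: \<Sigma>_def mult.commute)
    fix t assume t: "t \<in> T" "t \<noteq> 0"
    have nn: "(\<Sum>q'\<in>F. \<sigma> t q q' * \<sigma> t q q') \<ge> 0" for q by (simp add: sum_nonneg)
    have "\<Sigma> t t \<noteq> 0"
    proof
      assume 0: "\<Sigma> t t = 0"
      have z: "\<sigma> t q q' = 0" if "q \<in> F" "q' \<in> F" for q q'
      proof -
        have "(\<Sum>q'\<in>F. \<sigma> t q q' * \<sigma> t q q') = 0"
          using 0 that(1) nn fin unfolding \<Sigma>_def by (simp add: sum_nonneg_eq_0_iff)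
        then show ?thesis using that(2) fin by (simp add: sum_nonneg_eq_0_iff)
      qed
      have "\<kappa> (br t q) q = 0" if q: "q \<in> Q" for q
      proof -
        define c where "c = \<kappa> q"
        have "(\<Sum>e\<in>F. c e *\<^sub>R e) = q" using F q by (simp add: frame_def c_def)
        then have "\<kappa> (br t q) q = \<kappa> (br t (\<Sum>e\<in>F. c e *\<^sub>R e)) (\<Sum>e\<in>F. c e *\<^sub>R e)" by simp
        also have "br t (\<Sum>e\<in>F. c e *\<^sub>R e) = (\<Sum>e\<in>F. c e *\<^sub>R br t e)"
          using br by (simp add: bilinear_def linear_sum linear_scale)
        also have "\<kappa> \<dots> (\<Sum>e\<in>F. c e *\<^sub>R e) = (\<Sum>e\<in>F. \<Sum>e'\<in>F. c e * c e' * \<kappa> (br t e) e')"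
          by (subst bilinear_left_sum[OF pos_onD(1)[OF kappa]])
             (simp add: bilinear_right_sum[OF pos_onD(1)[OF kappa]] sum_distrib_left mult.assoc)
        finally have *: "\<kappa> (br t q) q = (\<Sum>e\<in>F. \<Sum>e'\<in>F. c e * c e' * \<kappa> (br t e) e')" .
        also have "\<dots> = (\<Sum>e\<in>F. \<Sum>e'\<in>F. c e' * c e * \<kappa> (br t e') e)" by (rule sum.swap)
        finally have "2 * \<kappa> (br t q) q = (\<Sum>e\<in>F. \<Sum>e'\<in>F. c e * c e' * \<kappa> (br t e) e') +
            (\<Sum>e\<in>F. \<Sum>e'\<in>F. c e' * c e * \<kappa> (br t e') e)" using * by linarith
        also have "\<dots> = (\<Sum>e\<in>F. \<Sum>e'\<in>F. c e * c e' * (2 * \<sigma> t e e'))"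
        proof -
          have "2 * \<sigma> t e e' = \<kappa> (br t e) e' + \<kappa> (br t e') e" for e e' by (simp add: \<sigma>_def)
          then show ?thesis by (simp add: sum.distrib distrib_left mult.commute)
        qed
        also have "\<dots> = 0" using z by simp
        finally show ?thesis by simp
      qed
      then show False using not_skew[OF t] by blast
    qed
    moreover have "\<Sigma> t t \<ge> 0" unfolding \<Sigma>_def by (intro sum_nonneg nn)
    ultimately show "\<Sigma> t t > 0" by simp
  qed
  have "bilinear W" unfolding W_def using pos_onD(1)[OF tau]
    by (intro bilinear_Sum bilinear_prod) (auto simp: bilinear_def)
  moreover obtain E' where "frame \<Sigma> T E' (\<lambda>e. e)" by (rule pos_on_frame[OF \<Sigma> G sub(1)])
  ultimately obtain R where R: "R \<ge> 0" "\<And>t. t \<in> T \<Longrightarrow> \<bar>W t t\<bar> \<le> R * \<Sigma> t t"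
    using bilinear_form_bounded[OF pos_onD(1)[OF \<Sigma>]] by metis
  define \<epsilon> where "\<epsilon> = 1 / (R + 1)"
  have \<epsilon>: "\<epsilon> > 0" "\<epsilon> \<le> 1" "\<epsilon> * R \<le> 1" using R(1) by (auto simp: \<epsilon>_def field_simps)
  define a where "a x y = \<epsilon>\<^sup>2 * \<tau> x y + \<kappa> x y" for x y
  define I where "I = E <+> F"
  define e :: "'u + 'u \<Rightarrow> 'u" where "e = case_sum (\<lambda>e. (1 / \<epsilon>) *\<^sub>R e) (\<lambda>e. e)"
  have a: "inner_product a" and fra: "frame a UNIV I e"
    unfolding a_def[abs_def] I_def e_def
    using orthogonal_sum[OF tau kappa tau_Q kappa_T TQ E F \<epsilon>(1)] by blast+
  have abil: "bilinear a" using a by (simp add: inner_product_def)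
  note as = bilinearD[OF abil]
  \<comment> \<open>\<open>P\<close> is the block of \<open>\<rho>\<close> from \<open>V1\<close> to \<open>V2\<close> and \<open>P'\<close> the transpose of the opposite block. The metric with
    parameter \<open>s\<close> replaces them by \<open>s P\<close> and \<open>P' / s\<close>, so for \<open>s \<ge> 1\<close> the form \<open>excess\<close> is at least
    \<open>b0 + (s\<^sup>2 / 4) b1\<close>.\<close>
  define P where "P x g f = \<beta>2 (\<rho> x g) f" for x g f
  define P' where "P' x g f = \<beta>1 (\<rho> x f) g" for x g f
  define sa where "sa x i j = (a (br x (e i)) (e j) + a (br x (e j)) (e i)) / 2" for x i j
  define b0 where "b0 x y = (\<Sum>i\<in>I. \<Sum>j\<in>I. sa x i j * sa y i j)
    - 1/4 * (\<Sum>i\<in>I. \<Sum>j\<in>I. a (br (e i) (e j)) x * a (br (e i) (e j)) y)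
    - 1/2 * (\<Sum>g\<in>F1. \<Sum>f\<in>F2. P' x g f * P' y g f)" for x y
  define b1 where "b1 x y = (\<Sum>g\<in>F1. \<Sum>f\<in>F2. P x g f * P y g f)" for x y
  have lin: "linear (\<lambda>x. sa x i j)" "linear (\<lambda>x. a z x)" "linear (\<lambda>x. P x g f)" "linear (\<lambda>x. P' x g f)" for i j z g f
    by (simp_all add: linear_iff sa_def P_def P'_def brs as rhos bs1 bs2 field_simps)
  have b0: "bilinear b0" and b1: "bilinear b1"
    unfolding b0_def b1_def by (intro bilinear_minus bilinear_cmul bilinear_Sum bilinear_prod lin)+
  have b0_sym: "b0 x y = b0 y x" and b1_sym: "b1 x y = b1 y x" for x y
    by (simp_all add: b0_def b1_def mult.commute)
  have b0_T: "b0 t t > 0" if t: "t \<in> T" "t \<noteq> 0" for t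
  proof -
    have "(\<Sum>g\<in>F1. \<Sum>f\<in>F2. P' t g f * P' t g f) = 0"
    proof -
      have "P' t g f = 0" if "f \<in> F2" for g f
        unfolding P'_def using \<beta>12[OF T_V(2)[OF t(1) mem(4)[OF that]]] pos_onD(2)[OF \<beta>1] by metis
      then show ?thesis by simp
    qed
    moreover have "(\<Sum>i\<in>I. \<Sum>j\<in>I. sa t i j * sa t i j) \<ge> \<Sigma> t t"
    proof -
      have "sa t (Inr q) (Inr q') = \<sigma> t q q'" if "q \<in> F" "q' \<in> F" for q q'
        using that mem tau_Q by (simp add: sa_def \<sigma>_def a_def e_def)
      then have "\<Sigma> t t = (\<Sum>q\<in>F. \<Sum>q'\<in>F. sa t (Inr q) (Inr q') * sa t (Inr q) (Inr q'))"
        by (simp add: \<Sigma>_def)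
      also have "\<dots> \<le> (\<Sum>q\<in>F. \<Sum>j\<in>I. sa t (Inr q) j * sa t (Inr q) j)"
        unfolding I_def sum_Inl_Inr[OF fin(1,2)] by (intro sum_mono) (simp add: sum_nonneg)
      also have "\<dots> \<le> (\<Sum>i\<in>I. \<Sum>j\<in>I. sa t i j * sa t i j)"
      proof -
        have "(\<Sum>i\<in>I. \<Sum>j\<in>I. sa t i j * sa t i j) =
            (\<Sum>s\<in>E. \<Sum>j\<in>I. sa t (Inl s) j * sa t (Inl s) j) + (\<Sum>q\<in>F. \<Sum>j\<in>I. sa t (Inr q) j * sa t (Inr q) j)"
          unfolding I_def by (rule sum_Inl_Inr[OF fin(1,2)])
        moreover have "(\<Sum>s\<in>E. \<Sum>j\<in>I. sa t (Inl s) j * sa t (Inl s) j) \<ge> 0" by (intro sum_nonneg) simp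
        ultimately show ?thesis by linarith
      qed
      finally show ?thesis .
    qed
    moreover have "(\<Sum>i\<in>I. \<Sum>j\<in>I. a (br (e i) (e j)) t * a (br (e i) (e j)) t) \<le> \<Sigma> t t"
    proof -
      have at: "a y t = \<epsilon>\<^sup>2 * \<tau> y t" for y using kappa_T[OF t(1)] by (simp add: a_def)
      have tQ: "\<tau> y t = 0" if "y \<in> Q" for y using tau_Q[OF that] pos_onD(2)[OF tau] by metis
      have 1: "a (br (e (Inl s)) (e (Inl s'))) t = 0" if "s \<in> E" "s' \<in> E" for s s'
        using TT[OF mem(1)[OF that(1)] mem(1)[OF that(2)]] by (simp add: e_def brs as)
      have 2: "a (br (e (Inl s)) (e (Inr q))) t = 0" if "s \<in> E" "q \<in> F" for s q
        using tQ[OF T_Q[OF mem(1)[OF that(1)] mem(2)[OF that(2)]]] by (simp add: e_def at brs ts)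
      have 3: "a (br (e (Inr q)) (e (Inl s))) t = 0" if "s \<in> E" "q \<in> F" for s q
        using 2[OF that] br_skew[of "e (Inr q)" "e (Inl s)"] by (simp add: as)
      have "(\<Sum>i\<in>I. \<Sum>j\<in>I. a (br (e i) (e j)) t * a (br (e i) (e j)) t) =
          (\<Sum>q\<in>F. \<Sum>q'\<in>F. a (br q q') t * a (br q q') t)"
        unfolding I_def by (simp add: sum_Inl_Inr[OF fin(1,2)] 1 2 3) (simp add: e_def)
      also have "\<dots> = \<epsilon>^4 * W t t"
        by (simp add: at W_def sum_distrib_left power4_eq_xxxx power2_eq_square mult_ac)
      also have "\<dots> \<le> \<epsilon> * (R * \<Sigma> t t)"
      proof (intro mult_mono)
        show "\<epsilon>^4 \<le> \<epsilon>" using \<epsilon> power_decreasing[of 1 4 \<epsilon>] by simp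
        show "W t t \<le> R * \<Sigma> t t" using R(2)[OF t(1)] by simp
        show "0 \<le> W t t" unfolding W_def by (intro sum_nonneg) simp
      qed (use \<epsilon> in auto)
      also have "\<dots> \<le> 1 * \<Sigma> t t"
        unfolding mult.assoc[symmetric] using pos_onD(3)[OF \<Sigma> t] \<epsilon>(3) by (intro mult_right_mono) auto
      finally show ?thesis by simp
    qed
    moreover have "\<Sigma> t t > 0" by (rule pos_onD(3)[OF \<Sigma> t])
    ultimately show ?thesis unfolding b0_def by linarith
  qed
  have b1_T: "b1 t y = 0" if t: "t \<in> T" for t y
  proof -
    have "P t g f = 0" if "g \<in> F1" for g f
      unfolding P_def using \<beta>21[OF T_V(1)[OF t mem(3)[OF that]]] pos_onD(2)[OF \<beta>2] by metis
    then show ?thesis by (simp add: b1_def)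
  qed
  have b1_Q: "b1 q q > 0" if q: "q \<in> Q" "q \<noteq> 0" for q
  proof -
    have nn: "(\<Sum>f\<in>F2. P q g f * P q g f) \<ge> 0" for g by (simp add: sum_nonneg)
    have "b1 q q \<noteq> 0"
    proof
      assume 0: "b1 q q = 0"
      have "\<rho> q g = 0" if g: "g \<in> F1" for g
      proof -
        have "(\<Sum>f\<in>F2. P q g f * P q g f) = 0"
          using 0 g nn fin unfolding b1_def by (simp add: sum_nonneg_eq_0_iff)
        then have "P q g f = 0" if "f \<in> F2" for f using that fin by (simp add: sum_nonneg_eq_0_iff)
        moreover have "(\<Sum>f\<in>F2. P q g f *\<^sub>R f) = \<rho> q g"
          using F2 Q_V[OF q(1) mem(3)[OF g]] unfolding frame_def P_def by blast
        ultimately show ?thesis by simp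
      qed
      moreover have "\<rho> q v = (\<Sum>g\<in>F1. \<beta>1 v g *\<^sub>R \<rho> q g)" if "v \<in> V1" for v
      proof -
        have "\<rho> q v = \<rho> q (\<Sum>g\<in>F1. \<beta>1 v g *\<^sub>R g)" using F1 that by (simp add: frame_def)
        then show ?thesis using rho by (simp add: bilinear_def linear_sum linear_scale)
      qed
      ultimately show False using Q_inj[OF q(1)] q(2) by simp
    qed
    moreover have "b1 q q \<ge> 0" unfolding b1_def by (intro sum_nonneg nn)
    ultimately show ?thesis by simp
  qed
  obtain L where L: "\<And>L' x. L' \<ge> L \<Longrightarrow> x \<noteq> 0 \<Longrightarrow> b0 x x + L' * b1 x x > 0"
    by (rule finsler[OF b0 b0_sym b1 b1_sym G sub TQ b0_T b1_Q b1_T]) blast+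
  define s where "s = 1 + 4 * \<bar>L\<bar>"
  have s: "s \<ge> 1" "s\<^sup>2 / 4 \<ge> L"
  proof -
    show "s \<ge> 1" by (simp add: s_def)
    then have "s * 1 \<le> s * s" by (intro mult_left_mono) auto
    then show "s\<^sup>2 / 4 \<ge> L" by (simp add: s_def power2_eq_square)
  qed
  define b where "b v w = s\<^sup>2 * \<beta>2 v w + \<beta>1 v w" for v w
  define J where "J = F2 <+> F1"
  define fV :: "'v + 'v \<Rightarrow> 'v" where "fV = case_sum (\<lambda>e. (1 / s) *\<^sub>R e) (\<lambda>e. e)"
  have b: "inner_product b" and frb: "frame b UNIV J fV"
    unfolding b_def[abs_def] J_def fV_def
    using orthogonal_sum[OF \<beta>2 \<beta>1 \<beta>21 \<beta>12 UV F2 F1, of s] s(1) by auto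
  have bbil: "bilinear b" using b by (simp add: inner_product_def)
  interpret M: metric_representation br \<rho> a I e b J fV
  proof
    show "(\<Sum>i\<in>I. a (br x (e i)) (e i)) = 0" for x
      using frame_trace[OF abil fra, of "br x"] tr_ad[of x] br by (simp add: bilinear_def)
    show "(\<Sum>j\<in>J. b (\<rho> x (fV j)) (fV j)) = 0" for x
      using frame_trace[OF bbil frb, of "\<rho> x"] tr_rho[of x] rho by (simp add: bilinear_def)
  qed (fact br br_alt rho a fra b frb)+
  have fV: "fV (Inl w) = (1 / s) *\<^sub>R w" "fV (Inr w) = w" for w by (simp_all add: fV_def)
  have "M.dim = real DIM('v)"
    unfolding M.dim_def using frame_trace[OF bbil frb linear_id] trace_on_id[where 'a='v] by (simp add: id_def)
  then have dim: "M.dim \<ge> 1" using DIM_positive[where 'a='v] by simp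
  have "M.excess x > 0" if x: "x \<noteq> 0" for x
  proof -
    have sr: "(M.sym_rho x (Inr g) (Inl f))\<^sup>2 + (M.sym_rho x (Inl f) (Inr g))\<^sup>2 \<ge>
        s\<^sup>2 / 4 * (P x g f * P x g f) - 1/2 * (P' x g f * P' x g f)" if "g \<in> F1" "f \<in> F2" for g f
    proof -
      let ?P = "P x g f" and ?P' = "P' x g f"
      have eq: "M.sym_rho x (Inr g) (Inl f) = (s * ?P + ?P' / s) / 2" "M.sym_rho x (Inl f) (Inr g) = (s * ?P + ?P' / s) / 2"
      proof -
        have "b (\<rho> x g) ((1 / s) *\<^sub>R f) = s * ?P"
          using \<beta>12[OF mem(4)[OF that(2)]] s(1) by (simp add: b_def P_def bs1 bs2 power2_eq_square)
        moreover have "b (\<rho> x ((1 / s) *\<^sub>R f)) g = ?P' / s"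
          using \<beta>21[OF mem(3)[OF that(1)]] by (simp add: b_def P'_def bs1 bs2 rhos)
        ultimately show "M.sym_rho x (Inr g) (Inl f) = (s * ?P + ?P' / s) / 2"
          "M.sym_rho x (Inl f) (Inr g) = (s * ?P + ?P' / s) / 2"
          by (simp_all add: M.sym_rho_def fV add.commute)
      qed
      have "u\<^sup>2 / 4 - w\<^sup>2 / 2 \<le> ((u + w) / 2)\<^sup>2 + ((u + w) / 2)\<^sup>2" for u w :: real
        using zero_le_power2[of "u + 2 * w"] by (simp add: power2_eq_square field_simps)
      from this[of "s * ?P" "?P' / s"]
      have "(s * ?P)\<^sup>2 / 4 - (?P' / s)\<^sup>2 / 2 \<le>
          (M.sym_rho x (Inr g) (Inl f))\<^sup>2 + (M.sym_rho x (Inl f) (Inr g))\<^sup>2" unfolding eq .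
      moreover have "(?P' / s)\<^sup>2 \<le> ?P' * ?P'"
      proof -
        have "1 \<le> s\<^sup>2" using s(1) by simp
        then have "?P'\<^sup>2 / s\<^sup>2 \<le> ?P'\<^sup>2 / 1" by (intro divide_left_mono) auto
        then show ?thesis by (simp add: power_divide power2_eq_square)
      qed
      moreover have "(s * ?P)\<^sup>2 / 4 = s\<^sup>2 / 4 * (?P * ?P)" by (simp add: power2_eq_square)
      ultimately show ?thesis by linarith
    qed
    have "(\<Sum>i\<in>J. \<Sum>j\<in>J. (M.sym_rho x i j)\<^sup>2) \<ge>
        (\<Sum>g\<in>F1. \<Sum>f\<in>F2. (M.sym_rho x (Inr g) (Inl f))\<^sup>2) + (\<Sum>f\<in>F2. \<Sum>g\<in>F1. (M.sym_rho x (Inl f) (Inr g))\<^sup>2)"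
      unfolding J_def sum_Inl_Inr[OF fin(4,3)] by (simp add: sum.distrib sum_nonneg)
    also have "(\<Sum>f\<in>F2. \<Sum>g\<in>F1. (M.sym_rho x (Inl f) (Inr g))\<^sup>2) = (\<Sum>g\<in>F1. \<Sum>f\<in>F2. (M.sym_rho x (Inl f) (Inr g))\<^sup>2)"
      by (rule sum.swap)
    also have "(\<Sum>g\<in>F1. \<Sum>f\<in>F2. (M.sym_rho x (Inr g) (Inl f))\<^sup>2) + \<dots> \<ge>
        (\<Sum>g\<in>F1. \<Sum>f\<in>F2. s\<^sup>2 / 4 * (P x g f * P x g f) - 1/2 * (P' x g f * P' x g f))"
      unfolding sum.distrib[symmetric] by (intro sum_mono sr)
    also have "(\<Sum>g\<in>F1. \<Sum>f\<in>F2. s\<^sup>2 / 4 * (P x g f * P x g f) - 1/2 * (P' x g f * P' x g f)) =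
        s\<^sup>2 / 4 * b1 x x - 1/2 * (\<Sum>g\<in>F1. \<Sum>f\<in>F2. P' x g f * P' x g f)"
      by (simp only: b1_def sum_subtractf sum_distrib_left)
    finally have "M.excess x \<ge> b0 x x + s\<^sup>2 / 4 * b1 x x"
      unfolding M.excess_def b0_def M.sym_ad_def sa_def power2_eq_square by linarith
    then show ?thesis using L[OF s(2) x] by linarith
  qed
  then show ?thesis by (rule M.negative_ricci_exists[OF dim])
qed

end

section \<open>Polynomials in an operator\<close>

locale fd_complex = vector_space sc for sc :: "complex \<Rightarrow> 'v::ab_group_add \<Rightarrow> 'v" +
  assumes fin_dim: "\<exists>G. finite G \<and> span G = UNIV"
begin

definition lin :: "('v \<Rightarrow> 'v) \<Rightarrow> bool" where
  "lin h \<longleftrightarrow> (\<forall>x y. h (x + y) = h x + h y) \<and> (\<forall>c x. h (sc c x) = sc c (h x))"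

lemma linD:
  assumes "lin h"
  shows "h (x + y) = h x + h y" "h (sc c x) = sc c (h x)" "h 0 = 0" "h (- x) = - h x" "h (x - y) = h x - h y"
proof -
  show a: "h (x + y) = h x + h y" and s: "h (sc c x) = sc c (h x)" for x y c
    using assms by (auto simp: lin_def)
  show z: "h 0 = 0" using s[of 0 0] by simp
  show m: "h (- x) = - h x" for x using a[of "- x" x] z by (simp add: eq_neg_iff_add_eq_0)
  show "h (x - y) = h x - h y" using a[of x "- y"] m by simp
qed

lemma lin_sum: "lin h \<Longrightarrow> h (sum g A) = (\<Sum>a\<in>A. h (g a))"
  by (induction A rule: infinite_finite_induct) (auto simp: linD)

lemma lin_funpow: "lin h \<Longrightarrow> lin (h ^^ n)"
  by (induction n) (auto simp: lin_def)

text \<open>The value \<open>p(h) v\<close> of a polynomial in an operator.\<close>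

definition papp :: "('v \<Rightarrow> 'v) \<Rightarrow> complex poly \<Rightarrow> 'v \<Rightarrow> 'v" where
  "papp h p v = (\<Sum>i\<le>degree p. sc (coeff p i) ((h ^^ i) v))"

lemma papp_bound: "degree p \<le> n \<Longrightarrow> papp h p v = (\<Sum>i\<le>n. sc (coeff p i) ((h ^^ i) v))"
  unfolding papp_def by (rule sum.mono_neutral_left) (auto simp: coeff_eq_0)

lemma papp_0 [simp]: "papp h 0 v = 0" by (simp add: papp_def)

lemma papp_pCons:
  assumes "lin h"
  shows "papp h (pCons a p) v = sc a v + h (papp h p v)"
proof -
  have "papp h (pCons a p) v = (\<Sum>i\<le>Suc (degree p). sc (coeff (pCons a p) i) ((h ^^ i) v))"
    by (rule papp_bound) (simp add: degree_pCons_le)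
  also have "\<dots> = sc a v + (\<Sum>i\<le>degree p. sc (coeff p i) (h ((h ^^ i) v)))"
    by (simp only: sum.atMost_Suc_shift) simp
  also have "(\<Sum>i\<le>degree p. sc (coeff p i) (h ((h ^^ i) v))) = h (papp h p v)"
    by (simp add: papp_def lin_sum[OF assms] linD[OF assms])
  finally show ?thesis .
qed

lemma papp_add: "papp h (p + q) v = papp h p v + papp h q v"
proof -
  let ?n = "max (degree p) (degree q)"
  have "papp h (p + q) v = (\<Sum>i\<le>?n. sc (coeff (p + q) i) ((h ^^ i) v))"
    by (rule papp_bound) (simp add: degree_add_le)
  also have "\<dots> = papp h p v + papp h q v"
    by (simp add: papp_bound[of p ?n] papp_bound[of q ?n] scale_left_distrib sum.distrib)
  finally show ?thesis .
qed

lemma papp_smult: "papp h (smult a p) v = sc a (papp h p v)"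
  by (subst papp_bound[of _ "degree p"]) (simp_all add: papp_def scale_sum_right degree_smult_le)

lemma papp_1 [simp]: "papp h 1 v = v" by (simp add: papp_def)

lemma papp_linear: 
  assumes h: "lin h"
  shows "lin (papp h p)"
  using lin_funpow[OF h] unfolding lin_def papp_def
  by (simp add: scale_right_distrib sum.distrib scale_sum_right mult.commute)

lemma papp_mult:
  assumes h: "lin h"
  shows "papp h (p * q) v = papp h p (papp h q v)"
  by (induction p) (simp_all add: papp_pCons[OF h] papp_add papp_smult)

lemma papp_linear_factor: "lin h \<Longrightarrow> papp h [:- a, 1:] v = h v - sc a v"
  by (simp add: papp_pCons linD)

lemma papp_commute: "lin h \<Longrightarrow> papp h p (papp h q v) = papp h q (papp h p v)"
  by (metis papp_mult mult.commute)

lemma papp_apply: "lin h \<Longrightarrow> papp h p (h v) = h (papp h p v)"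
proof (induction p)
  case (pCons a p)
  then show ?case by (simp add: papp_pCons linD)
qed (simp add: linD)

text \<open>If \<open>x\<close> shifts eigenvalues of \<open>h\<close> by \<open>c\<close>, then \<open>p(h - c) x = x p(h)\<close>.\<close>

lemma papp_shift:
  assumes h: "lin h" and x: "lin x" and comm: "\<And>v. h (x v) = x (h v) + sc c (x v)"
  shows "papp h (pcompose p [:- c, 1:]) (x v) = x (papp h p v)"
proof (induction p)
  case (pCons a p)
  have "papp h (pcompose (pCons a p) [:- c, 1:]) (x v)
      = sc a (x v) + papp h [:- c, 1:] (papp h (pcompose p [:- c, 1:]) (x v))"
    by (simp only: pcompose_pCons papp_add papp_mult[OF h]) (simp add: papp_pCons[OF h] linD[OF h])
  also have "\<dots> = sc a (x v) + (h (x (papp h p v)) - sc c (x (papp h p v)))"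
    by (simp only: pCons papp_linear_factor[OF h])
  also have "\<dots> = x (papp h (pCons a p) v)"
    by (simp add: comm papp_pCons[OF h] linD[OF x])
  finally show ?case .
qed (simp add: linD[OF x])

lemma papp_mod:
  assumes h: "lin h" and K: "subspace K" "\<And>v. v \<in> K \<Longrightarrow> h v \<in> K" and v: "h v - sc m v \<in> K"
  shows "papp h p v - sc (poly p m) v \<in> K"
proof (induction p)
  case (pCons a p)
  have "papp h (pCons a p) v - sc (poly (pCons a p) m) v =
     h (papp h p v - sc (poly p m) v) + sc (poly p m) (h v - sc m v)"
    by (simp add: papp_pCons[OF h] linD[OF h] scale_left_distrib scale_right_diff_distrib mult.commute)
  also have "\<dots> \<in> K" using pCons K v by (intro subspace_add subspace_scale) auto
  finally show ?case .
qed (simp add: subspace_0 K)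

lemma papp_eigen: 
  assumes h: "lin h" and v: "h v = sc m v"
  shows "papp h p v = sc (poly p m) v"
  using papp_mod[OF h subspace_single_0, of v m p] v linD(3)[OF h] by simp

lemma papp_in:
  assumes h: "lin h" and K: "subspace K" "\<And>v. v \<in> K \<Longrightarrow> h v \<in> K" and v: "v \<in> K"
  shows "papp h p v \<in> K"
  by (induction p) (auto simp: papp_pCons[OF h] subspace_0 K v intro!: subspace_add subspace_scale)

text \<open>If \<open>p = (x - a) r\<close>, then \<open>r(h) w\<close> is an eigenvector for \<open>a\<close> that \<open>q(h)\<close> multiplies by \<open>q(a) \<noteq> 0\<close>, so it
  vanishes; the degree of \<open>p\<close> drops until \<open>w\<close> itself is reached.\<close>

lemma coprime_annihilators:
  assumes h: "lin h" and "p \<noteq> 0" and "\<And>z. poly p z = 0 \<Longrightarrow> poly q z \<noteq> 0"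
    and "papp h p w = 0" and q: "papp h q w = 0"
  shows "w = 0"
  using assms(2-4)
proof (induction "degree p" arbitrary: p)
  case 0
  then obtain a where a: "p = [:a:]" by (metis degree_eq_zeroE)
  then show ?case using 0 by (simp add: papp_pCons[OF h] linD[OF h])
next
  case (Suc n)
  then have "\<not> constant (poly p)" unfolding constant_degree by simp
  then obtain a where a: "poly p a = 0" using fundamental_theorem_of_algebra by blast
  then obtain r where r: "p = [:- a, 1:] * r" by (auto simp: poly_eq_0_iff_dvd)
  have r0: "r \<noteq> 0" using Suc.prems(1) r by auto
  then have "degree p = degree [:- a, 1:] + degree r" unfolding r by (intro degree_mult_eq) auto
  then have deg: "degree r = n" using Suc.hyps(2) by simp
  let ?u = "papp h r w"
  have "h ?u - sc a ?u = 0" using Suc.prems(3) unfolding r papp_mult[OF h] papp_linear_factor[OF h] .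
  then have "papp h q ?u = sc (poly q a) ?u" by (intro papp_eigen[OF h]) simp
  moreover have "papp h q ?u = 0"
    by (subst papp_commute[OF h]) (simp add: q linD[OF papp_linear[OF h]])
  ultimately have "?u = 0" using Suc.prems(2)[OF a] by simp
  then show ?case using Suc.hyps(1)[OF deg[symmetric] r0] Suc.prems(2) r by simp
qed

text \<open>The vectors \<open>v, h v, h\<^sup>2 v, \<dots>\<close> are dependent.\<close>

lemma annihilator_vector:
  assumes h: "lin h"
  obtains p where "p \<noteq> 0" "papp h p v = 0"
proof -
  obtain G where G: "finite G" "span G = UNIV" using fin_dim by blast
  define w where "w i = (h ^^ i) v" for i
  define n where "n = card G"
  show ?thesis
  proof (cases "inj_on w {..n}")
    case False
    then obtain i j where ij: "i \<noteq> j" "w i = w j" by (auto simp: inj_on_def)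
    have "papp h (monom 1 i - monom 1 j) v = 0"
    proof -
      have m: "papp h (monom 1 k) v = w k" for k
        by (simp add: papp_def degree_monom_eq w_def if_distrib[of "\<lambda>c. sc c _"] sum.delta cong: if_cong)
      have "papp h ((monom 1 i - monom 1 j) + monom 1 j) v = papp h (monom 1 i - monom 1 j) v + papp h (monom 1 j) v"
        by (rule papp_add)
      then show ?thesis using ij by (simp add: m)
    qed
    moreover have "monom 1 i - monom (1::complex) j \<noteq> 0" using ij(1) by (simp add: monom_eq_iff')
    ultimately show ?thesis using that by blast
  next
    case True
    have "dependent (w ` {..n})"
    proof (rule ccontr)
      assume "independent (w ` {..n})"
      then have "card (w ` {..n}) \<le> card G" using independent_span_bound[OF G(1)] G(2) by simp
      then show False using True by (simp add: card_image n_def)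
    qed
    then obtain u where u: "(\<Sum>x\<in>w ` {..n}. sc (u x) x) = 0" "\<exists>x\<in>w ` {..n}. u x \<noteq> 0"
      using dependent_finite[of "w ` {..n}"] by auto
    define p where "p = (\<Sum>i\<le>n. monom (u (w i)) i)"
    have c: "coeff p i = (if i \<le> n then u (w i) else 0)" for i
      by (simp add: p_def coeff_sum sum.delta' if_distrib cong: if_cong)
    have "degree p \<le> n" by (rule degree_le) (simp add: c)
    then have "papp h p v = (\<Sum>i\<le>n. sc (u (w i)) (w i))"
      by (simp add: papp_bound c w_def)
    also have "\<dots> = (\<Sum>x\<in>w ` {..n}. sc (u x) x)" using True by (simp add: sum.reindex)
    finally have "papp h p v = 0" using u(1) by simp
    moreover have "p \<noteq> 0"
    proof
      assume "p = 0"
      then have "u (w i) = 0" if "i \<le> n" for i using c[of i] that by simp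
      then show False using u(2) by auto
    qed
    ultimately show ?thesis using that by blast
  qed
qed

lemma annihilator:
  assumes h: "lin h"
  obtains p where "p \<noteq> 0" "\<And>v. papp h p v = 0"
proof -
  obtain G where G: "finite G" "span G = UNIV" using fin_dim by blast
  have "\<exists>p. p \<noteq> 0 \<and> (\<forall>v\<in>G'. papp h p v = 0)" if "finite G'" for G'
    using that
  proof (induction G' rule: finite_induct)
    case empty
    show ?case by (intro exI[of _ 1]) auto
  next
    case (insert g G')
    then obtain p where p: "p \<noteq> 0" "\<And>v. v \<in> G' \<Longrightarrow> papp h p v = 0" by blast
    obtain q where q: "q \<noteq> 0" "papp h q g = 0" using annihilator_vector[OF h] by blast
    have "papp h (q * p) v = 0" if "v \<in> insert g G'" for v
    proof (cases "v = g")
      case True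
      then show ?thesis using q by (simp add: mult.commute[of q] papp_mult[OF h] linD[OF papp_linear[OF h]])
    next
      case False
      then show ?thesis using that p by (simp add: papp_mult[OF h] linD[OF papp_linear[OF h]])
    qed
    then show ?case using p q by (intro exI[of _ "q * p"]) auto
  qed
  from this[OF G(1)] obtain p where p: "p \<noteq> 0" "\<And>v. v \<in> G \<Longrightarrow> papp h p v = 0" by blast
  have "papp h p v = 0" for v
  proof -
    have "v \<in> span G" using G by simp
    then show ?thesis
    proof (induction rule: span_induct_alt)
      case base
      show ?case by (simp add: linD[OF papp_linear[OF h]])
    next
      case (step c x y)
      then show ?case using p by (simp add: linD[OF papp_linear[OF h]])
    qed
  qed
  then show ?thesis using that p by blast
qed

text \<open>If \<open>p(h) = 0\<close>, then \<open>x\<^sup>k v\<close> is annihilated by \<open>p(h)\<close> and by \<open>p(h - k c)\<close>. For all but finitely many \<open>k\<close>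
  these polynomials have no common root.\<close>

lemma ladder_nilpotent:
  assumes h: "lin h" and x: "lin x" and comm: "\<And>v. h (x v) = x (h v) + sc c (x v)" and c: "c \<noteq> 0"
  obtains k where "\<And>v. (x ^^ k) v = 0"
proof -
  obtain p where p: "p \<noteq> 0" "\<And>v. papp h p v = 0" using annihilator[OF h] by blast
  have comm_k: "h ((x ^^ k) v) = (x ^^ k) (h v) + sc (of_nat k * c) ((x ^^ k) v)" for k v
    by (induction k) (simp_all add: comm linD[OF x] scale_left_distrib algebra_simps)
  define Z where "Z = {z. poly p z = 0}"
  have "finite ((\<lambda>(z, z'). (z - z') / c) ` (Z \<times> Z))" unfolding Z_def using poly_roots_finite[OF p(1)] by simp
  then have "\<exists>k. (of_nat k :: complex) \<notin> (\<lambda>(z, z'). (z - z') / c) ` (Z \<times> Z)"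
    using range_inj_infinite[of "of_nat :: nat \<Rightarrow> complex"] inj_of_nat
    by (metis (no_types, lifting) finite_subset image_subsetI)
  then obtain k where k: "(of_nat k :: complex) \<notin> (\<lambda>(z, z'). (z - z') / c) ` (Z \<times> Z)" by blast
  have "(x ^^ k) v = 0" for v
  proof (rule coprime_annihilators[OF h p(1)])
    show "papp h p ((x ^^ k) v) = 0" by (rule p(2))
    show "papp h (pcompose p [:- (of_nat k * c), 1:]) ((x ^^ k) v) = 0"
      unfolding papp_shift[OF h lin_funpow[OF x] comm_k] by (simp add: p linD[OF lin_funpow[OF x]])
    show "poly (pcompose p [:- (of_nat k * c), 1:]) z \<noteq> 0" if "poly p z = 0" for z
    proof
      assume "poly (pcompose p [:- (of_nat k * c), 1:]) z = 0"
      then have "z - of_nat k * c \<in> Z" by (simp add: poly_pcompose Z_def)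
      then have "(z, z - of_nat k * c) \<in> Z \<times> Z" using that by (simp add: Z_def)
      then have "(z - (z - of_nat k * c)) / c \<in> (\<lambda>(z, z'). (z - z') / c) ` (Z \<times> Z)" by force
      then show False using k c by simp
    qed
  qed
  then show ?thesis using that by blast
qed

text \<open>Diagonalizability is expressed through polynomials with simple roots: the vectors annihilated by one
  of them form the sum of the eigenspaces.\<close>

definition split_poly :: "complex set \<Rightarrow> complex poly" where "split_poly A = (\<Prod>a\<in>A. [:- a, 1:])"

definition diagonal_part :: "('v \<Rightarrow> 'v) \<Rightarrow> 'v set" where
  "diagonal_part h = {v. \<exists>A. finite A \<and> papp h (split_poly A) v = 0}"

lemma poly_split_poly: "finite A \<Longrightarrow> poly (split_poly A) z = 0 \<longleftrightarrow> z \<in> A"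
  by (auto simp: split_poly_def poly_prod)

lemma split_poly_insert: "finite A \<Longrightarrow> a \<notin> A \<Longrightarrow> split_poly (insert a A) = [:- a, 1:] * split_poly A"
  by (simp add: split_poly_def)

lemma split_poly_mono: "finite B \<Longrightarrow> A \<subseteq> B \<Longrightarrow> split_poly B = split_poly (B - A) * split_poly A"
  unfolding split_poly_def by (simp add: prod.subset_diff)

lemma split_poly_kernel_mono: "lin h \<Longrightarrow> finite B \<Longrightarrow> A \<subseteq> B \<Longrightarrow> papp h (split_poly A) v = 0 \<Longrightarrow> papp h (split_poly B) v = 0"
  by (simp add: split_poly_mono papp_mult linD[OF papp_linear])

lemma diagonal_part_subspace:
  assumes h: "lin h"
  shows "subspace (diagonal_part h)"
proof (rule subspaceI)
  show "0 \<in> diagonal_part h" by (auto simp: diagonal_part_def linD[OF papp_linear[OF h]])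
  show "x + y \<in> diagonal_part h" if xy: "x \<in> diagonal_part h" "y \<in> diagonal_part h" for x y
  proof -
    obtain A B where "finite A" "papp h (split_poly A) x = 0" "finite B" "papp h (split_poly B) y = 0"
      using xy by (auto simp: diagonal_part_def)
    then have "papp h (split_poly (A \<union> B)) (x + y) = 0" "finite (A \<union> B)"
      using split_poly_kernel_mono[OF h, of "A \<union> B" A x] split_poly_kernel_mono[OF h, of "A \<union> B" B y]
      by (auto simp: linD[OF papp_linear[OF h]])
    then show ?thesis by (auto simp: diagonal_part_def)
  qed
  show "sc c x \<in> diagonal_part h" if "x \<in> diagonal_part h" for c x
    using that by (auto simp: diagonal_part_def linD[OF papp_linear[OF h]])
qed

lemma diagonal_part_shift:
  assumes h: "lin h" and x: "lin x" and comm: "\<And>v. h (x v) = x (h v) + sc c (x v)" and v: "v \<in> diagonal_part h"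
  shows "x v \<in> diagonal_part h"
proof -
  obtain A where A: "finite A" "papp h (split_poly A) v = 0" using v by (auto simp: diagonal_part_def)
  have "pcompose (split_poly A) [:- c, 1:] = split_poly ((\<lambda>a. a + c) ` A)"
    unfolding split_poly_def pcompose_prod
    by (subst prod.reindex) (auto simp: inj_on_def pcompose_pCons intro!: prod.cong)
  then have "papp h (split_poly ((\<lambda>a. a + c) ` A)) (x v) = 0"
    using papp_shift[OF h x comm, of "split_poly A" v] A by (simp add: linD[OF x])
  then show ?thesis using A by (auto simp: diagonal_part_def)
qed

text \<open>By induction on the roots: \<open>h v - a v\<close> is a sum of eigenvectors for the other roots, on whose span \<open>h - a\<close> is
  invertible; subtracting the preimage from \<open>v\<close> leaves an eigenvector for \<open>a\<close>. All vectors stay in \<open>W\<close>.\<close>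

lemma split_poly_eigenvectors:
  assumes h: "lin h" and W: "subspace W" "\<And>w. w \<in> W \<Longrightarrow> h w \<in> W"
    and A: "finite A" and v: "v \<in> W" "papp h (split_poly A) v = 0"
  shows "v \<in> span {w \<in> W. \<exists>a\<in>A. h w = sc a w}"
  using A v
proof (induction A arbitrary: v rule: finite_induct)
  case empty
  then show ?case by (simp add: split_poly_def span_zero)
next
  case (insert a A)
  let ?E = "\<lambda>A. {w \<in> W. \<exists>a\<in>A. h w = sc a w}"
  have mono: "span (?E A) \<subseteq> span (?E (insert a A))" by (rule span_mono) auto
  let ?u = "h v - sc a v"
  have "papp h (split_poly A) ?u = 0"
    using insert.prems(2) unfolding split_poly_insert[OF insert.hyps] papp_mult[OF h]
    by (subst (asm) papp_commute[OF h]) (simp add: papp_linear_factor[OF h])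
  moreover have "?u \<in> W" using insert.prems W by (intro subspace_diff subspace_scale) auto
  ultimately have u: "?u \<in> span (?E A)" using insert.IH by blast
  have "\<exists>y\<in>span (?E A). h y - sc a y = ?u"
    using u
  proof (induction rule: span_induct_alt)
    case base
    show ?case by (intro bexI[of _ 0]) (auto simp: linD[OF h] span_zero)
  next
    case (step c x z)
    then obtain y b where y: "y \<in> span (?E A)" "h y - sc a y = z" and b: "b \<in> A" "h x = sc b x" and x: "x \<in> ?E A"
      by auto
    have ba: "b - a \<noteq> 0" using b insert.hyps by auto
    define k where "k = c / (b - a)"
    have "k * (b - a) = c" using ba by (simp add: k_def)
    then have kc: "sc c x = sc (k * b) x - sc (k * a) x"
      by (simp only: scale_left_diff_distrib[symmetric] right_diff_distrib[symmetric])
    have "h (sc k x + y) - sc a (sc k x + y) = sc c x + z"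
      by (simp add: linD[OF h] b y(2)[symmetric] kc scale_right_distrib mult.commute algebra_simps)
    then show ?case using span_add[OF span_scale[OF span_base[OF x]] y(1)] by blast
  qed
  then obtain y where y: "y \<in> span (?E A)" "h y - sc a y = ?u" by blast
  have "span (?E A) \<subseteq> W" using W by (intro span_minimal) auto
  then have "v - y \<in> W" using y insert.prems W by (auto intro: subspace_diff)
  moreover have "h (v - y) = sc a (v - y)"
    using y(2) by (simp add: linD[OF h] scale_right_diff_distrib algebra_simps)
  ultimately have "v - y \<in> span (?E (insert a A))" by (intro span_base) auto
  then have "(v - y) + y \<in> span (?E (insert a A))" using y mono by (intro span_add) auto
  then show ?case by simp
qed

end

section \<open>Diagonalizability in representations of \<open>sl2\<close>\<close>

locale sl2_triple = fd_complex sc for sc :: "complex \<Rightarrow> 'v::ab_group_add \<Rightarrow> 'v" +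
  fixes e f h :: "'v \<Rightarrow> 'v"
  assumes lin_e: "lin e" and lin_f: "lin f" and lin_h: "lin h"
    and ef: "e (f v) - f (e v) = h v"
    and he: "h (e v) = e (h v) + sc 2 (e v)" and hf: "h (f v) = f (h v) + sc (- 2) (f v)"
begin

lemmas le = linD[OF lin_e]
lemmas lf = linD[OF lin_f]
lemmas lh = linD[OF lin_h]

lemma sc2: "sc 2 v = v + v"
  by (metis one_add_one scale_left_distrib scale_one)

lemma ef': "e (f v) = f (e v) + h v" using ef[of v] by (simp add: algebra_simps)

lemma h_fk: "h ((f ^^ k) v) = (f ^^ k) (h v) - sc (2 * of_nat k) ((f ^^ k) v)"
proof (induction k)
  case (Suc k)
  have "h ((f ^^ Suc k) v) = f (h ((f ^^ k) v)) + sc (- 2) (f ((f ^^ k) v))" by (simp add: hf)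
  also have "\<dots> = f ((f ^^ k) (h v)) - (sc (2 * of_nat k) (f ((f ^^ k) v)) + sc 2 (f ((f ^^ k) v)))"
    unfolding Suc by (simp add: lf)
  also have "\<dots> = (f ^^ Suc k) (h v) - sc (2 * of_nat (Suc k)) ((f ^^ Suc k) v)"
    by (simp add: scale_left_distrib distrib_left add.commute)
  finally show ?case .
qed simp

definition invariant :: "'v set \<Rightarrow> bool" where
  "invariant K \<longleftrightarrow> subspace K \<and> (\<forall>v\<in>K. e v \<in> K \<and> f v \<in> K \<and> h v \<in> K)"

lemma invariantD:
  assumes "invariant K"
  shows "subspace K" "v \<in> K \<Longrightarrow> e v \<in> K" "v \<in> K \<Longrightarrow> f v \<in> K" "v \<in> K \<Longrightarrow> h v \<in> K"
  using assms by (auto simp: invariant_def)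

lemma funpow_in: "v \<in> K \<Longrightarrow> (\<And>v. v \<in> K \<Longrightarrow> g v \<in> K) \<Longrightarrow> (g ^^ k) v \<in> K"
  by (induction k) auto

lemma e_papp_h:
  assumes K: "invariant K" and v: "e v \<in> K"
  shows "e (papp h p v) \<in> K"
proof -
  have "papp h (pcompose p [:- 2, 1:]) (e v) = e (papp h p v)" by (rule papp_shift[OF lin_h lin_e he])
  then show ?thesis using papp_in[OF lin_h invariantD(1,4)[OF K] v] by metis
qed

text \<open>The identity \<open>[e, f\<^sup>k] = k f\<^sup>k\<^sup>-\<^sup>1 (h - (k - 1))\<close>, read modulo an invariant subspace into which \<open>e\<close> sends \<open>v\<close>.
  Working modulo \<open>K\<close> avoids quotient representations.\<close>

lemma e_f_power:
  assumes K: "invariant K" and v: "e v \<in> K"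
  shows "e ((f ^^ Suc k) v) - sc (of_nat (Suc k)) ((f ^^ k) (h v - sc (of_nat k) v)) \<in> K"
proof (induction k)
  case 0
  then show ?case using v by (simp add: ef' lf invariantD[OF K])
next
  case (Suc k)
  have "e ((f ^^ Suc (Suc k)) v) - sc (of_nat (Suc (Suc k))) ((f ^^ Suc k) (h v - sc (of_nat (Suc k)) v))
     = f (e ((f ^^ Suc k) v) - sc (of_nat (Suc k)) ((f ^^ k) (h v - sc (of_nat k) v)))"
    by (simp add: ef' lf linD[OF lin_funpow[OF lin_f]] hf h_fk scale_right_diff_distrib scale_right_distrib
        scale_left_distrib scale_left_diff_distrib sc2 algebra_simps)
  also have "\<dots> \<in> K" using Suc invariantD[OF K] by blast
  finally show ?case .
qed

text \<open>Modulo \<open>K\<close>, the operator \<open>e\<^sup>k f\<^sup>k\<close> acts on \<open>v\<close> as \<open>k! h (h - 1) \<dots> (h - k + 1)\<close>. As \<open>f\<close> is nilpotent, this product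
  vanishes on \<open>v\<close> modulo \<open>K\<close> for large \<open>k\<close>, and it has simple, nonnegative integral roots.\<close>

lemma e_power_f_power:
  assumes K: "invariant K" and v: "e v \<in> K"
  shows "(e ^^ k) ((f ^^ k) v) - sc (fact k) (papp h (split_poly (of_nat ` {..<k})) v) \<in> K"
  using v
proof (induction k arbitrary: v)
  case 0
  then show ?case by (simp add: split_poly_def subspace_0 invariantD[OF K])
next
  case (Suc k)
  let ?w = "h v - sc (of_nat k) v"
  have w: "?w = papp h [:- of_nat k, 1:] v" by (simp add: papp_linear_factor[OF lin_h])
  have ew: "e ?w \<in> K" unfolding w by (rule e_papp_h[OF K Suc.prems])
  have 1: "(e ^^ k) (e ((f ^^ Suc k) v) - sc (of_nat (Suc k)) ((f ^^ k) ?w)) \<in> K"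
    by (rule funpow_in[OF e_f_power[OF K Suc.prems] invariantD(2)[OF K]])
  have 2: "sc (of_nat (Suc k)) ((e ^^ k) ((f ^^ k) ?w) - sc (fact k) (papp h (split_poly (of_nat ` {..<k})) ?w)) \<in> K"
    by (rule subspace_scale[OF invariantD(1)[OF K] Suc.IH[OF ew]])
  have "split_poly (of_nat ` {..<Suc k}) = [:- of_nat k, 1:] * split_poly (of_nat ` {..<k})"
    by (simp add: lessThan_Suc split_poly_insert image_iff)
  then have 3: "papp h (split_poly (of_nat ` {..<k})) ?w = papp h (split_poly (of_nat ` {..<Suc k})) v"
    unfolding w by (simp only: papp_mult[OF lin_h]) (rule papp_commute[OF lin_h])
  have "(e ^^ Suc k) ((f ^^ Suc k) v) - sc (fact (Suc k)) (papp h (split_poly (of_nat ` {..<Suc k})) v) =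
      (e ^^ k) (e ((f ^^ Suc k) v) - sc (of_nat (Suc k)) ((f ^^ k) ?w)) +
      sc (of_nat (Suc k)) ((e ^^ k) ((f ^^ k) ?w) - sc (fact k) (papp h (split_poly (of_nat ` {..<k})) ?w))"
    unfolding 3
    by (simp add: funpow_swap1 linD[OF lin_funpow[OF lin_e]] scale_right_diff_distrib del: funpow.simps)
       (simp add: funpow_Suc_right algebra_simps del: funpow.simps)
  also have "\<dots> \<in> K" by (rule subspace_add[OF invariantD(1)[OF K] 1 2])
  finally show ?case .
qed

lemma e_nilpotent: obtains n where "\<And>v. (e ^^ n) v = 0"
  using ladder_nilpotent[OF lin_h lin_e he] by (metis zero_neq_numeral)

lemma f_nilpotent: obtains n where "\<And>v. (f ^^ n) v = 0"
  using ladder_nilpotent[OF lin_h lin_f hf] by (metis neg_equal_0_iff_equal zero_neq_numeral)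

lemma invariant_diagonal_part: "invariant (diagonal_part h)"
proof -
  have "h v \<in> diagonal_part h" if "v \<in> diagonal_part h" for v
    using diagonal_part_shift[OF lin_h lin_h, of 0 v] that by simp
  then show ?thesis
    using diagonal_part_subspace[OF lin_h] diagonal_part_shift[OF lin_h lin_e he] diagonal_part_shift[OF lin_h lin_f hf]
    by (auto simp: invariant_def)
qed

lemma highest_weight_diagonalizable:
  assumes "e v = 0"
  shows "v \<in> diagonal_part h"
proof -
  obtain k where k: "\<And>v. (f ^^ k) v = 0" by (rule f_nilpotent) blast
  have inv: "invariant {0}" by (auto simp: invariant_def subspace_single_0 le lf lh)
  have "sc (fact k) (papp h (split_poly (of_nat ` {..<k})) v) = 0"
    using e_power_f_power[OF inv, of v k] assms by (simp add: k linD[OF lin_funpow[OF lin_e]])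
  then have "papp h (split_poly (of_nat ` {..<k})) v = 0" by simp
  then show ?thesis unfolding diagonal_part_def by blast
qed

text \<open>On a weight space of weight \<open>m\<close> the operator \<open>T = e f\<close> has the eigenvalues
  \<open>(i + 1) (m + i)\<close>: this is its value on \<open>f\<^sup>i w\<close> for a highest weight vector \<open>w\<close> of weight \<open>m + 2 i\<close>. The products
  \<open>R\<close> and \<open>S\<close> of the factors \<open>T - (i + 1) (m + i)\<close> start with \<open>i = 0\<close> and \<open>i = 1\<close> respectively.\<close>

definition T where "T v = e (f v)"

definition casimir_value :: "complex \<Rightarrow> nat \<Rightarrow> complex" where "casimir_value m i = of_nat (Suc i) * (m + of_nat i)"

primrec S :: "complex \<Rightarrow> nat \<Rightarrow> 'v \<Rightarrow> 'v" where
  "S m 0 v = v"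
| "S m (Suc n) v = T (S m n v) - sc (casimir_value m (Suc n)) (S m n v)"

primrec R :: "complex \<Rightarrow> nat \<Rightarrow> 'v \<Rightarrow> 'v" where
  "R m 0 v = v"
| "R m (Suc n) v = T (R m n v) - sc (casimir_value m n) (R m n v)"

lemma lin_T: "lin T" unfolding T_def[abs_def] lin_def by (simp add: le lf)

lemmas lT = linD[OF lin_T]

lemma T_h: "h (T v) = T (h v)"
  by (simp add: T_def he hf le lf)

lemma S_h: "h (S m n v) = S m n (h v)"
  by (induction n) (simp_all add: lh T_h lT)

lemma S_scale: "S m n (sc c v) = sc c (S m n v)"
  by (induction n) (simp_all add: lT scale_right_diff_distrib mult.commute)

lemma R_eq: "R m (Suc n) v = T (S m n v) - sc (casimir_value m 0) (S m n v)"
proof (induction n)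
  case (Suc n)
  have "R m (Suc (Suc n)) v = T (R m (Suc n) v) - sc (casimir_value m (Suc n)) (R m (Suc n) v)" by simp
  then show ?case unfolding Suc by (simp add: lT scale_right_diff_distrib algebra_simps)
qed simp

text \<open>Moving \<open>e\<close> past a factor of \<open>S\<close> raises the weight by \<open>2\<close> and turns it into a factor of \<open>R\<close>. The
  hypothesis on \<open>e v\<close> is inherited by every further factor, as \<open>T\<close> commutes with \<open>h\<close>.\<close>

lemma e_S:
  assumes "h (e v) = sc (m + 2) (e v)"
  shows "h (e (S m n v)) = sc (m + 2) (e (S m n v))" "e (S m n v) = R (m + 2) n (e v)"
proof (induction n)
  case 0
  { case 1 then show ?case using assms by simp }
  { case 2 then show ?case by simp }
next
  case (Suc n)
  let ?u = "S m n v"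
  have eh: "e (h ?u) = sc m (e ?u)"
    using Suc.IH(1) he[of ?u] by (simp add: scale_left_distrib)
  have eT: "e (T ?u) = T (e ?u) + sc m (e ?u)"
    unfolding T_def by (simp add: ef'[of ?u] le eh)
  have "casimir_value m (Suc n) - m = casimir_value (m + 2) n" by (simp add: casimir_value_def algebra_simps)
  then have c: "casimir_value m (Suc n) = casimir_value (m + 2) n + m" by (simp add: algebra_simps)
  have eS: "e (S m (Suc n) v) = T (e ?u) - sc (casimir_value (m + 2) n) (e ?u)"
    by (simp add: le eT c scale_left_distrib)
  { case 1
    show ?case unfolding eS using Suc.IH(1) by (simp add: lh T_h lT scale_right_diff_distrib mult.commute) }
  { case 2
    show ?case unfolding eS using Suc.IH(2) by simp }
qed

lemma R_zero:
  assumes "h v = sc m v" "(e ^^ n) v = 0"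
  shows "R m n v = 0"
  using assms
proof (induction n arbitrary: m v)
  case (Suc n)
  have hev: "h (e v) = sc (m + 2) (e v)" using Suc.prems(1) by (simp add: he le scale_left_distrib)
  let ?z = "S m n v"
  have "(e ^^ n) (e v) = 0" using Suc.prems(2) by (simp add: funpow_swap1)
  then have "e ?z = 0" using Suc.IH[OF hev] e_S(2)[OF hev] by simp
  then have "T ?z = sc (casimir_value m 0) ?z"
    using S_h[of m n v] Suc.prems(1) by (simp add: T_def ef' lf casimir_value_def S_scale)
  then show ?case unfolding R_eq by simp
qed simp

text \<open>Let \<open>K\<close> be the sum of the eigenspaces of \<open>h\<close>, a subrepresentation. If \<open>K \<noteq> V\<close>, there is a vector outside
  \<open>K\<close> that is a highest weight vector modulo \<open>K\<close>, of weight \<open>m \<ge> 0\<close>. It can be changed so that \<open>e v2\<close> is an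
  eigenvector for \<open>m + 2\<close>. The product \<open>S\<close> then turns \<open>v2\<close> into a true highest weight vector,
  which lies in \<open>K\<close>; but modulo \<open>K\<close> it multiplies \<open>v2\<close> by a nonzero number, because \<open>T v2\<close> is \<open>m v2\<close>
  modulo \<open>K\<close> and \<open>m \<noteq> (i + 1) (m + i)\<close> for \<open>i \<ge> 1\<close>. So \<open>v2\<close> lies in \<open>K\<close>, a contradiction.\<close>

theorem sl2_diagonalizable: "v \<in> diagonal_part h"
proof (rule ccontr)
  let ?K = "diagonal_part h"
  note K = invariant_diagonal_part
  note Ks = invariantD(1)[OF K] and Kh = invariantD(4)[OF K]
  assume v: "v \<notin> ?K"
  obtain n where n: "\<And>v. (e ^^ n) v = 0" by (rule e_nilpotent) blast
  \<comment> \<open>As \<open>e\<close> is nilpotent, some power of \<open>e\<close> applied to \<open>v\<close> is the last one outside \<open>K\<close>.\<close>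
  have "\<exists>k. (e ^^ k) v \<in> ?K" using n[of v] subspace_0[OF Ks] by metis
  define k where "k = (LEAST k. (e ^^ k) v \<in> ?K)"
  have k: "(e ^^ k) v \<in> ?K" unfolding k_def by (rule LeastI_ex) fact
  have "k \<noteq> 0" using k v by (cases k) auto
  then obtain k' where k': "k = Suc k'" by (cases k) auto
  define v1 where "v1 = (e ^^ k') v"
  have v1: "v1 \<notin> ?K" "e v1 \<in> ?K"
    using not_less_Least[of k' "\<lambda>k. (e ^^ k) v \<in> ?K"] k k' by (auto simp: v1_def k_def)
  obtain l where l: "\<And>v. (f ^^ l) v = 0" by (rule f_nilpotent) blast
  have "sc (- 1) ((e ^^ l) ((f ^^ l) v1) - sc (fact l) (papp h (split_poly (of_nat ` {..<l})) v1)) \<in> ?K"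
    by (rule subspace_scale[OF Ks e_power_f_power[OF K v1(2)]])
  then have "sc (fact l) (papp h (split_poly (of_nat ` {..<l})) v1) \<in> ?K"
    by (simp add: l linD[OF lin_funpow[OF lin_e]])
  then have "sc (1 / fact l) (sc (fact l) (papp h (split_poly (of_nat ` {..<l})) v1)) \<in> ?K"
    by (rule subspace_scale[OF Ks])
  then have p: "papp h (split_poly (of_nat ` {..<l})) v1 \<in> ?K" by simp
  have "\<exists>w m. m \<in> B \<and> w \<notin> ?K \<and> e w \<in> ?K \<and> h w - sc m w \<in> ?K"
    if "finite B" "papp h (split_poly B) v1 \<in> ?K" for B
    using that
  proof (induction B rule: finite_induct)
    case empty
    then show ?case using v1 by (simp add: split_poly_def)
  next
    case (insert b B)
    let ?w = "papp h (split_poly B) v1"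
    have hw: "h ?w - sc b ?w \<in> ?K"
      using insert.prems unfolding split_poly_insert[OF insert.hyps] papp_mult[OF lin_h] papp_linear_factor[OF lin_h] .
    have ew: "e ?w \<in> ?K" by (rule e_papp_h[OF K v1(2)])
    show ?case
    proof (cases "?w \<in> ?K")
      case True
      then show ?thesis using insert.IH by blast
    next
      case False
      then show ?thesis using hw ew by blast
    qed
  qed
  from this[OF _ p] obtain w j where w: "w \<notin> ?K" "e w \<in> ?K" "h w - sc (of_nat j) w \<in> ?K" by auto
  define m where "m = (of_nat j :: complex)"
  \<comment> \<open>Modulo \<open>K\<close>, the polynomial \<open>q(h)\<close> multiplies \<open>w\<close> by \<open>q(m) \<noteq> 0\<close>; it removes the components of \<open>h w - m w\<close>
    for eigenvalues other than \<open>m\<close>.\<close>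
  obtain A where A: "finite A" "papp h (split_poly A) (h w - sc m w) = 0"
    using w(3) by (auto simp: diagonal_part_def m_def)
  define q where "q = split_poly (A - {m})"
  define v2 where "v2 = papp h q w"
  have qm: "poly q m \<noteq> 0" using A(1) by (simp add: q_def poly_split_poly)
  have hw: "h w - sc m w \<in> ?K" using w(3) by (simp add: m_def)
  have v2K: "v2 \<notin> ?K"
  proof
    assume "v2 \<in> ?K"
    moreover have "v2 - sc (poly q m) w \<in> ?K"
      unfolding v2_def by (rule papp_mod[OF lin_h Ks Kh hw])
    ultimately have "v2 - (v2 - sc (poly q m) w) \<in> ?K" by (rule subspace_diff[OF Ks])
    then have "sc (1 / poly q m) (sc (poly q m) w) \<in> ?K" by (intro subspace_scale[OF Ks, of "sc (poly q m) w"]) simp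
    then show False using qm w(1) by simp
  qed
  have ev2: "e v2 \<in> ?K" unfolding v2_def by (rule e_papp_h[OF K w(2)])
  have hv2: "h v2 - sc m v2 \<in> ?K"
  proof -
    have "h v2 - sc m v2 = papp h q (h w - sc m w)"
      by (simp add: v2_def papp_apply[OF lin_h] linD[OF papp_linear[OF lin_h]])
    then show ?thesis using papp_in[OF lin_h Ks Kh hw] by simp
  qed
  have sq: "h (h v2 - sc m v2) = sc m (h v2 - sc m v2)"
  proof -
    have "papp h (split_poly (insert m A)) (h w - sc m w) = 0"
      using A split_poly_kernel_mono[OF lin_h, of "insert m A" A] by auto
    also have "split_poly (insert m A) = [:- m, 1:] * q"
      using split_poly_insert[of "A - {m}" m] A(1) by (simp add: q_def)
    also have "papp h \<dots> (h w - sc m w) = papp h [:- m, 1:] (h v2 - sc m v2)"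
      by (simp only: papp_mult[OF lin_h] v2_def papp_apply[OF lin_h] linD[OF papp_linear[OF lin_h]])
    finally show ?thesis by (simp add: papp_linear_factor[OF lin_h])
  qed
  have hev2: "h (e v2) = sc (m + 2) (e v2)"
  proof -
    define x where "x = e v2"
    define y where "y = h x - sc (m + 2) x"
    have yx: "y = e (h v2 - sc m v2)" by (simp add: y_def x_def he le scale_left_distrib)
    have hy: "h y = sc (m + 2) y" unfolding yx by (simp add: he sq) (simp add: le scale_left_distrib)
    obtain B where B: "finite B" "papp h (split_poly B) x = 0" using ev2 by (auto simp: diagonal_part_def x_def)
    have "papp h (split_poly (insert (m + 2) B)) x = 0" using B split_poly_kernel_mono[OF lin_h, of "insert (m + 2) B" B x] by auto
    moreover have "split_poly (insert (m + 2) B) = [:- (m + 2), 1:] * split_poly (B - {m + 2})"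
      using split_poly_insert[of "B - {m + 2}" "m + 2"] B(1) by simp
    ultimately have "papp h ([:- (m + 2), 1:] * split_poly (B - {m + 2})) x = 0" by metis
    then have "papp h (split_poly (B - {m + 2})) y = 0"
      unfolding papp_mult[OF lin_h] by (subst (asm) papp_commute[OF lin_h]) (simp only: papp_linear_factor[OF lin_h] y_def)
    then have "sc (poly (split_poly (B - {m + 2})) (m + 2)) y = 0" using papp_eigen[OF lin_h hy] by simp
    moreover have "poly (split_poly (B - {m + 2})) (m + 2) \<noteq> 0" using B(1) by (simp add: poly_split_poly)
    ultimately show ?thesis by (simp add: y_def x_def)
  qed
  \<comment> \<open>With \<open>e\<^sup>n = 0\<close>, the product of \<open>n\<close> factors turns \<open>v2\<close> into a highest weight vector.\<close>
  have "e (S m n v2) = 0"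
    using e_S(2)[OF hev2, of n] R_zero[OF hev2 n] by simp
  then have SK: "S m n v2 \<in> ?K" by (rule highest_weight_diagonalizable)
  have Tv2: "T v2 - sc m v2 \<in> ?K"
  proof -
    have "T v2 - sc m v2 = f (e v2) + (h v2 - sc m v2)" by (simp add: T_def ef')
    then show ?thesis using subspace_add[OF Ks invariantD(3)[OF K ev2] hv2] by metis
  qed
  have "\<exists>c. c \<noteq> 0 \<and> S m i v2 - sc c v2 \<in> ?K" for i
  proof (induction i)
    case 0
    show ?case by (intro exI[of _ 1]) (simp add: subspace_0[OF Ks])
  next
    case (Suc i)
    then obtain c where c: "c \<noteq> 0" "S m i v2 - sc c v2 \<in> ?K" by blast
    have TK: "T v \<in> ?K" if "v \<in> ?K" for v using that invariantD[OF K] by (simp add: T_def)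
    have "casimir_value m (Suc i) - m = of_nat (Suc i * j + Suc (Suc i) * Suc i)"
      by (simp add: casimir_value_def m_def algebra_simps)
    moreover have "of_nat (Suc i * j + Suc (Suc i) * Suc i) \<noteq> (0 :: complex)"
      by (simp only: of_nat_eq_0_iff) simp
    ultimately have nz: "m - casimir_value m (Suc i) \<noteq> 0" by auto
    have "S m (Suc i) v2 - sc (c * (m - casimir_value m (Suc i))) v2 =
        T (S m i v2 - sc c v2) - sc (casimir_value m (Suc i)) (S m i v2 - sc c v2) + sc c (T v2 - sc m v2)"
      by (simp add: lT scale_right_diff_distrib scale_left_diff_distrib right_diff_distrib mult.commute)
    also have "\<dots> \<in> ?K"
      by (intro subspace_add[OF Ks] subspace_diff[OF Ks] subspace_scale[OF Ks] TK c(2) Tv2)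
    finally show ?case using c(1) nz by (intro exI[of _ "c * (m - casimir_value m (Suc i))"]) simp
  qed
  then obtain c where c: "c \<noteq> 0" "S m n v2 - sc c v2 \<in> ?K" by blast
  have "S m n v2 - (S m n v2 - sc c v2) \<in> ?K" by (rule subspace_diff[OF Ks SK c(2)])
  then have "sc (1 / c) (sc c v2) \<in> ?K" by (intro subspace_scale[OF Ks, of "sc c v2"]) simp
  then show False using c(1) v2K by simp
qed

end

section \<open>Commuting and nilpotent families of operators\<close>

context fd_complex
begin

text \<open>Diagonalizability, including that of the restrictions to invariant subspaces, which is what a
  simultaneous diagonalization needs.\<close>

definition splits :: "('v \<Rightarrow> 'v) \<Rightarrow> bool" where
  "splits h \<longleftrightarrow> (\<forall>W. subspace W \<longrightarrow> (\<forall>w\<in>W. h w \<in> W) \<longrightarrow> W \<subseteq> span {w \<in> W. \<exists>a. h w = sc a w})"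

lemma splitsD: "splits h \<Longrightarrow> subspace W \<Longrightarrow> (\<And>w. w \<in> W \<Longrightarrow> h w \<in> W) \<Longrightarrow> v \<in> W \<Longrightarrow>
    v \<in> span {w \<in> W. \<exists>a. h w = sc a w}"
  unfolding splits_def by blast

text \<open>Rescaling \<open>f\<close> and \<open>h\<close> by \<open>2 / c\<close> normalizes the triple.\<close>

lemma sl2_splits:
  assumes lin: "lin e" "lin f" "lin h" and ef: "\<And>v. e (f v) - f (e v) = h v"
    and he: "\<And>v. h (e v) = e (h v) + sc c (e v)" and hf: "\<And>v. h (f v) = f (h v) + sc (- c) (f v)"
    and c: "c \<noteq> 0"
  shows "splits h"
  unfolding splits_def
proof (intro allI impI subsetI)
  fix W v assume W: "subspace W" "\<forall>w\<in>W. h w \<in> W" and v: "v \<in> W"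
  let ?h = "\<lambda>v. sc (2 / c) (h v)"
  interpret T: sl2_triple sc e "\<lambda>v. sc (2 / c) (f v)" ?h
  proof
    show "lin e" by fact
    show "lin (\<lambda>v. sc (2 / c) (f v))" "lin ?h" using lin by (auto simp: lin_def scale_right_distrib mult.commute)
    show "e (sc (2 / c) (f v)) - sc (2 / c) (f (e v)) = ?h v" for v
      by (simp add: linD[OF lin(1)] scale_right_diff_distrib[symmetric] ef)
    show "?h (e v) = e (?h v) + sc 2 (e v)" for v
      using c by (simp add: linD[OF lin(1)] he scale_right_distrib)
    show "?h (sc (2 / c) (f v)) = sc (2 / c) (f (?h v)) + sc (- 2) (sc (2 / c) (f v))" for v
      using c by (simp add: linD[OF lin(2)] linD[OF lin(3)] hf scale_right_distrib scale_right_diff_distrib)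
  qed
  obtain A where A: "finite A" "papp ?h (split_poly A) v = 0" using T.sl2_diagonalizable[of v] by (auto simp: diagonal_part_def)
  have hW: "?h w \<in> W" if "w \<in> W" for w using W that by (auto intro: subspace_scale)
  have "v \<in> span {w \<in> W. \<exists>a\<in>A. ?h w = sc a w}"
    by (rule split_poly_eigenvectors[OF T.lin_h W(1) hW A(1) v A(2)])
  also have "{w \<in> W. \<exists>a\<in>A. ?h w = sc a w} \<subseteq> {w \<in> W. \<exists>a. h w = sc a w}"
  proof
    fix w assume "w \<in> {w \<in> W. \<exists>a\<in>A. ?h w = sc a w}"
    then obtain a where a: "w \<in> W" "?h w = sc a w" by auto
    from a(2) have "sc (c / 2) (?h w) = sc (c / 2) (sc a w)" by simp
    then have "h w = sc (c / 2 * a) w" using c by simp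
    then show "w \<in> {w \<in> W. \<exists>a. h w = sc a w}" using a by blast
  qed
  then have "span {w \<in> W. \<exists>a\<in>A. ?h w = sc a w} \<subseteq> span {w \<in> W. \<exists>a. h w = sc a w}" by (rule span_mono)
  finally show "v \<in> span {w \<in> W. \<exists>a. h w = sc a w}" .
qed

lemma joint_eigenvectors:
  assumes "finite A" and lin: "\<And>a. a \<in> A \<Longrightarrow> lin (H a)"
    and comm: "\<And>a b v. a \<in> A \<Longrightarrow> b \<in> A \<Longrightarrow> H a (H b v) = H b (H a v)"
    and split: "\<And>a. a \<in> A \<Longrightarrow> splits (H a)"
  shows "span {v. \<forall>a\<in>A. \<exists>c. H a v = sc c v} = UNIV"
  using assms
proof (induction A rule: finite_induct)
  case empty
  then show ?case by (simp add: span_UNIV)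
next
  case (insert a A)
  let ?E = "\<lambda>A. {v. \<forall>a\<in>A. \<exists>c. H a v = sc c v}"
  have "?E A \<subseteq> span (?E (insert a A))"
  proof
    fix v assume "v \<in> ?E A"
    then obtain \<mu> where \<mu>: "\<And>b. b \<in> A \<Longrightarrow> H b v = sc (\<mu> b) v" by simp metis
    define W where "W = {w. \<forall>b\<in>A. H b w = sc (\<mu> b) w}"
    have lin': "lin (H b)" if "b \<in> A" for b using insert.prems(1) that by blast
    have W: "subspace W" unfolding W_def
      by (rule subspaceI) (auto simp: linD[OF lin'] scale_right_distrib mult.commute)
    have la: "lin (H a)" using insert.prems(1) by blast
    have "H a w \<in> W" if "w \<in> W" for w
      using that insert.prems(2)[of _ a] by (auto simp: W_def linD[OF la])
    from splitsD[OF insert.prems(3)[of a] W this, of v]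
    have "v \<in> span {w \<in> W. \<exists>c. H a w = sc c w}" using \<mu> by (auto simp: W_def)
    also have "\<dots> \<subseteq> span (?E (insert a A))" by (rule span_mono) (auto simp: W_def)
    finally show "v \<in> span (?E (insert a A))" .
  qed
  then have "span (?E A) \<subseteq> span (?E (insert a A))" by (rule span_minimal) (rule subspace_span)
  then show ?case using insert by auto
qed

lemma minimal_subspace:
  assumes "P W0" and sub: "\<And>W. P W \<Longrightarrow> subspace W"
  shows "\<exists>W. P W \<and> (\<forall>W'. P W' \<longrightarrow> W' \<subseteq> W \<longrightarrow> W' = W)"
proof -
  obtain G where G: "finite G" "span G = UNIV" using fin_dim by blast
  obtain B where "finite B" "independent B" "span B = UNIV"
    using resolves_basis[OF G subspace_UNIV] by metis
  then interpret finite_dimensional_vector_space sc B by unfold_locales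
  obtain W where W: "P W" "\<And>W'. P W' \<Longrightarrow> dim W \<le> dim W'"
    using ex_has_least_nat[of P W0 dim] assms(1) by blast
  have "W' = W" if "P W'" "W' \<subseteq> W" for W'
    using subspace_dim_equal[OF sub[OF that(1)] sub[OF W(1)] that(2)] W(2)[OF that(1)] by simp
  then show ?thesis using W by blast
qed

text \<open>For a representation of a nilpotent Lie algebra \<open>C 0\<close> with descending series \<open>C k\<close>, an invariant linear
  form \<open>\<phi> \<noteq> 0\<close> forces an invariant vector \<open>\<noteq> 0\<close>. Choose a minimal stable subspace \<open>W\<close> on which
  \<open>\<phi>\<close> does not vanish. For each \<open>H\<close> the generalized null space of \<open>\<rho> H\<close> in \<open>W\<close> is stable, and \<open>\<phi>\<close>, being
  zero on the image of \<open>\<rho> H\<close>, does not vanish on it; so it is all of \<open>W\<close>, and every \<open>\<rho> H\<close> is nilpotent on \<open>W\<close>.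
  A minimal nonzero stable subspace \<open>U\<close> of \<open>W\<close> is then killed by \<open>C k\<close> for all \<open>k\<close>, by descending
  induction on \<open>k\<close>: modulo \<open>C (k + 1)\<close> the elements of \<open>C k\<close> are central, so their kernels in \<open>U\<close>, nonzero by
  nilpotency, are stable.\<close>

lemma nilpotent_common_kernel:
  fixes \<rho> :: "'g \<Rightarrow> 'v \<Rightarrow> 'v" and br :: "'g \<Rightarrow> 'g \<Rightarrow> 'g" and z :: 'g and C :: "nat \<Rightarrow> 'g set" and \<phi> :: "'v \<Rightarrow> complex"
  assumes C: "\<And>k. C k \<subseteq> C 0" "C n = {z}" "\<And>H K k. H \<in> C 0 \<Longrightarrow> K \<in> C k \<Longrightarrow> br H K \<in> C (Suc k)"
    and lin: "\<And>H. H \<in> C 0 \<Longrightarrow> lin (\<rho> H)" and zero: "\<And>v. \<rho> z v = 0"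
    and rep: "\<And>H K v. H \<in> C 0 \<Longrightarrow> K \<in> C 0 \<Longrightarrow> \<rho> (br H K) v = \<rho> H (\<rho> K v) - \<rho> K (\<rho> H v)"
    and \<phi>_add: "\<And>v w. \<phi> (v + w) = \<phi> v + \<phi> w" and \<phi>_sc: "\<And>c v. \<phi> (sc c v) = c * \<phi> v"
    and \<phi>_inv: "\<And>H v. H \<in> C 0 \<Longrightarrow> \<phi> (\<rho> H v) = 0" and \<phi>: "\<phi> v0 \<noteq> 0"
  obtains v where "v \<noteq> 0" "\<And>H. H \<in> C 0 \<Longrightarrow> \<rho> H v = 0"
proof -
  define stable where "stable W \<longleftrightarrow> subspace W \<and> (\<forall>H\<in>C 0. \<forall>w\<in>W. \<rho> H w \<in> W)" for W
  have \<rho>0: "\<rho> H 0 = 0" if "H \<in> C 0" for H using linD(3)[OF lin[OF that]] .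
  define P where "P W \<longleftrightarrow> stable W \<and> (\<exists>w\<in>W. \<phi> w \<noteq> 0)" for W
  have "P UNIV" using \<phi> by (auto simp: P_def stable_def)
  moreover have "subspace W" if "P W" for W using that by (simp add: P_def stable_def)
  ultimately have "\<exists>W. P W \<and> (\<forall>W'. P W' \<longrightarrow> W' \<subseteq> W \<longrightarrow> W' = W)"
    by (rule minimal_subspace)
  then obtain W where PW: "P W" and min: "\<And>W'. P W' \<Longrightarrow> W' \<subseteq> W \<Longrightarrow> W' = W" by auto
  have W: "stable W" "\<exists>w\<in>W. \<phi> w \<noteq> 0" using PW by (auto simp: P_def)
  have nil: "\<exists>N. (\<rho> H ^^ N) w = 0" if H: "H \<in> C 0" and w: "w \<in> W" for H w
  proof -
    let ?A = "\<rho> H"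
    note l = lin[OF H]
    define W0 where "W0 = {w \<in> W. \<exists>N. (?A ^^ N) w = 0}"
    have mono: "(?A ^^ M) w = 0" if "(?A ^^ N) w = 0" "N \<le> M" for N M w
    proof -
      have "(?A ^^ M) w = (?A ^^ (M - N)) ((?A ^^ N) w)"
        using that(2) by (simp add: funpow_add[symmetric, THEN fun_cong, unfolded comp_def])
      then show ?thesis using that(1) by (simp add: linD[OF lin_funpow[OF l]])
    qed
    \<comment> \<open>\<open>?A\<close> acts nilpotently on \<open>C 0\<close> by commutators; each commutator moves \<open>K\<close> one step down the series.\<close>
    have key: "(?A ^^ (M + d)) (\<rho> K w) = 0" if "d \<le> n" "K \<in> C (n - d)" "(?A ^^ M) w = 0" for d M K w
      using that
    proof (induction d arbitrary: M K w)
      case 0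
      then show ?case using C(2) by (simp add: zero linD[OF lin_funpow[OF l]])
    next
      case (Suc d)
      have K0: "K \<in> C 0" using Suc.prems(2) C(1) by blast
      have HK: "br H K \<in> C (n - d)"
        using C(3)[OF H Suc.prems(2)] Suc.prems(1) by (simp add: Suc_diff_Suc)
      note IH = Suc.IH and d = Suc.prems(1)
      from Suc.prems(3) show ?case
      proof (induction M arbitrary: w)
        case 0
        then show ?case by (simp add: \<rho>0[OF K0] \<rho>0[OF H] linD[OF lin_funpow[OF l]])
      next
        case (Suc M)
        have "(?A ^^ (M + Suc d)) (\<rho> K (?A w)) = 0"
          by (rule Suc.IH) (use Suc.prems in \<open>simp add: funpow_swap1\<close>)
        moreover have "(?A ^^ (Suc M + d)) (\<rho> (br H K) w) = 0"
          by (rule IH[OF _ HK Suc.prems]) (use d in simp)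
        moreover have "(?A ^^ (Suc M + Suc d)) (\<rho> K w) = (?A ^^ (Suc M + d)) (\<rho> K (?A w) + \<rho> (br H K) w)"
        proof -
          have "(?A ^^ (Suc M + Suc d)) (\<rho> K w) = (?A ^^ (Suc M + d)) (?A (\<rho> K w))"
            by (simp only: add_Suc_right funpow_Suc_right comp_apply)
          also have "?A (\<rho> K w) = \<rho> K (?A w) + \<rho> (br H K) w" using rep[OF H K0] by simp
          finally show ?thesis .
        qed
        ultimately show ?case by (simp only: linD(1)[OF lin_funpow[OF l]] add_Suc_right add_Suc add_0_right)
      qed
    qed
    have "stable W0"
      unfolding stable_def
    proof (intro conjI ballI)
      show "subspace W0"
      proof (rule subspaceI)
        show "0 \<in> W0" using W(1) by (auto simp: W0_def stable_def subspace_0 intro: exI[of _ 0])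
        show "x + y \<in> W0" if xy: "x \<in> W0" "y \<in> W0" for x y
        proof -
          obtain N M where "(?A ^^ N) x = 0" "(?A ^^ M) y = 0" using xy by (auto simp: W0_def)
          then have "(?A ^^ (max N M)) (x + y) = 0"
            using mono[of N x "max N M"] mono[of M y "max N M"] by (simp add: linD[OF lin_funpow[OF l]])
          moreover have "x + y \<in> W" using xy W(1) by (auto simp: W0_def stable_def intro: subspace_add)
          ultimately show ?thesis by (auto simp: W0_def)
        qed
        show "sc c x \<in> W0" if "x \<in> W0" for c x
          using that W(1) by (auto simp: W0_def stable_def linD[OF lin_funpow[OF l]] intro: subspace_scale)
      qed
      fix K w assume K: "K \<in> C 0" and w: "w \<in> W0"
      then obtain N where "(?A ^^ N) w = 0" by (auto simp: W0_def)
      then have "(?A ^^ (N + n)) (\<rho> K w) = 0" using key[of n K N w] K by simp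
      then show "\<rho> K w \<in> W0" using w K W(1) by (auto simp: W0_def stable_def)
    qed
    moreover have "\<exists>w\<in>W0. \<phi> w \<noteq> 0"
    proof -
      obtain w where w: "w \<in> W" "\<phi> w \<noteq> 0" using W(2) by blast
      \<comment> \<open>Split the power of \<open>x\<close> off a polynomial \<open>p\<close> annihilating \<open>w\<close>; the other factor multiplies \<open>\<phi> w\<close> by its
        constant term.\<close>
      obtain p where p: "p \<noteq> 0" "papp ?A p w = 0" by (rule annihilator_vector[OF l])
      obtain q where q: "p = [:- 0, 1:] ^ order 0 p * q" "\<not> [:- 0, 1:] dvd q"
        using order_decomp[OF p(1)] by blast
      let ?u = "papp ?A q w"
      have "\<phi> 0 = 0" using \<phi>_sc[of 0 0] by simp
      then have "\<phi> (papp ?A r w) = poly r 0 * \<phi> w" for r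
        by (induction r) (simp_all add: papp_pCons[OF l] \<phi>_add \<phi>_sc \<phi>_inv[OF H])
      moreover have "poly q 0 \<noteq> 0" using q(2) by (simp add: poly_eq_0_iff_dvd)
      ultimately have "\<phi> ?u \<noteq> 0" using w by simp
      moreover have "?u \<in> W" using W(1) H w by (intro papp_in[OF l]) (auto simp: stable_def)
      moreover have "papp ?A ([:- 0, 1:] ^ k) v = (?A ^^ k) v" for k v
        by (induction k) (simp_all add: papp_mult[OF l] papp_pCons[OF l] linD[OF l] del: mult_pCons_left)
      then have "(?A ^^ order 0 p) ?u = 0" using p(2) q(1) by (metis papp_mult[OF l])
      ultimately show ?thesis by (auto simp: W0_def)
    qed
    moreover have "W0 \<subseteq> W" by (auto simp: W0_def)
    ultimately have "W0 = W" using min by (simp add: P_def)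
    then show ?thesis using w by (auto simp: W0_def)
  qed
  define Q where "Q W' \<longleftrightarrow> stable W' \<and> W' \<noteq> {0} \<and> W' \<subseteq> W" for W'
  have "Q W" using W \<phi>_sc[of 0 0] by (auto simp: Q_def)
  moreover have "subspace W'" if "Q W'" for W' using that by (simp add: Q_def stable_def)
  ultimately have "\<exists>U. Q U \<and> (\<forall>U'. Q U' \<longrightarrow> U' \<subseteq> U \<longrightarrow> U' = U)"
    by (rule minimal_subspace)
  then obtain U where U: "Q U" and minU: "\<And>U'. Q U' \<Longrightarrow> U' \<subseteq> U \<Longrightarrow> U' = U" by auto
  have Us: "subspace U" and Ust: "\<And>H u. H \<in> C 0 \<Longrightarrow> u \<in> U \<Longrightarrow> \<rho> H u \<in> U" and UW: "U \<subseteq> W" and U0: "U \<noteq> {0}"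
    using U by (auto simp: Q_def stable_def)
  have kill: "\<forall>H\<in>C (n - d). \<forall>u\<in>U. \<rho> H u = 0" if "d \<le> n" for d
    using that
  proof (induction d)
    case 0
    then show ?case using C(2) zero by simp
  next
    case (Suc d)
    show ?case
    proof
      fix H assume H: "H \<in> C (n - Suc d)"
      then have H0: "H \<in> C 0" using C(1) by blast
      note l = lin[OF H0]
      define U' where "U' = {u \<in> U. \<rho> H u = 0}"
      have "stable U'"
        unfolding stable_def
      proof (intro conjI ballI)
        show "subspace U'" unfolding U'_def
          by (rule subspaceI) (auto simp: linD[OF l] intro: subspace_add[OF Us] subspace_scale[OF Us] subspace_0[OF Us])
        fix K u assume K: "K \<in> C 0" and u: "u \<in> U'"
        have "br K H \<in> C (n - d)" using C(3)[OF K H] Suc.prems by (simp add: Suc_diff_Suc)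
        then have "\<rho> (br K H) u = 0" using Suc u by (auto simp: U'_def)
        then have "\<rho> H (\<rho> K u) = 0" using rep[OF K H0, of u] u \<rho>0[OF K] by (simp add: U'_def)
        then show "\<rho> K u \<in> U'" using Ust[OF K] u by (simp add: U'_def)
      qed
      moreover have "U' \<noteq> {0}"
      proof -
        obtain u where u: "u \<in> U" "u \<noteq> 0" using U0 subspace_0[OF Us] by blast
        obtain N where "(\<rho> H ^^ N) u = 0" using nil[OF H0] u UW by blast
        define N where "N = (LEAST N. (\<rho> H ^^ N) u = 0)"
        have N: "(\<rho> H ^^ N) u = 0" unfolding N_def by (rule LeastI) fact
        then obtain N' where N': "N = Suc N'" using u by (cases N) auto
        have "(\<rho> H ^^ N') u \<noteq> 0" using not_less_Least[of N' "\<lambda>N. (\<rho> H ^^ N) u = 0"] N' by (simp add: N_def)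
        moreover have "(\<rho> H ^^ k) u \<in> U" for k by (induction k) (auto simp: u Ust[OF H0])
        moreover have "\<rho> H ((\<rho> H ^^ N') u) = 0" using N N' by simp
        ultimately show ?thesis by (auto simp: U'_def)
      qed
      moreover have "U' \<subseteq> U" by (auto simp: U'_def)
      ultimately have "U' = U" using minU UW unfolding Q_def by blast
      then show "\<forall>u\<in>U. \<rho> H u = 0" by (auto simp: U'_def)
    qed
  qed
  obtain u where u: "u \<in> U" "u \<noteq> 0" using U0 subspace_0[OF Us] by blast
  show ?thesis
  proof (rule that[OF u(2)])
    show "\<rho> H u = 0" if "H \<in> C 0" for H using kill[of n] that u by simp
  qed
qed

end

lemma complex_structure_vector_space: "complex_structure sc \<Longrightarrow> vector_space sc"
  by (simp add: complex_structure_def)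

lemma dual_on_outside: "\<mu> \<in> dual_on \<hh> \<Longrightarrow> H \<notin> \<hh> \<Longrightarrow> \<mu> H = 0"
  unfolding dual_on_def by blast

text \<open>Applying \<open>\<pi> H - \<nu>(H)\<close> removes the summand of weight \<open>\<nu>\<close> and rescales the others. Root spaces are the weight
  spaces of the adjoint representation.\<close>

lemma weight_independent:
  fixes \<pi> :: "'u::real_vector cplx \<Rightarrow> 'v::real_vector \<Rightarrow> 'v"
  assumes vs: "vector_space sc" and lin: "\<And>H. H \<in> \<hh> \<Longrightarrow> Vector_Spaces.linear sc sc (\<pi> H)"
    and "finite A" "A \<subseteq> dual_on \<hh>" "\<And>\<mu>. \<mu> \<in> A \<Longrightarrow> v \<mu> \<in> weight_space sc \<pi> \<hh> \<mu>"
    and "(\<Sum>\<mu>\<in>A. v \<mu>) = 0"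
  shows "\<forall>\<mu>\<in>A. v \<mu> = 0"
proof -
  interpret vector_space sc by fact
  show ?thesis using assms(3-6)
  proof (induction A arbitrary: v rule: finite_induct)
    case (insert \<nu> A)
    have "\<forall>\<mu>\<in>A. v \<mu> = 0"
    proof
      fix \<mu> assume \<mu>: "\<mu> \<in> A"
      then have "\<mu> \<noteq> \<nu>" using insert.hyps by auto
      moreover have "\<mu> H = \<nu> H" if "H \<notin> \<hh>" for H
        using dual_on_outside[OF _ that] insert.prems(1) \<mu> by (metis insert_subset subsetD)
      ultimately obtain H where H: "H \<in> \<hh>" "\<mu> H \<noteq> \<nu> H" by blast
      interpret L: Vector_Spaces.linear sc sc "\<pi> H" by (rule lin[OF H(1)])
      define w where "w \<kappa> = sc (\<kappa> H - \<nu> H) (v \<kappa>)" for \<kappa>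
      have ev: "\<pi> H (v \<kappa>) = sc (\<kappa> H) (v \<kappa>)" if "\<kappa> \<in> insert \<nu> A" for \<kappa>
        using insert.prems(2)[OF that] H by (simp add: weight_space_def)
      have sub: "w \<kappa> \<in> weight_space sc \<pi> \<hh> \<kappa>" if "\<kappa> \<in> A" for \<kappa>
      proof -
        have "\<pi> K (w \<kappa>) = sc (\<kappa> K) (w \<kappa>)" if K: "K \<in> \<hh>" for K
        proof -
          interpret K: Vector_Spaces.linear sc sc "\<pi> K" by (rule lin[OF K])
          have "\<pi> K (v \<kappa>) = sc (\<kappa> K) (v \<kappa>)"
            using insert.prems(2)[of \<kappa>] \<open>\<kappa> \<in> A\<close> K by (simp add: weight_space_def)
          then show ?thesis by (simp add: w_def K.scale mult.commute)
        qed
        then show ?thesis by (simp add: weight_space_def)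
      qed
      have "0 = \<pi> H (\<Sum>\<kappa>\<in>insert \<nu> A. v \<kappa>) - sc (\<nu> H) (\<Sum>\<kappa>\<in>insert \<nu> A. v \<kappa>)"
        using insert.prems(3) by (simp add: L.zero)
      also have "\<dots> = (\<Sum>\<kappa>\<in>insert \<nu> A. w \<kappa>)"
        unfolding L.sum scale_sum_right sum_subtractf[symmetric]
        by (intro sum.cong refl) (simp add: ev w_def scale_left_diff_distrib)
      also have "\<dots> = (\<Sum>\<kappa>\<in>A. w \<kappa>)" using insert.hyps by (simp add: w_def)
      finally have "w \<mu> = 0" using insert.IH[of w] insert.prems(1) sub \<mu> by simp
      then show "v \<mu> = 0" using H(2) by (simp add: w_def)
    qed
    then show ?case using insert by simp
  qed simp
qed

section \<open>The complexification of a compact Lie algebra\<close>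

definition conj_pair :: "'u::real_vector cplx \<Rightarrow> 'u cplx" where
  "conj_pair Z = (fst Z, - snd Z)"

locale compact_algebra =
  fixes br :: "'u::real_vector \<Rightarrow> 'u \<Rightarrow> 'u"
  assumes compact: "compact_semisimple br"
begin

abbreviation "cb \<equiv> cbracket br"
abbreviation "B \<equiv> ckilling br"
abbreviation "K \<equiv> killing_form scaleR br"

lemma lie: "lie_algebra scaleR br" and K_neg: "x \<noteq> 0 \<Longrightarrow> K x x < 0"
  using compact by (auto simp: compact_semisimple_def)

lemma finite_span: "\<exists>G. finite G \<and> span G = (UNIV :: 'u set)"
  using compact by (auto simp: compact_semisimple_def)

lemmas real_lie = real_vector.lie_algebraD[OF lie]

lemma cscale_simps: "fst (cscale c Z) = Re c *\<^sub>R fst Z - Im c *\<^sub>R snd Z"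
  "snd (cscale c Z) = Re c *\<^sub>R snd Z + Im c *\<^sub>R fst Z"
  by (simp_all add: cscale_def)

lemma cscale_real: "cscale (complex_of_real r) Z = r *\<^sub>R Z"
  using complex_structure_cscale unfolding complex_structure_def by blast

lemma cembed_split: "Z = cembed (fst Z) + cscale \<i> (cembed (snd Z))"
  by (simp add: prod_eq_iff cscale_simps cembed_def)

lemma vs: "vector_space (cscale :: complex \<Rightarrow> 'u cplx \<Rightarrow> 'u cplx)"
  by (rule complex_structure_vector_space[OF complex_structure_cscale])

sublocale C: fd_complex "cscale :: complex \<Rightarrow> 'u cplx \<Rightarrow> 'u cplx"
proof -
  interpret C: vector_space "cscale :: complex \<Rightarrow> 'u cplx \<Rightarrow> 'u cplx" by (rule vs)
  show "fd_complex (cscale :: complex \<Rightarrow> 'u cplx \<Rightarrow> 'u cplx)"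
  proof
    obtain G where G: "finite G" "span G = (UNIV :: 'u set)" using finite_span by blast
    have "cembed x \<in> C.span (cembed ` G)" for x
    proof -
      have "x \<in> span G" using G by simp
      then show ?thesis
      proof (induction rule: real_vector.span_induct_alt)
        case base
        then show ?case using C.span_zero by (simp add: cembed_def zero_prod_def)
      next
        case (step c x y)
        have "cembed (c *\<^sub>R x + y) = cscale (complex_of_real c) (cembed x) + cembed y"
          by (simp add: cscale_real cembed_def)
        then show ?case using step by (simp add: C.span_add C.span_scale C.span_base)
      qed
    qed
    then have "Z \<in> C.span (cembed ` G)" for Z
      by (subst cembed_split) (intro C.span_add C.span_scale)
    then show "\<exists>G. finite G \<and> C.span G = (UNIV :: 'u cplx set)" using G by blast
  qed
qed

lemma clie: "lie_algebra cscale cb"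
  unfolding lie_algebra_def
proof (intro conjI allI)
  show "Vector_Spaces.linear cscale cscale (cb x)" for x
    by (intro Vector_Spaces.linear_iff[THEN iffD2] conjI vs allI)
       (simp_all add: cbracket_def prod_eq_iff cscale_simps real_lie(1-4,10-13) algebra_simps)
  show "Vector_Spaces.linear cscale cscale (\<lambda>x. cb x y)" for y
    by (intro Vector_Spaces.linear_iff[THEN iffD2] conjI vs allI)
       (simp_all add: cbracket_def prod_eq_iff cscale_simps real_lie(1-4,10-13) algebra_simps)
  show "cb x x = 0" for x
    using real_lie(6)[of "snd x" "fst x"] by (simp add: cbracket_def prod_eq_iff real_lie(5))
  show "cb x (cb y z) + cb y (cb z x) + cb z (cb x y) = 0" for x y z
  proof -
    have J: "br c (br a b) = - br a (br b c) - br b (br c a)" for a b c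
    proof -
      have "br a (br b c) + br b (br c a) + br c (br a b) = 0" using lie by (simp add: lie_algebra_def)
      then show ?thesis by (simp add: eq_neg_iff_add_eq_0 algebra_simps)
    qed
    obtain x1 x2 y1 y2 z1 z2 where "x = (x1, x2)" "y = (y1, y2)" "z = (z1, z2)" by (metis prod.exhaust)
    then show ?thesis
      by (simp add: cbracket_def prod_eq_iff real_lie(1,3,12,13) J[of z1 x1 y1] J[of z1 x2 y2] J[of z2 x1 y2]
          J[of z2 x2 y1] J[of z1 x1 y2] J[of z1 x2 y1] J[of z2 x1 y1] J[of z2 x2 y2])
  qed
qed

lemmas cl = C.lie_algebraD[OF clie]

text \<open>A real basis of \<open>\<uu>\<close> resolves the identity of the complexification over \<open>\<complex>\<close>, with complexified coordinates.\<close>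

lemma ckilling_eq:
  "B Z W = Complex (K (fst Z) (fst W) - K (snd Z) (snd W)) (K (fst Z) (snd W) + K (snd Z) (fst W))"
proof -
  obtain G where G: "finite G" "span G = (UNIV :: 'u set)" using finite_span by blast
  obtain E where E: "independent E" "span E = (UNIV :: 'u set)"
    and r: "resolves scaleR UNIV E (\<lambda>b x. representation E x b) (\<lambda>b. b)"
    by (rule real_vector.resolves_basis[OF G subspace_UNIV])
  define \<phi> where "\<phi> b x = representation E x b" for b x
  have \<phi>: "\<phi> b (x + y) = \<phi> b x + \<phi> b y" "\<phi> b (x - y) = \<phi> b x - \<phi> b y" "\<phi> b (c *\<^sub>R x) = c * \<phi> b x" for b x y c
    using E by (simp_all add: \<phi>_def representation_add representation_diff representation_scale)
  have r: "resolves scaleR UNIV E \<phi> (\<lambda>b. b)" using r by (simp add: \<phi>_def[abs_def])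
  have rC: "resolves cscale UNIV E (\<lambda>b X. Complex (\<phi> b (fst X)) (\<phi> b (snd X))) cembed"
    unfolding resolves_def
  proof (intro conjI ballI allI)
    show "finite E" using r by (simp add: resolves_def)
    show "(\<Sum>b\<in>E. cscale (Complex (\<phi> b (fst x)) (\<phi> b (snd x))) (cembed b)) = x" for x
      using r unfolding resolves_def
      by (simp add: prod_eq_iff fst_sum snd_sum cscale_simps cembed_def)
  qed (auto simp: \<phi> cscale_simps complex_eq_iff C.subspace_UNIV)
  have "B Z W = (\<Sum>b\<in>E. Complex (\<phi> b (fst (cb Z (cb W (cembed b))))) (\<phi> b (snd (cb Z (cb W (cembed b))))))"
    unfolding killing_form_def
    by (rule C.trace_on_resolves[OF rC endo_on_comp[OF C.lie_endo_on[OF clie, of Z] C.lie_endo_on[OF clie, of W]]])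
  moreover have "K x y = (\<Sum>b\<in>E. \<phi> b (br x (br y b)))" for x y
    unfolding killing_form_def
    by (rule real_vector.trace_on_resolves[OF r endo_on_comp[OF real_vector.lie_endo_on[OF lie, of x] real_vector.lie_endo_on[OF lie, of y]]])
  ultimately show ?thesis
    by (simp add: complex_eq_iff cbracket_def cembed_def real_lie(8,9) \<phi> sum.distrib sum_subtractf real_lie(1))
qed

lemma K_sym: "K x y = K y x"
  using finite_span real_vector.killing_form_sym[OF lie] by (metis span_raw_def)

lemma K_inv: "K (br x y) z = K x (br y z)"
  using finite_span real_vector.killing_form_invariant[OF lie] by (metis span_raw_def)

lemma K_bilinear: "bilinear K"
proof -
  have r: "K x (y + z) = K x y + K x z" "K x (c *\<^sub>R y) = c *\<^sub>R K x y" for x y z c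
    using finite_span real_vector.killing_form_linear[OF lie] by (metis span_raw_def real_scaleR_def)+
  have l: "K (x + y) z = K x z + K y z" "K (c *\<^sub>R x) z = c *\<^sub>R K x z" for x y z c
    using r K_sym by metis+
  show ?thesis by (rule bilinearI) (rule l r)+
qed

lemmas Ks = bilinearD[OF K_bilinear]

lemma B_sym: "B Z W = B W Z"
  by (simp add: ckilling_eq complex_eq_iff K_sym[of "fst W"] K_sym[of "snd W"])

lemma B_inv: "B (cb x y) z = B x (cb y z)"
  using C.fin_dim C.killing_form_invariant[OF clie] by metis

lemma B_add: "B x (y + z) = B x y + B x z" "B (x + y) z = B x z + B y z"
    and B_scale: "B x (cscale c y) = c * B x y" "B (cscale c x) y = c * B x y"
proof -
  obtain G where G: "finite G" "C.span G = (UNIV :: 'u cplx set)" using C.fin_dim by blast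
  show add: "B x (y + z) = B x y + B x z" and scale: "B x (cscale c y) = c * B x y" for x y z
    by (rule C.killing_form_linear[OF clie G])+
  show "B (x + y) z = B x z + B y z"
    using add[of z x y] B_sym[of z "x + y"] B_sym[of z x] B_sym[of z y] by simp
  show "B (cscale c x) y = c * B x y"
    using scale[of y x] B_sym[of y "cscale c x"] B_sym[of y x] by simp
qed

lemma B_zero: "B 0 x = 0" "B x 0 = 0"
  using B_scale(1)[of x 0 0] B_scale(2)[of 0 0 x] by simp_all

lemma B_diff: "B x (y - z) = B x y - B x z" "B (x - y) z = B x z - B y z"
  using B_add(1)[of x "y - z" z] B_add(2)[of "x - y" y z] by simp_all

lemma B_sum: "B x (sum g A) = (\<Sum>a\<in>A. B x (g a))" "B (sum g A) x = (\<Sum>a\<in>A. B (g a) x)"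
  by (induction A rule: infinite_finite_induct) (auto simp: B_add B_zero)

text \<open>Pairing \<open>Z\<close> with its conjugate gives the sum of two values of the negative definite real form.\<close>

lemma B_nondegenerate:
  assumes "\<And>W. B Z W = 0"
  shows "Z = 0"
proof -
  have "K (fst Z) (fst Z) + K (snd Z) (snd Z) = 0"
    using assms[of "conj_pair Z"] by (simp add: ckilling_eq conj_pair_def complex_eq_iff Ks)
  moreover have le: "K x x \<le> 0" for x using K_neg[of x] by (cases "x = 0") (auto simp: Ks)
  moreover note le[of "fst Z"] le[of "snd Z"]
  ultimately have "K (fst Z) (fst Z) = 0" "K (snd Z) (snd Z) = 0"
    by linarith+
  moreover have zero: "x = 0" if "K x x = 0" for x
  proof (rule ccontr)
    assume "x \<noteq> 0"
    from K_neg[OF this] show False using that by simp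
  qed
  ultimately have "fst Z = 0" "snd Z = 0" by blast+
  then show ?thesis by (simp add: prod_eq_iff)
qed

lemma B_conj: "B (conj_pair Z) (conj_pair W) = cnj (B Z W)"
  by (simp add: ckilling_eq conj_pair_def complex_eq_iff Ks)

text \<open>\<open>ad x\<close> is skew for the inner product \<open>- K\<close>.\<close>

lemma trace_ad: "trace_on scaleR UNIV (br x) = 0"
proof -
  obtain G where G: "finite G" "span G = (UNIV :: 'u set)" using finite_span by blast
  have p: "pos_on (\<lambda>x y. - K x y) UNIV"
    unfolding pos_on_def
  proof (intro conjI ballI allI impI)
    show "bilinear (\<lambda>x y. - K x y)" using bilinear_cmul[OF K_bilinear, of "-1"] by simp
    show "- K x y = - K y x" for x y by (simp add: K_sym)
    show "- K x x > 0" if "x \<noteq> 0" for x using K_neg[OF that] by simp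
  qed
  obtain E where E: "frame (\<lambda>x y. - K x y) UNIV E (\<lambda>e. e)"
    by (rule pos_on_frame[OF p G subspace_UNIV])
  have "linear (br x)" by (simp add: linear_iff real_lie(1,2))
  from frame_trace[OF pos_onD(1)[OF p] E this]
  have "trace_on scaleR UNIV (br x) = (\<Sum>e\<in>E. - K (br x e) e)" by simp
  also have "\<dots> = 0" by (simp add: K_inv real_lie(5) Ks)
  finally show ?thesis .
qed

end

section \<open>Roots\<close>

locale root_data = compact_algebra br for br :: "'u::real_vector \<Rightarrow> 'u \<Rightarrow> 'u" +
  fixes \<hh> :: "'u cplx set" and X :: "('u cplx \<Rightarrow> complex) \<Rightarrow> 'u cplx"
  assumes cartan: "cartan_subalgebra cscale (cbracket br) \<hh>"
    and adapted: "adapted_root_vectors br \<hh> X"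
begin

abbreviation "\<Delta> \<equiv> roots br \<hh>"
abbreviation "D \<equiv> dual_vector br \<hh>"

lemma h_sub: "C.subspace \<hh>" and h_nil: "\<exists>n. lower_central cscale cb \<hh> n = {0}"
  and h_br: "x \<in> \<hh> \<Longrightarrow> y \<in> \<hh> \<Longrightarrow> cb x y \<in> \<hh>"
  and h_norm: "(\<And>y. y \<in> \<hh> \<Longrightarrow> cb x y \<in> \<hh>) \<Longrightarrow> x \<in> \<hh>"
  using cartan unfolding cartan_subalgebra_def by (blast | auto)+

lemma dual_onD:
  assumes "\<mu> \<in> dual_on \<hh>"
  shows "x \<in> \<hh> \<Longrightarrow> y \<in> \<hh> \<Longrightarrow> \<mu> (x + y) = \<mu> x + \<mu> y" "x \<in> \<hh> \<Longrightarrow> \<mu> (cscale c x) = c * \<mu> x"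
  using assms unfolding dual_on_def by blast+

lemma root_dual: "\<alpha> \<in> \<Delta> \<Longrightarrow> \<alpha> \<in> dual_on \<hh>" by (simp add: roots_def)

lemma functional_nonzero:
  assumes "\<mu> \<in> dual_on \<hh>" "\<mu> \<noteq> (\<lambda>_. 0)"
  obtains H where "H \<in> \<hh>" "\<mu> H \<noteq> 0"
  using assms dual_on_outside by (metis ext)

lemma root_nonzero:
  assumes "\<alpha> \<in> \<Delta>"
  obtains H where "H \<in> \<hh>" "\<alpha> H \<noteq> 0"
  using functional_nonzero[OF root_dual[OF assms]] assms unfolding roots_def by blast

lemma X_root: "\<alpha> \<in> \<Delta> \<Longrightarrow> H \<in> \<hh> \<Longrightarrow> cb H (X \<alpha>) = cscale (\<alpha> H) (X \<alpha>)"
  and X_nonzero: "\<alpha> \<in> \<Delta> \<Longrightarrow> X \<alpha> \<noteq> 0"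
  and X_bracket: "\<alpha> \<in> \<Delta> \<Longrightarrow> cb (X \<alpha>) (X (fneg \<alpha>)) = D \<alpha>"
  using adapted unfolding adapted_root_vectors_def root_space_def by blast+

lemma u_span: "range cembed = span (\<Union>\<alpha>\<in>\<Delta>.
      {cscale \<i> (D \<alpha>), X \<alpha> - X (fneg \<alpha>), cscale \<i> (X \<alpha> + X (fneg \<alpha>))})"
  using adapted unfolding adapted_root_vectors_def by blast

lemma fneg_dual: "\<mu> \<in> dual_on \<hh> \<Longrightarrow> fneg \<mu> \<in> dual_on \<hh>"
  unfolding dual_on_def by auto

lemma lower_in_h: "lower_central cscale cb \<hh> k \<subseteq> \<hh>"
proof (induction k)
  case (Suc k)
  show ?case unfolding lower_central.simps
    by (rule C.span_minimal[OF _ h_sub]) (use Suc h_br in blast)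
qed simp

text \<open>Invariance of \<open>B\<close> makes \<open>B(\<cdot>, X\<^sub>\<alpha>)\<close> an eigenfunctional of \<open>\<hh>\<close> of weight \<open>- \<alpha>\<close>. After a twist by \<open>\<alpha>\<close> it is an
  invariant form for the nilpotent algebra \<open>\<hh>\<close>, and \<open>nilpotent_common_kernel\<close> turns it into a root vector.\<close>

lemma neg_root:
  assumes \<alpha>: "\<alpha> \<in> \<Delta>"
  shows "fneg \<alpha> \<in> \<Delta>"
proof -
  note \<alpha>d = dual_onD[OF root_dual[OF \<alpha>]]
  obtain n where n: "lower_central cscale cb \<hh> n = {0}" using h_nil by blast
  have br0: "\<alpha> (cb H J) = 0" if "H \<in> \<hh>" "J \<in> \<hh>" for H J
  proof -
    have "cscale (\<alpha> (cb H J)) (X \<alpha>) = cb (cb H J) (X \<alpha>)" using X_root[OF \<alpha> h_br] that by simp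
    also have "\<dots> = cb H (cb J (X \<alpha>)) - cb J (cb H (X \<alpha>))" by (rule cl(7))
    also have "\<dots> = 0" using that by (simp add: X_root[OF \<alpha>] cl(2) mult.commute)
    finally show ?thesis using X_nonzero[OF \<alpha>] by simp
  qed
  define \<rho> where "\<rho> H v = cb H v + cscale (\<alpha> H) v" for H v
  have "\<exists>v0. B (X \<alpha>) v0 \<noteq> 0" using B_nondegenerate X_nonzero[OF \<alpha>] by blast
  then obtain v0 where v0: "B v0 (X \<alpha>) \<noteq> 0" using B_sym by metis
  have a0: "\<alpha> 0 = 0" using \<alpha>d(2)[of 0 0] C.subspace_0[OF h_sub] by simp
  obtain v where v: "v \<noteq> 0" "\<And>H. H \<in> \<hh> \<Longrightarrow> \<rho> H v = 0"
  proof (rule C.nilpotent_common_kernel[of "lower_central cscale cb \<hh>" n 0 cb \<rho> "\<lambda>v. B v (X \<alpha>)" v0])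
    show "lower_central cscale cb \<hh> k \<subseteq> lower_central cscale cb \<hh> 0" for k using lower_in_h by simp
    show "lower_central cscale cb \<hh> n = {0}" by (rule n)
    show "cb H J \<in> lower_central cscale cb \<hh> (Suc k)"
      if "H \<in> lower_central cscale cb \<hh> 0" "J \<in> lower_central cscale cb \<hh> k" for H J k
      using that unfolding lower_central.simps by (intro C.span_base) blast
    show "C.lin (\<rho> H)" for H
      by (simp add: C.lin_def \<rho>_def cl(1,2) C.scale_right_distrib mult.commute)
    show "\<rho> 0 v = 0" for v by (simp add: \<rho>_def cl(8) a0)
    show "\<rho> (cb H J) v = \<rho> H (\<rho> J v) - \<rho> J (\<rho> H v)"
      if "H \<in> lower_central cscale cb \<hh> 0" "J \<in> lower_central cscale cb \<hh> 0" for H J v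
      using that br0[of H J] by (simp add: \<rho>_def cl(1,2,7) C.scale_right_distrib mult.commute)
    show "B (\<rho> H v) (X \<alpha>) = 0" if "H \<in> lower_central cscale cb \<hh> 0" for H v
    proof -
      have "B (cb H v) (X \<alpha>) = - B v (cb H (X \<alpha>))"
        using B_inv[of v H "X \<alpha>"] cl(6)[of H v] B_scale(2)[of "-1" "cb v H" "X \<alpha>"] by simp
      then show ?thesis using that by (simp add: \<rho>_def B_add B_scale X_root[OF \<alpha>])
    qed
  qed (auto simp: B_add B_scale v0)
  have "v \<in> root_space br \<hh> (fneg \<alpha>)"
    using v(2) by (auto simp: root_space_def \<rho>_def eq_neg_iff_add_eq_0)
  moreover have "fneg \<alpha> \<noteq> (\<lambda>_. 0)" using \<alpha> by (auto simp: roots_def fun_eq_iff)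
  ultimately show ?thesis using v(1) fneg_dual[OF root_dual[OF \<alpha>]] by (auto simp: roots_def)
qed

text \<open>By the Jacobi identity \<open>H\<^sub>\<alpha> = [X\<^sub>\<alpha>, X\<^sub>-\<^sub>\<alpha>]\<close> commutes with \<open>\<hh>\<close>, and \<open>\<hh>\<close> is its own normalizer. The
  equation that defines \<open>H\<^sub>\<alpha>\<close> is established in \<open>B_D\<close> below.\<close>

lemma D_in: "\<alpha> \<in> \<Delta> \<Longrightarrow> D \<alpha> \<in> \<hh>" and D_central: "\<alpha> \<in> \<Delta> \<Longrightarrow> H \<in> \<hh> \<Longrightarrow> cb H (D \<alpha>) = 0"
proof -
  assume \<alpha>: "\<alpha> \<in> \<Delta>"
  show c: "cb H (D \<alpha>) = 0" if "H \<in> \<hh>" for H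
    using that cl(14)[of H "X \<alpha>" "X (fneg \<alpha>)"]
    by (simp add: X_bracket[OF \<alpha>] X_root[OF \<alpha>] X_root[OF neg_root[OF \<alpha>]] cl(2,4,11))
  show "D \<alpha> \<in> \<hh>"
  proof (rule h_norm)
    fix y assume "y \<in> \<hh>"
    then show "cb (D \<alpha>) y \<in> \<hh>" using c[of y] cl(6)[of "D \<alpha>" y] C.subspace_0[OF h_sub] by simp
  qed
qed

lemma root_vectors_independent:
  assumes "finite A" "A \<subseteq> \<Delta>" "(\<Sum>\<alpha>\<in>A. cscale (c \<alpha>) (X \<alpha>)) = 0"
  shows "\<forall>\<alpha>\<in>A. c \<alpha> = 0"
proof -
  have "\<forall>\<alpha>\<in>A. cscale (c \<alpha>) (X \<alpha>) = 0"
  proof (rule weight_independent[OF vs _ assms(1) _ _ assms(3)])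
    show "Vector_Spaces.linear cscale cscale (cb H)" for H using clie unfolding lie_algebra_def by blast
    show "A \<subseteq> dual_on \<hh>" using assms(2) root_dual by blast
    show "cscale (c \<alpha>) (X \<alpha>) \<in> weight_space cscale cb \<hh> \<alpha>" if "\<alpha> \<in> A" for \<alpha>
      using that assms(2) by (auto simp: weight_space_def cl(2) X_root mult.commute subsetD)
  qed
  then show ?thesis using X_nonzero assms(2) by auto
qed

lemma finite_roots: "finite \<Delta>"
proof (rule ccontr)
  assume inf: "infinite \<Delta>"
  obtain G where G: "finite G" "C.span G = (UNIV :: 'u cplx set)" using C.fin_dim by blast
  obtain A where A: "A \<subseteq> \<Delta>" "finite A" "card A = Suc (card G)"
    using infinite_arbitrarily_large[OF inf] by blast
  have inj: "inj_on X A"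
  proof (rule inj_onI)
    fix \<alpha> \<beta> assume ab: "\<alpha> \<in> A" "\<beta> \<in> A" "X \<alpha> = X \<beta>"
    have "\<alpha> H = \<beta> H" for H
    proof (cases "H \<in> \<hh>")
      case True
      then have "cscale (\<alpha> H) (X \<alpha>) = cscale (\<beta> H) (X \<alpha>)"
        using X_root[of \<alpha> H] X_root[of \<beta> H] ab A(1) by (metis subsetD)
      then show ?thesis using X_nonzero[of \<alpha>] ab A(1) by auto
    next
      case False
      then show ?thesis using dual_on_outside root_dual ab A(1) by (metis subsetD)
    qed
    then show "\<alpha> = \<beta>" by blast
  qed
  have "C.independent (X ` A)"
  proof (rule ccontr)
    assume "\<not> C.independent (X ` A)"
    then obtain u where u: "\<exists>v\<in>X ` A. u v \<noteq> 0" "(\<Sum>v\<in>X ` A. cscale (u v) v) = 0"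
      using C.dependent_finite[of "X ` A"] A(2) by auto
    then have "(\<Sum>\<alpha>\<in>A. cscale (u (X \<alpha>)) (X \<alpha>)) = 0" by (simp add: sum.reindex[OF inj])
    from root_vectors_independent[OF A(2,1) this] show False using u(1) by auto
  qed
  then have "card (X ` A) \<le> card G" using C.independent_span_bound[OF G(1)] G(2) by simp
  then show False using A(3) by (simp add: card_image[OF inj])
qed

lemma decomposition:
  obtains k c where "k \<in> C.span (D ` \<Delta>)" "Z = k + (\<Sum>\<alpha>\<in>\<Delta>. cscale (c \<alpha>) (X \<alpha>))"
proof -
  define S where "S = {k + (\<Sum>\<alpha>\<in>\<Delta>. cscale (c \<alpha>) (X \<alpha>)) | k c. k \<in> C.span (D ` \<Delta>)}"
  have SI: "k + (\<Sum>\<alpha>\<in>\<Delta>. cscale (c \<alpha>) (X \<alpha>)) \<in> S" if "k \<in> C.span (D ` \<Delta>)" for k c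
    using that unfolding S_def by blast
  have sub: "C.subspace S"
  proof (rule C.subspaceI)
    have "0 + (\<Sum>\<alpha>\<in>\<Delta>. cscale 0 (X \<alpha>)) \<in> S" by (rule SI[OF C.span_zero])
    then show "0 \<in> S" by simp
    show "x + y \<in> S" if xy: "x \<in> S" "y \<in> S" for x y
    proof -
      obtain k c l d where "x = k + (\<Sum>\<alpha>\<in>\<Delta>. cscale (c \<alpha>) (X \<alpha>))" "k \<in> C.span (D ` \<Delta>)"
        "y = l + (\<Sum>\<alpha>\<in>\<Delta>. cscale (d \<alpha>) (X \<alpha>))" "l \<in> C.span (D ` \<Delta>)" using xy unfolding S_def by blast
      then have "x + y = (k + l) + (\<Sum>\<alpha>\<in>\<Delta>. cscale (c \<alpha> + d \<alpha>) (X \<alpha>))" "k + l \<in> C.span (D ` \<Delta>)"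
        by (auto simp: C.scale_left_distrib sum.distrib C.span_add)
      then show ?thesis using SI by metis
    qed
    show "cscale a x \<in> S" if xS: "x \<in> S" for a x
    proof -
      obtain k c where "x = k + (\<Sum>\<alpha>\<in>\<Delta>. cscale (c \<alpha>) (X \<alpha>))" "k \<in> C.span (D ` \<Delta>)"
        using xS unfolding S_def by blast
      then have "cscale a x = cscale a k + (\<Sum>\<alpha>\<in>\<Delta>. cscale (a * c \<alpha>) (X \<alpha>))" "cscale a k \<in> C.span (D ` \<Delta>)"
        by (auto simp: C.scale_right_distrib C.scale_sum_right C.span_scale)
      then show ?thesis using SI by metis
    qed
  qed
  have D: "D \<alpha> \<in> S" if "\<alpha> \<in> \<Delta>" for \<alpha>
  proof -
    have "D \<alpha> + (\<Sum>\<alpha>\<in>\<Delta>. cscale 0 (X \<alpha>)) \<in> S" by (rule SI) (intro C.span_base imageI that)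
    then show ?thesis by simp
  qed
  have X: "X \<alpha> \<in> S" if "\<alpha> \<in> \<Delta>" for \<alpha>
  proof -
    have "0 + (\<Sum>\<beta>\<in>\<Delta>. cscale (if \<beta> = \<alpha> then 1 else 0) (X \<beta>)) \<in> S" by (rule SI[OF C.span_zero])
    also have "(\<Sum>\<beta>\<in>\<Delta>. cscale (if \<beta> = \<alpha> then 1 else 0) (X \<beta>)) = X \<alpha>"
      using that finite_roots by (simp add: if_distrib[of "\<lambda>c. cscale c _"] sum.delta cong: if_cong)
    finally show ?thesis by simp
  qed
  have rsub: "subspace S"
    using sub by (auto simp: subspace_def C.subspace_def cscale_real[symmetric])
  have "range cembed \<subseteq> S"
    unfolding u_span using D X neg_root sub
    by (intro span_minimal rsub) (auto intro!: C.subspace_scale C.subspace_diff C.subspace_add)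
  then have "Z \<in> S"
    by (subst cembed_split) (intro C.subspace_add[OF sub] C.subspace_scale[OF sub], auto)
  then show ?thesis using that unfolding S_def by blast
qed

text \<open>Modulo the span of the \<open>H\<^sub>\<alpha>\<close>, an element of \<open>\<hh>\<close> is a combination \<open>y\<close> of root vectors that again lies in \<open>\<hh>\<close>. As \<open>\<hh>\<close>
  is nilpotent, \<open>(ad H)\<^sup>n y = 0\<close>, while \<open>ad H\<close> multiplies the component along \<open>X\<^sub>\<alpha>\<close> by \<open>\<alpha>(H)\<close>. So \<open>y = 0\<close>.\<close>

lemma h_span: "\<hh> = C.span (D ` \<Delta>)"
proof
  show "C.span (D ` \<Delta>) \<subseteq> \<hh>" using D_in h_sub by (intro C.span_minimal) auto
  show "\<hh> \<subseteq> C.span (D ` \<Delta>)"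
  proof
    fix x assume x: "x \<in> \<hh>"
    obtain k c where k: "k \<in> C.span (D ` \<Delta>)" "x = k + (\<Sum>\<alpha>\<in>\<Delta>. cscale (c \<alpha>) (X \<alpha>))" by (rule decomposition)
    define y where "y = (\<Sum>\<alpha>\<in>\<Delta>. cscale (c \<alpha>) (X \<alpha>))"
    have "k \<in> \<hh>" using k(1) \<open>C.span (D ` \<Delta>) \<subseteq> \<hh>\<close> by blast
    then have y: "y \<in> \<hh>" using k(2) C.subspace_diff[OF h_sub x, of k] by (simp add: y_def)
    obtain n where n: "lower_central cscale cb \<hh> n = {0}" using h_nil by blast
    have "c \<alpha> = 0" if \<alpha>: "\<alpha> \<in> \<Delta>" for \<alpha>
    proof -
      obtain H where H: "H \<in> \<hh>" "\<alpha> H \<noteq> 0" by (rule root_nonzero[OF \<alpha>])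
      have "(cb H ^^ j) y \<in> lower_central cscale cb \<hh> j" for j
      proof (induction j)
        case (Suc j)
        have "(cb H ^^ Suc j) y = cb H ((cb H ^^ j) y)" by simp
        then show ?case using H(1) Suc unfolding lower_central.simps by (intro C.span_base) blast
      qed (use y in simp)
      then have "(cb H ^^ n) y = 0" using n by blast
      moreover have "(cb H ^^ j) y = (\<Sum>\<alpha>\<in>\<Delta>. cscale (c \<alpha> * \<alpha> H ^ j) (X \<alpha>))" for j
      proof (induction j)
        case (Suc j)
        have l: "C.lin (cb H)" by (simp add: C.lin_def cl(1,2))
        show ?case using Suc H(1) by (simp add: C.lin_sum[OF l] cl(2) X_root mult_ac)
      qed (simp add: y_def)
      ultimately have "(\<Sum>\<alpha>\<in>\<Delta>. cscale (c \<alpha> * \<alpha> H ^ n) (X \<alpha>)) = 0" by simp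
      from root_vectors_independent[OF finite_roots order_refl this] show ?thesis using \<alpha> H(2) by auto
    qed
    then show "x \<in> C.span (D ` \<Delta>)" using k by simp
  qed
qed

lemma h_abelian: "x \<in> \<hh> \<Longrightarrow> y \<in> \<hh> \<Longrightarrow> cb x y = 0"
proof -
  assume x: "x \<in> \<hh>" and "y \<in> \<hh>"
  then have "y \<in> C.span (D ` \<Delta>)" using h_span by simp
  then show ?thesis
  proof (induction rule: C.span_induct_alt)
    case (step c z y)
    then show ?case using D_central[OF _ x] by (auto simp: cl(1,2))
  qed (simp add: cl(9))
qed

lemma B_move: "B (cb H x) y = - B x (cb H y)"
  using B_inv[of x H y] cl(6)[of H x] B_scale(2)[of "-1" "cb x H" y] by simp

lemma B_h_X: "H \<in> \<hh> \<Longrightarrow> \<alpha> \<in> \<Delta> \<Longrightarrow> B H (X \<alpha>) = 0"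
proof -
  assume H: "H \<in> \<hh>" and \<alpha>: "\<alpha> \<in> \<Delta>"
  obtain J where J: "J \<in> \<hh>" "\<alpha> J \<noteq> 0" by (rule root_nonzero[OF \<alpha>])
  have "B H (cscale (\<alpha> J) (X \<alpha>)) = - B (cb J H) (X \<alpha>)" using B_move[of J H "X \<alpha>"] by (simp add: X_root[OF \<alpha> J(1)])
  then show ?thesis using h_abelian[OF J(1) H] J(2) by (simp add: B_scale B_zero)
qed

lemma B_X_X: "\<alpha> \<in> \<Delta> \<Longrightarrow> \<beta> \<in> \<Delta> \<Longrightarrow> \<beta> \<noteq> fneg \<alpha> \<Longrightarrow> B (X \<alpha>) (X \<beta>) = 0"
proof -
  assume ab: "\<alpha> \<in> \<Delta>" "\<beta> \<in> \<Delta>" "\<beta> \<noteq> fneg \<alpha>"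
  then obtain J where J: "\<beta> J \<noteq> - \<alpha> J" by blast
  then have "J \<in> \<hh>" using dual_on_outside root_dual ab by (metis add.inverse_neutral)
  then have "\<alpha> J * B (X \<alpha>) (X \<beta>) = - \<beta> J * B (X \<alpha>) (X \<beta>)"
    using B_move[of J "X \<alpha>" "X \<beta>"] ab by (simp add: X_root B_scale)
  then have "(\<beta> J + \<alpha> J) * B (X \<alpha>) (X \<beta>) = 0" by (simp add: distrib_right)
  moreover have "\<beta> J + \<alpha> J \<noteq> 0" using J by (simp add: eq_neg_iff_add_eq_0)
  ultimately show ?thesis by simp
qed

lemma B_h_nondegenerate:
  assumes H: "H \<in> \<hh>" and "\<And>J. J \<in> \<hh> \<Longrightarrow> B J H = 0"
  shows "H = 0"
proof (rule B_nondegenerate)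
  fix W
  obtain k c where k: "k \<in> C.span (D ` \<Delta>)" "W = k + (\<Sum>\<alpha>\<in>\<Delta>. cscale (c \<alpha>) (X \<alpha>))" by (rule decomposition)
  have "B H k = 0" using assms(2)[of k] k(1) h_span B_sym by metis
  then show "B H W = 0" by (simp add: k(2) B_add B_sum B_scale B_h_X[OF H])
qed

lemma dual_vector_eq:
  assumes "H \<in> \<hh>" "\<And>J. J \<in> \<hh> \<Longrightarrow> B J H = \<mu> J"
  shows "D \<mu> = H"
  unfolding dual_vector_def
proof (rule the_equality)
  show "H \<in> \<hh> \<and> (\<forall>H'\<in>\<hh>. B H' H = \<mu> H')" using assms by blast
  fix H2 assume "H2 \<in> \<hh> \<and> (\<forall>H'\<in>\<hh>. B H' H2 = \<mu> H')"
  then have "H2 - H = 0"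
    using assms by (intro B_h_nondegenerate) (auto simp: B_diff intro: C.subspace_diff[OF h_sub])
  then show "H2 = H" by simp
qed

text \<open>Invariance gives \<open>B(H, [X\<^sub>\<alpha>, X\<^sub>-\<^sub>\<alpha>]) = b \<alpha>(H)\<close> with \<open>b = B(X\<^sub>\<alpha>, X\<^sub>-\<^sub>\<alpha>)\<close>. So \<open>[X\<^sub>\<alpha>, X\<^sub>-\<^sub>\<alpha>] / b\<close> represents \<open>\<alpha>\<close> and
  equals \<open>H\<^sub>\<alpha>\<close>; comparison with \<open>[X\<^sub>\<alpha>, X\<^sub>-\<^sub>\<alpha>] = H\<^sub>\<alpha>\<close> forces \<open>b = 1\<close>.\<close>

lemma B_pair_1: "\<alpha> \<in> \<Delta> \<Longrightarrow> B (X \<alpha>) (X (fneg \<alpha>)) = 1" and B_D: "\<alpha> \<in> \<Delta> \<Longrightarrow> H \<in> \<hh> \<Longrightarrow> B H (D \<alpha>) = \<alpha> H"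
proof -
  assume \<alpha>: "\<alpha> \<in> \<Delta>"
  define b where "b = B (X \<alpha>) (X (fneg \<alpha>))"
  have "b \<noteq> 0"
  proof
    assume b: "b = 0"
    have "X \<alpha> = 0"
    proof (rule B_nondegenerate)
      fix W
      obtain k c where k: "k \<in> C.span (D ` \<Delta>)" "W = k + (\<Sum>\<alpha>\<in>\<Delta>. cscale (c \<alpha>) (X \<alpha>))" by (rule decomposition)
      have "B (X \<alpha>) k = 0" using B_h_X[OF _ \<alpha>, of k] k(1) h_span B_sym by metis
      moreover have "B (X \<alpha>) (X \<beta>) = 0" if "\<beta> \<in> \<Delta>" for \<beta>
        using B_X_X[OF \<alpha> that] b by (cases "\<beta> = fneg \<alpha>") (auto simp: b_def)
      ultimately show "B (X \<alpha>) W = 0" by (simp add: k(2) B_add B_sum B_scale)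
    qed
    then show False using X_nonzero[OF \<alpha>] by blast
  qed
  have pair: "B H (D \<alpha>) = \<alpha> H * b" if "H \<in> \<hh>" for H
    unfolding X_bracket[OF \<alpha>, symmetric] B_inv[symmetric]
    using that by (simp add: X_root[OF \<alpha>] B_scale b_def)
  have "D \<alpha> = cscale (1 / b) (D \<alpha>)"
    using \<open>b \<noteq> 0\<close> D_in[OF \<alpha>] by (intro dual_vector_eq C.subspace_scale[OF h_sub]) (auto simp: B_scale pair)
  moreover have "D \<alpha> \<noteq> 0"
  proof
    assume "D \<alpha> = 0"
    moreover obtain H where "H \<in> \<hh>" "\<alpha> H \<noteq> 0" by (rule root_nonzero[OF \<alpha>])
    ultimately show False using pair[of H] \<open>b \<noteq> 0\<close> by (simp add: B_zero)
  qed
  ultimately have "1 / b = 1" by (metis C.scale_one C.scale_cancel_right)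
  then have b1: "b = 1" by simp
  then show "B (X \<alpha>) (X (fneg \<alpha>)) = 1" by (simp add: b_def)
  show "B H (D \<alpha>) = \<alpha> H" if "H \<in> \<hh>" using pair[OF that] b1 by simp
qed

lemma real_form:
  assumes "\<alpha> \<in> \<Delta>"
  shows "cscale \<i> (D \<alpha>) \<in> range cembed" "X \<alpha> - X (fneg \<alpha>) \<in> range cembed" "cscale \<i> (X \<alpha> + X (fneg \<alpha>)) \<in> range cembed"
  unfolding u_span by (intro span_base UN_I[OF assms]; simp)+

lemma range_cembed: "Z \<in> range cembed \<longleftrightarrow> snd Z = 0"
  by (auto simp: cembed_def image_iff prod_eq_iff)

lemma D_imag: "\<alpha> \<in> \<Delta> \<Longrightarrow> fst (D \<alpha>) = 0"
  using real_form(1)[of \<alpha>] by (simp add: range_cembed cscale_simps)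

text \<open>Both \<open>X\<^sub>\<alpha> - X\<^sub>-\<^sub>\<alpha>\<close> and \<open>\<i> (X\<^sub>\<alpha> + X\<^sub>-\<^sub>\<alpha>)\<close> are fixed by the conjugation with respect to \<open>\<uu>\<close>.\<close>

lemma X_conj: "\<alpha> \<in> \<Delta> \<Longrightarrow> conj_pair (X (fneg \<alpha>)) = - X \<alpha>"
proof -
  assume \<alpha>: "\<alpha> \<in> \<Delta>"
  have "snd (X \<alpha>) - snd (X (fneg \<alpha>)) = 0" "fst (X \<alpha>) + fst (X (fneg \<alpha>)) = 0"
    using real_form(2,3)[OF \<alpha>] by (simp_all add: range_cembed cscale_simps)
  then show ?thesis by (simp add: conj_pair_def prod_eq_iff eq_neg_iff_add_eq_0 add.commute)
qed

lemma D_nonzero: "\<alpha> \<in> \<Delta> \<Longrightarrow> D \<alpha> \<noteq> 0"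
  using root_nonzero B_D B_zero by metis

lemma root_pos: "\<alpha> \<in> \<Delta> \<Longrightarrow> \<exists>r>0. \<alpha> (D \<alpha>) = complex_of_real r"
proof -
  assume \<alpha>: "\<alpha> \<in> \<Delta>"
  have "snd (D \<alpha>) \<noteq> 0" using D_nonzero[OF \<alpha>] D_imag[OF \<alpha>] by (simp add: prod_eq_iff)
  moreover have "\<alpha> (D \<alpha>) = complex_of_real (- K (snd (D \<alpha>)) (snd (D \<alpha>)))"
    using B_D[OF \<alpha> D_in[OF \<alpha>]] D_imag[OF \<alpha>] by (simp add: ckilling_eq complex_eq_iff Ks)
  ultimately show ?thesis using K_neg by (intro exI[of _ "- K (snd (D \<alpha>)) (snd (D \<alpha>))"]) auto
qed

lemma real_cartan_imag: "H \<in> real_cartan br \<hh> \<Longrightarrow> fst H = 0" and real_cartan_h: "real_cartan br \<hh> \<subseteq> \<hh>"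
proof -
  have "subspace \<hh>" using h_sub by (auto simp: subspace_def C.subspace_def cscale_real[symmetric])
  then show "real_cartan br \<hh> \<subseteq> \<hh>" unfolding real_cartan_def using D_in by (intro span_minimal) auto
  have "subspace {H::'u cplx. fst H = 0}" by (rule subspaceI) auto
  then have "real_cartan br \<hh> \<subseteq> {H. fst H = 0}" unfolding real_cartan_def
    using D_imag by (intro span_minimal) auto
  then show "fst H = 0" if "H \<in> real_cartan br \<hh>" using that by blast
qed

text \<open>On \<open>\<hh>\<^sub>\<real>\<close> the form \<open>B\<close> is real and positive definite, so a frame of \<open>\<hh>\<^sub>\<real>\<close> represents any linear form on \<open>\<hh>\<close>,
  first on \<open>\<hh>\<^sub>\<real>\<close> and then by complex linearity.\<close>

lemma dual_vector_represents:
  assumes \<mu>: "\<mu> \<in> dual_on \<hh>"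
  shows "D \<mu> \<in> \<hh>" "H \<in> \<hh> \<Longrightarrow> B H (D \<mu>) = \<mu> H"
proof -
  let ?R = "real_cartan br \<hh>"
  define g where "g Z W = Re (B Z W)" for Z W
  have g: "pos_on g ?R"
    unfolding pos_on_def
  proof (intro conjI ballI allI impI)
    show "bilinear g"
      by (intro bilinearI) (simp_all add: g_def B_add B_scale cscale_real[symmetric])
    show "g x y = g y x" for x y unfolding g_def by (simp add: B_sym[of x y])
    fix x assume x: "x \<in> ?R" "x \<noteq> 0"
    then have "snd x \<noteq> 0" using real_cartan_imag[OF x(1)] by (simp add: prod_eq_iff)
    then show "g x x > 0" using K_neg real_cartan_imag[OF x(1)] by (simp add: g_def ckilling_eq Ks)
  qed
  have real: "B Z W = complex_of_real (g Z W)" if "Z \<in> ?R" "W \<in> ?R" for Z W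
    using real_cartan_imag[OF that(1)] real_cartan_imag[OF that(2)] by (simp add: g_def ckilling_eq complex_eq_iff Ks)
  obtain G where G: "finite G" "span G = (UNIV :: 'u set)" using finite_span by blast
  have "Z \<in> span ((\<lambda>x. (x, 0)) ` G \<union> (\<lambda>x. (0, x)) ` G)" for Z :: "'u cplx"
  proof -
    let ?f = "\<lambda>x::'u. (x, 0::'u)" and ?g = "\<lambda>x::'u. (0::'u, x)"
    have l: "linear ?f" "linear ?g" by (simp_all add: linear_iff)
    have "?f (fst Z) \<in> span (?f ` G)" "?g (snd Z) \<in> span (?g ` G)"
      unfolding linear_span_image[OF l(1)] linear_span_image[OF l(2)] G(2) by blast+
    then have "?f (fst Z) \<in> span (?f ` G \<union> ?g ` G)" "?g (snd Z) \<in> span (?f ` G \<union> ?g ` G)"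
      using span_mono[of "?f ` G" "?f ` G \<union> ?g ` G"] span_mono[of "?g ` G" "?f ` G \<union> ?g ` G"] by blast+
    then have "?f (fst Z) + ?g (snd Z) \<in> span (?f ` G \<union> ?g ` G)" by (rule span_add)
    then show ?thesis by simp
  qed
  then have G2: "finite ((\<lambda>x. (x, 0)) ` G \<union> (\<lambda>x. (0, x)) ` G)"
    "span ((\<lambda>x. (x, 0)) ` G \<union> (\<lambda>x. (0, x)) ` G) = (UNIV :: 'u cplx set)" using G(1) by blast+
  obtain E where E: "frame g ?R E (\<lambda>e. e)"
    by (rule pos_on_frame[OF g G2]) (unfold real_cartan_def, rule subspace_span)
  define M where "M = (\<Sum>e\<in>E. cscale (\<mu> e) e)"
  have ER: "e \<in> E \<Longrightarrow> e \<in> ?R" for e using E by (auto simp: frame_def)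
  have Eh: "e \<in> E \<Longrightarrow> e \<in> \<hh>" for e using ER real_cartan_h by blast
  have Mh: "M \<in> \<hh>" unfolding M_def by (intro C.subspace_sum[OF h_sub] C.subspace_scale[OF h_sub] Eh)
  have \<mu>0: "\<mu> 0 = 0" using dual_onD(2)[OF \<mu>, of 0 0] C.subspace_0[OF h_sub] by simp
  have \<mu>_sum: "\<mu> (\<Sum>e\<in>F. cscale (c e) e) = (\<Sum>e\<in>F. c e * \<mu> e)" if "finite F" "F \<subseteq> \<hh>" for F c
    using that
  proof (induction F rule: finite_induct)
    case (insert e F)
    have "(\<Sum>e\<in>F. cscale (c e) e) \<in> \<hh>"
      using insert.prems by (intro C.subspace_sum[OF h_sub] C.subspace_scale[OF h_sub]) auto
    then show ?case using insert by (simp add: dual_onD[OF \<mu>] C.subspace_scale[OF h_sub])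
  qed (simp add: \<mu>0)
  have "B H M = \<mu> H" if H: "H \<in> ?R" for H
  proof -
    have "B H M = (\<Sum>e\<in>E. \<mu> e * complex_of_real (g H e))"
      unfolding M_def B_sum by (intro sum.cong refl) (simp add: B_scale real[OF H ER])
    also have "\<dots> = \<mu> (\<Sum>e\<in>E. cscale (complex_of_real (g H e)) e)"
      using E Eh by (subst \<mu>_sum) (auto simp: frame_def mult.commute)
    also have "(\<Sum>e\<in>E. cscale (complex_of_real (g H e)) e) = H"
      using E H by (simp add: cscale_real frame_def)
    finally show ?thesis .
  qed
  then have "B (D \<alpha>) M = \<mu> (D \<alpha>)" if "\<alpha> \<in> \<Delta>" for \<alpha>
    using that unfolding real_cartan_def by (meson imageI span_base)
  then have BM: "B H M = \<mu> H" if "H \<in> \<hh>" for H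
  proof -
    have "H \<in> C.span (D ` \<Delta>)" using that h_span by simp
    then have "H \<in> \<hh> \<and> B H M = \<mu> H"
    proof (induction rule: C.span_induct_alt)
      case base
      then show ?case by (simp add: B_zero \<mu>0 C.subspace_0[OF h_sub])
    next
      case (step c x y)
      then obtain \<alpha> where \<alpha>: "\<alpha> \<in> \<Delta>" "x = D \<alpha>" by auto
      then have xh: "cscale c x \<in> \<hh>" "x \<in> \<hh>" using D_in by (auto intro: C.subspace_scale[OF h_sub])
      then show ?case using step \<alpha> \<open>\<And>\<alpha>. \<alpha> \<in> \<Delta> \<Longrightarrow> B (D \<alpha>) M = \<mu> (D \<alpha>)\<close>
        by (auto simp: B_add B_scale dual_onD[OF \<mu>] C.subspace_add[OF h_sub])
    qed
    then show ?thesis by blast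
  qed
  then have DM: "D \<mu> = M" by (intro dual_vector_eq Mh)
  show "D \<mu> \<in> \<hh>" using DM Mh by simp
  show "B H (D \<mu>) = \<mu> H" if "H \<in> \<hh>" using DM BM that by simp
qed

end

section \<open>Weight spaces of a representation\<close>

locale root_representation = root_data br \<hh> X
  for br :: "'u::real_vector \<Rightarrow> 'u \<Rightarrow> 'u" and \<hh> :: "'u cplx set" and X :: "('u cplx \<Rightarrow> complex) \<Rightarrow> 'u cplx" +
  fixes sc :: "complex \<Rightarrow> 'v::euclidean_space \<Rightarrow> 'v" and \<pi> :: "'u cplx \<Rightarrow> 'v \<Rightarrow> 'v"
  assumes complex: "complex_structure sc"
    and rep: "lie_representation cscale (cbracket br) sc \<pi>"
begin

lemma sc_real: "sc (complex_of_real r) v = r *\<^sub>R v"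
  using complex unfolding complex_structure_def by blast

sublocale V: fd_complex sc
proof -
  interpret V: vector_space sc by (rule complex_structure_vector_space[OF complex])
  show "fd_complex sc"
  proof
    have "v \<in> V.span (Basis :: 'v set)" for v
    proof -
      have "(\<Sum>b\<in>Basis. sc (complex_of_real (v \<bullet> b)) b) \<in> V.span (Basis :: 'v set)"
        by (intro V.span_sum V.span_scale V.span_base)
      then show ?thesis by (simp add: sc_real euclidean_representation)
    qed
    then show "\<exists>G. finite G \<and> V.span G = (UNIV :: 'v set)" using finite_Basis by blast
  qed
qed

lemma pi_linear: "Vector_Spaces.linear sc sc (\<pi> Z)" "Vector_Spaces.linear cscale sc (\<lambda>Z. \<pi> Z v)"
  using rep unfolding lie_representation_def by blast+

lemma pi_simps: "\<pi> Z (v + w) = \<pi> Z v + \<pi> Z w" "\<pi> Z (sc c v) = sc c (\<pi> Z v)" "\<pi> Z 0 = 0" "\<pi> Z (- v) = - \<pi> Z v"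
  "\<pi> Z (v - w) = \<pi> Z v - \<pi> Z w"
  "\<pi> (Z + W) v = \<pi> Z v + \<pi> W v" "\<pi> (cscale c Z) v = sc c (\<pi> Z v)" "\<pi> 0 v = 0" "\<pi> (- Z) v = - \<pi> Z v"
  "\<pi> (Z - W) v = \<pi> Z v - \<pi> W v"
proof -
  interpret L: Vector_Spaces.linear sc sc "\<pi> Z" for Z by (rule pi_linear)
  interpret R: Vector_Spaces.linear cscale sc "\<lambda>Z. \<pi> Z v" for v by (rule pi_linear)
  show "\<pi> Z (v + w) = \<pi> Z v + \<pi> Z w" "\<pi> Z (sc c v) = sc c (\<pi> Z v)" "\<pi> Z 0 = 0" "\<pi> Z (- v) = - \<pi> Z v"
    "\<pi> Z (v - w) = \<pi> Z v - \<pi> Z w"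
    by (simp_all add: L.add L.scale L.zero L.neg L.diff)
  show "\<pi> (Z + W) v = \<pi> Z v + \<pi> W v" "\<pi> (cscale c Z) v = sc c (\<pi> Z v)" "\<pi> 0 v = 0" "\<pi> (- Z) v = - \<pi> Z v"
    "\<pi> (Z - W) v = \<pi> Z v - \<pi> W v"
    by (simp_all add: R.add R.scale R.zero R.neg R.diff)
qed

lemma pi_sum: "\<pi> (sum g A) v = (\<Sum>a\<in>A. \<pi> (g a) v)"
  by (induction A rule: infinite_finite_induct) (auto simp: pi_simps)

lemma pi_bracket: "\<pi> (cb Z W) v = \<pi> Z (\<pi> W v) - \<pi> W (\<pi> Z v)"
  using rep unfolding lie_representation_def by blast

lemma pi_real: "\<pi> Z (r *\<^sub>R v) = r *\<^sub>R \<pi> Z v" "\<pi> (r *\<^sub>R Z) v = r *\<^sub>R \<pi> Z v"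
  using pi_simps(2)[of Z "complex_of_real r" v] pi_simps(7)[of "complex_of_real r" Z v]
  by (simp_all add: sc_real cscale_real)

abbreviation "W \<equiv> weight_space sc \<pi> \<hh>"

lemma W_subspace: "V.subspace (W \<mu>)"
  by (rule V.subspaceI) (auto simp: weight_space_def pi_simps V.scale_right_distrib mult.commute)

lemma real_subspace: "V.subspace S \<Longrightarrow> subspace S"
  by (auto simp: subspace_def V.subspace_def sc_real[symmetric])

lemma W_eigen: "v \<in> W \<mu> \<Longrightarrow> H \<in> \<hh> \<Longrightarrow> \<pi> H v = sc (\<mu> H) v"
  by (simp add: weight_space_def)

lemma X_shift:
  assumes "v \<in> W \<mu>" "\<alpha> \<in> \<Delta>"
  shows "\<pi> (X \<alpha>) v \<in> W (fadd \<mu> \<alpha>)"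
proof -
  have "\<pi> H (\<pi> (X \<alpha>) v) = sc (\<mu> H + \<alpha> H) (\<pi> (X \<alpha>) v)" if H: "H \<in> \<hh>" for H
    using pi_bracket[of H "X \<alpha>" v] W_eigen[OF assms(1) H]
    by (simp add: X_root[OF assms(2) H] pi_simps V.scale_left_distrib algebra_simps)
  then show ?thesis by (simp add: weight_space_def)
qed

lemma D_splits: "\<alpha> \<in> \<Delta> \<Longrightarrow> V.splits (\<pi> (D \<alpha>))"
proof (rule V.sl2_splits[of "\<pi> (X \<alpha>)" "\<pi> (X (fneg \<alpha>))" _ "\<alpha> (D \<alpha>)"])
  assume \<alpha>: "\<alpha> \<in> \<Delta>"
  show "V.lin (\<pi> (X \<alpha>))" "V.lin (\<pi> (X (fneg \<alpha>)))" "V.lin (\<pi> (D \<alpha>))"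
    by (simp_all add: V.lin_def pi_simps)
  show "\<pi> (X \<alpha>) (\<pi> (X (fneg \<alpha>)) v) - \<pi> (X (fneg \<alpha>)) (\<pi> (X \<alpha>) v) = \<pi> (D \<alpha>) v" for v
    by (simp add: X_bracket[OF \<alpha>, symmetric] pi_bracket)
  show "\<pi> (D \<alpha>) (\<pi> (X \<alpha>) v) = \<pi> (X \<alpha>) (\<pi> (D \<alpha>) v) + sc (\<alpha> (D \<alpha>)) (\<pi> (X \<alpha>) v)" for v
    using pi_bracket[of "D \<alpha>" "X \<alpha>" v] by (simp add: X_root[OF \<alpha> D_in[OF \<alpha>]] pi_simps algebra_simps)
  show "\<pi> (D \<alpha>) (\<pi> (X (fneg \<alpha>)) v) = \<pi> (X (fneg \<alpha>)) (\<pi> (D \<alpha>) v) + sc (- \<alpha> (D \<alpha>)) (\<pi> (X (fneg \<alpha>)) v)" for v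
    using pi_bracket[of "D \<alpha>" "X (fneg \<alpha>)" v]
    by (simp add: X_root[OF neg_root[OF \<alpha>] D_in[OF \<alpha>]] pi_simps algebra_simps)
  show "\<alpha> (D \<alpha>) \<noteq> 0" using root_pos[OF \<alpha>] by auto
qed

lemma joint_eigenvector_weight:
  assumes v: "v \<noteq> 0" "\<forall>\<alpha>\<in>\<Delta>. \<exists>c. \<pi> (D \<alpha>) v = sc c v"
  obtains \<mu> where "\<mu> \<in> weights sc \<pi> \<hh>" "v \<in> W \<mu>"
proof -
  have ex: "\<exists>c. \<pi> H v = sc c v" if "H \<in> \<hh>" for H
  proof -
    have "H \<in> C.span (D ` \<Delta>)" using that h_span by simp
    then show ?thesis
    proof (induction rule: C.span_induct_alt)
      case base
      show ?case by (intro exI[of _ 0]) (simp add: pi_simps)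
    next
      case (step c x y)
      then obtain a b where "\<pi> x v = sc a v" "\<pi> y v = sc b v" using v(2) by blast
      then show ?case by (intro exI[of _ "c * a + b"]) (simp add: pi_simps V.scale_left_distrib)
    qed
  qed
  define \<mu> where "\<mu> H = (if H \<in> \<hh> then SOME c. \<pi> H v = sc c v else 0)" for H
  have \<mu>: "\<pi> H v = sc (\<mu> H) v" if "H \<in> \<hh>" for H using someI_ex[OF ex[OF that]] that by (simp add: \<mu>_def)
  have u: "\<mu> H = c" if "H \<in> \<hh>" "\<pi> H v = sc c v" for H c
    using \<mu>[OF that(1)] that(2) v(1) by simp
  have "\<mu> \<in> dual_on \<hh>"
    unfolding dual_on_def
  proof (intro CollectI conjI ballI allI impI)
    show "\<mu> (x + y) = \<mu> x + \<mu> y" if "x \<in> \<hh>" "y \<in> \<hh>" for x y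
      using that by (intro u C.subspace_add[OF h_sub]) (auto simp: pi_simps \<mu> V.scale_left_distrib)
    show "\<mu> (cscale c x) = c * \<mu> x" if "x \<in> \<hh>" for c x
      using that by (intro u C.subspace_scale[OF h_sub]) (auto simp: pi_simps \<mu>)
  qed (simp add: \<mu>_def)
  moreover have "v \<in> W \<mu>" using \<mu> by (simp add: weight_space_def)
  ultimately show ?thesis using that v(1) by (auto simp: weights_def)
qed

text \<open>The commuting operators \<open>\<pi>(H\<^sub>\<alpha>)\<close> are diagonalizable by \<open>sl2_splits\<close>, and a joint eigenvector of them is a
  weight vector because the \<open>H\<^sub>\<alpha>\<close> span \<open>\<hh>\<close>.\<close>

lemma weight_spaces_span: "V.span (\<Union>\<mu>\<in>weights sc \<pi> \<hh>. W \<mu>) = UNIV"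
proof -
  have "V.span {v. \<forall>\<alpha>\<in>\<Delta>. \<exists>c. \<pi> (D \<alpha>) v = sc c v} = UNIV"
  proof (rule V.joint_eigenvectors[OF finite_roots])
    show "V.lin (\<pi> (D \<alpha>))" for \<alpha> by (simp add: V.lin_def pi_simps)
    show "\<pi> (D \<alpha>) (\<pi> (D \<beta>) v) = \<pi> (D \<beta>) (\<pi> (D \<alpha>) v)" if "\<alpha> \<in> \<Delta>" "\<beta> \<in> \<Delta>" for \<alpha> \<beta> v
      using pi_bracket[of "D \<alpha>" "D \<beta>" v] h_abelian[OF D_in[OF that(1)] D_in[OF that(2)]] by (simp add: pi_simps)
  qed (rule D_splits)
  moreover have "{v. \<forall>\<alpha>\<in>\<Delta>. \<exists>c. \<pi> (D \<alpha>) v = sc c v} \<subseteq> V.span (\<Union>\<mu>\<in>weights sc \<pi> \<hh>. W \<mu>)"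
  proof
    fix v assume v: "v \<in> {v. \<forall>\<alpha>\<in>\<Delta>. \<exists>c. \<pi> (D \<alpha>) v = sc c v}"
    show "v \<in> V.span (\<Union>\<mu>\<in>weights sc \<pi> \<hh>. W \<mu>)"
    proof (cases "v = 0")
      case False
      then obtain \<mu> where "\<mu> \<in> weights sc \<pi> \<hh>" "v \<in> W \<mu>" using v by (auto elim: joint_eigenvector_weight)
      then show ?thesis by (intro V.span_base) blast
    qed (simp add: V.span_zero)
  qed
  ultimately show ?thesis using V.span_minimal[OF _ V.subspace_span] by blast
qed

lemma span_weight_spaces:
  assumes "v \<in> V.span (\<Union>\<mu>\<in>M. W \<mu>)"
  shows "\<exists>A w. finite A \<and> A \<subseteq> M \<and> (\<forall>\<mu>\<in>A. w \<mu> \<in> W \<mu>) \<and> v = sum w A"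
  using assms
proof (induction rule: V.span_induct_alt)
    case base
    show ?case by (intro exI[of _ "{}"]) simp
  next
    case (step c x y)
    then obtain A w where A: "finite A" "A \<subseteq> M" "\<forall>\<mu>\<in>A. w \<mu> \<in> W \<mu>" "y = sum w A" by blast
    obtain \<nu> where \<nu>: "\<nu> \<in> M" "x \<in> W \<nu>" using step by blast
    define w' where "w' \<mu> = (if \<mu> \<in> A then w \<mu> else 0) + (if \<mu> = \<nu> then sc c x else 0)" for \<mu>
    have "sum w' (insert \<nu> A) = (\<Sum>\<mu>\<in>insert \<nu> A. if \<mu> \<in> A then w \<mu> else 0) + sc c x"
      using A(1) by (simp add: w'_def sum.distrib sum.delta del: sum.insert_if sum.insert)
    also have "(\<Sum>\<mu>\<in>insert \<nu> A. if \<mu> \<in> A then w \<mu> else 0) = sum w A"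
      by (rule sum.mono_neutral_cong_right) (use A(1) in auto)
    finally have "sc c x + y = sum w' (insert \<nu> A)" using A(4) by simp
    moreover have "\<forall>\<mu>\<in>insert \<nu> A. w' \<mu> \<in> W \<mu>"
      using A(3) \<nu>(2) by (auto simp: w'_def intro: V.subspace_add[OF W_subspace] V.subspace_scale[OF W_subspace] V.subspace_0[OF W_subspace])
    ultimately show ?case using A(1,2) \<nu>(1) by (intro exI[of _ "insert \<nu> A"] exI[of _ w']) auto
qed

lemma weight_dual: "\<mu> \<in> weights sc \<pi> \<hh> \<Longrightarrow> \<mu> \<in> dual_on \<hh>" by (simp add: weights_def)

lemma fadd_dual: "\<mu> \<in> dual_on \<hh> \<Longrightarrow> \<nu> \<in> dual_on \<hh> \<Longrightarrow> fadd \<mu> \<nu> \<in> dual_on \<hh>"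
  unfolding dual_on_def by (auto simp: algebra_simps)

context
  fixes \<mu>0 assumes \<mu>0: "\<mu>0 \<in> weights sc \<pi> \<hh>"
begin

abbreviation "V1 \<equiv> W \<mu>0"
abbreviation "V2 \<equiv> other_weight_spaces sc \<pi> \<hh> \<mu>0"

lemma V2_subspace: "V.subspace V2" by (simp add: other_weight_spaces_def)

lemma in_V2:
  assumes "v \<in> W \<mu>" "\<mu> \<in> dual_on \<hh>" "\<mu> \<noteq> \<mu>0"
  shows "v \<in> V2"
proof (cases "v = 0")
  case True
  then show ?thesis using V.subspace_0[OF V2_subspace] by simp
next
  case False
  then have "\<mu> \<in> weights sc \<pi> \<hh> - {\<mu>0}" using assms by (auto simp: weights_def)
  then show ?thesis unfolding other_weight_spaces_def using assms(1) by (intro V.span_base) blast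
qed

lemma V2_induct:
  assumes "w \<in> V2" "V.subspace S" "\<And>\<mu> v. \<mu> \<in> weights sc \<pi> \<hh> \<Longrightarrow> \<mu> \<noteq> \<mu>0 \<Longrightarrow> v \<in> W \<mu> \<Longrightarrow> v \<in> S"
  shows "w \<in> S"
proof -
  have "V2 \<subseteq> S" unfolding other_weight_spaces_def using assms(3) by (intro V.span_minimal assms(2)) blast
  then show ?thesis using assms(1) by blast
qed

lemma direct_sum: "direct_sum_decomposition V1 V2"
  unfolding direct_sum_decomposition_def
proof (intro conjI)
  show "subspace V1" "subspace V2" using real_subspace W_subspace V2_subspace by blast+
  show "V1 \<inter> V2 = {0}"
  proof
    show "{0} \<subseteq> V1 \<inter> V2" using V.subspace_0[OF W_subspace] V.subspace_0[OF V2_subspace] by simp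
    show "V1 \<inter> V2 \<subseteq> {0}"
    proof
      fix v assume v: "v \<in> V1 \<inter> V2"
      obtain A w where A: "finite A" "A \<subseteq> weights sc \<pi> \<hh> - {\<mu>0}" "\<And>\<mu>. \<mu> \<in> A \<Longrightarrow> w \<mu> \<in> W \<mu>" "v = sum w A"
        using span_weight_spaces[of v "weights sc \<pi> \<hh> - {\<mu>0}"] v unfolding other_weight_spaces_def by blast
      have n: "\<mu>0 \<notin> A" using A(2) by blast
      define w' where "w' = w(\<mu>0 := - v)"
      have "\<forall>\<mu>\<in>insert \<mu>0 A. w' \<mu> = 0"
      proof (rule weight_independent[OF V.vector_space_axioms])
        show "Vector_Spaces.linear sc sc (\<pi> H)" for H by (rule pi_linear)
        show "finite (insert \<mu>0 A)" using A(1) by simp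
        show "insert \<mu>0 A \<subseteq> dual_on \<hh>" using A(2) \<mu>0 weight_dual by blast
        show "w' \<mu> \<in> W \<mu>" if "\<mu> \<in> insert \<mu>0 A" for \<mu>
          using that A(3) v by (auto simp: w'_def intro: V.subspace_neg[OF W_subspace])
        have "sum w' A = sum w A" using n by (intro sum.cong) (auto simp: w'_def)
        then show "sum w' (insert \<mu>0 A) = 0" using A(1,4) n by (simp add: w'_def)
      qed
      then show "v \<in> {0}" by (simp add: w'_def)
    qed
  qed
  have "v \<in> {v + w | v w. v \<in> V1 \<and> w \<in> V2}" for v
  proof -
    let ?S = "{v + w | v w. v \<in> V1 \<and> w \<in> V2}"
    have s: "V.subspace ?S"
      by (rule V.subspace_sums[OF W_subspace V2_subspace])
    have "W \<mu> \<subseteq> ?S" if "\<mu> \<in> weights sc \<pi> \<hh>" for \<mu>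
    proof
      fix v assume v: "v \<in> W \<mu>"
      show "v \<in> ?S"
      proof (cases "\<mu> = \<mu>0")
        case True
        then have "v = v + 0" "v \<in> V1" "0 \<in> V2" using v V.subspace_0[OF V2_subspace] by auto
        then show ?thesis by blast
      next
        case False
        then have "v = 0 + v" "0 \<in> V1" "v \<in> V2"
          using in_V2[OF v weight_dual[OF that]] V.subspace_0[OF W_subspace] by auto
        then show ?thesis by blast
      qed
    qed
    then have "V.span (\<Union>\<mu>\<in>weights sc \<pi> \<hh>. W \<mu>) \<subseteq> ?S" by (intro V.span_minimal s) blast
    then show ?thesis using weight_spaces_span by blast
  qed
  then show "{v + w | v w. v \<in> V1 \<and> w \<in> V2} = UNIV" by blast
qed

lemma h_V1: "H \<in> \<hh> \<Longrightarrow> v \<in> V1 \<Longrightarrow> \<pi> H v \<in> V1"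
  using W_eigen V.subspace_scale[OF W_subspace] by metis

lemma h_V2: "H \<in> \<hh> \<Longrightarrow> w \<in> V2 \<Longrightarrow> \<pi> H w \<in> V2"
proof -
  assume H: "H \<in> \<hh>" and w: "w \<in> V2"
  have "w \<in> {w. \<pi> H w \<in> V2}"
  proof (rule V2_induct[OF w])
    show "V.subspace {w. \<pi> H w \<in> V2}"
      by (rule V.subspaceI) (auto simp: pi_simps intro: V.subspace_0[OF V2_subspace] V.subspace_add[OF V2_subspace] V.subspace_scale[OF V2_subspace])
    show "v \<in> {w. \<pi> H w \<in> V2}" if "\<mu> \<in> weights sc \<pi> \<hh>" "\<mu> \<noteq> \<mu>0" "v \<in> W \<mu>" for \<mu> v
      using W_eigen[OF that(3) H] V.subspace_scale[OF V2_subspace in_V2[OF that(3) weight_dual[OF that(1)] that(2)]] by simp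
  qed
  then show ?thesis by simp
qed

lemma shift_neq: "\<alpha> \<in> \<Delta> \<Longrightarrow> fadd \<mu>0 \<alpha> \<noteq> \<mu>0"
  by (metis add_cancel_right_right root_nonzero)

lemma shift_dual: "\<alpha> \<in> \<Delta> \<Longrightarrow> fadd \<mu>0 \<alpha> \<in> dual_on \<hh>"
  using fadd_dual[OF weight_dual[OF \<mu>0] root_dual] .

lemma X_V2: "\<alpha> \<in> \<Delta> \<Longrightarrow> v \<in> V1 \<Longrightarrow> \<pi> (X \<alpha>) v \<in> V2"
  using in_V2[OF X_shift shift_dual shift_neq] .

text \<open>The vectors \<open>\<pi>(X\<^sub>\<alpha>) v\<close> have the pairwise distinct weights \<open>\<mu>0 + \<alpha>\<close>.\<close>

lemma shifts_independent:
  assumes "A \<subseteq> \<Delta>" "v \<in> V1" "(\<Sum>\<alpha>\<in>A. sc (c \<alpha>) (\<pi> (X \<alpha>) v)) = 0" "\<alpha> \<in> A"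
  shows "sc (c \<alpha>) (\<pi> (X \<alpha>) v) = 0"
proof -
  have fin: "finite A" using finite_subset[OF assms(1) finite_roots] .
  define s where "s \<alpha> = fadd \<mu>0 \<alpha>" for \<alpha> :: "'u cplx \<Rightarrow> complex"
  define t where "t \<nu> = (\<lambda>H. \<nu> H - \<mu>0 H)" for \<nu> :: "'u cplx \<Rightarrow> complex"
  have ts: "t (s \<alpha>) = \<alpha>" for \<alpha> by (simp add: s_def t_def)
  have inj: "inj_on s A" by (metis inj_onI ts)
  define w where "w \<nu> = sc (c (t \<nu>)) (\<pi> (X (t \<nu>)) v)" for \<nu>
  have "\<forall>\<nu>\<in>s ` A. w \<nu> = 0"
  proof (rule weight_independent[OF V.vector_space_axioms])
    show "Vector_Spaces.linear sc sc (\<pi> H)" for H by (rule pi_linear)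
    show "finite (s ` A)" using fin by simp
    show "s ` A \<subseteq> dual_on \<hh>" using assms(1) shift_dual unfolding s_def by blast
    show "w \<nu> \<in> W \<nu>" if \<nu>: "\<nu> \<in> s ` A" for \<nu>
    proof -
      obtain \<beta> where \<beta>: "\<beta> \<in> A" "\<nu> = s \<beta>" using \<nu> by blast
      then have "\<pi> (X \<beta>) v \<in> W (s \<beta>)" unfolding s_def using assms(1,2) by (intro X_shift) auto
      then show ?thesis unfolding w_def \<beta>(2) ts by (rule V.subspace_scale[OF W_subspace])
    qed
    show "sum w (s ` A) = 0" using assms(3) by (simp add: sum.reindex[OF inj] w_def ts)
  qed
  then show ?thesis using assms(4) by (auto simp: w_def ts)
qed

context
  assumes regular: "\<And>\<alpha>. \<alpha> \<in> \<Delta> \<Longrightarrow> \<mu>0 (D \<alpha>) \<noteq> 0"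
begin

text \<open>This is where regularity enters: \<open>X\<^sub>\<alpha>\<close> and \<open>X\<^sub>-\<^sub>\<alpha>\<close> both annihilate \<open>v\<close>, hence so does their bracket \<open>H\<^sub>\<alpha>\<close>, which
  multiplies \<open>v\<close> by \<open>\<mu>0(H\<^sub>\<alpha>) \<noteq> 0\<close>.\<close>

lemma X_faithful:
  assumes "A \<subseteq> \<Delta>" "v \<in> V1" "(\<Sum>\<alpha>\<in>A. sc (c \<alpha>) (\<pi> (X \<alpha>) v)) = 0"
    and "\<alpha> \<in> A" "fneg \<alpha> \<in> A" "c \<alpha> \<noteq> 0" "c (fneg \<alpha>) \<noteq> 0"
  shows "v = 0"
proof -
  have \<alpha>: "\<alpha> \<in> \<Delta>" using assms by blast
  have "\<pi> (X \<alpha>) v = 0" "\<pi> (X (fneg \<alpha>)) v = 0"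
    using shifts_independent[OF assms(1-4)] shifts_independent[OF assms(1-3,5)] assms(6,7) by simp_all
  then have "\<pi> (D \<alpha>) v = 0" by (simp add: X_bracket[OF \<alpha>, symmetric] pi_bracket pi_simps)
  then show ?thesis using W_eigen[OF assms(2) D_in[OF \<alpha>]] regular[OF \<alpha>] by simp
qed

lemma cembed_fst: "Z \<in> range cembed \<Longrightarrow> cembed (fst Z) = Z"
  by (auto simp: cembed_def)

lemma cembed_root:
  assumes "\<alpha> \<in> \<Delta>"
  shows "cembed (root_X X \<alpha>) = X \<alpha> - X (fneg \<alpha>)" "cembed (root_Y X \<alpha>) = cscale \<i> (X \<alpha> + X (fneg \<alpha>))"
  unfolding root_X_def root_Y_def
  by (rule cembed_fst[OF real_form(2)[OF assms]], rule cembed_fst[OF real_form(3)[OF assms]])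

lemma root_neq_neg: "\<alpha> \<in> \<Delta> \<Longrightarrow> \<alpha> \<noteq> fneg \<alpha>"
proof
  assume \<alpha>: "\<alpha> \<in> \<Delta>" and eq: "\<alpha> = fneg \<alpha>"
  obtain H where "\<alpha> H \<noteq> 0" using root_nonzero[OF \<alpha>] by blast
  moreover have "\<alpha> H = - \<alpha> H" using eq by (rule fun_cong)
  ultimately show False by simp
qed

lemma rho_root:
  assumes "\<alpha> \<in> \<Delta>"
  shows "\<pi> (cembed (root_X X \<alpha>)) v = \<pi> (X \<alpha>) v - \<pi> (X (fneg \<alpha>)) v"
    "\<pi> (cembed (root_Y X \<alpha>)) v = sc \<i> (\<pi> (X \<alpha>) v + \<pi> (X (fneg \<alpha>)) v)"
  unfolding cembed_root[OF assms] by (simp_all add: pi_simps)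

lemma V1_nonzero: obtains v where "v \<in> V1" "v \<noteq> 0"
  using \<mu>0 V.subspace_0[OF W_subspace, of \<mu>0] by (auto simp: weights_def)

lemma rho_root_nonzero:
  assumes \<alpha>: "\<alpha> \<in> \<Delta>" and v: "v \<in> V1" "v \<noteq> 0"
  shows "\<pi> (cembed (root_X X \<alpha>)) v \<noteq> 0" "\<pi> (cembed (root_Y X \<alpha>)) v \<noteq> 0"
proof -
  let ?A = "{\<alpha>, fneg \<alpha>}"
  have A: "?A \<subseteq> \<Delta>" using \<alpha> neg_root[OF \<alpha>] by simp
  have s: "(\<Sum>\<beta>\<in>?A. sc (c \<beta>) (\<pi> (X \<beta>) v)) = sc (c \<alpha>) (\<pi> (X \<alpha>) v) + sc (c (fneg \<alpha>)) (\<pi> (X (fneg \<alpha>)) v)" for c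
    using root_neq_neg[OF \<alpha>] by simp
  show "\<pi> (cembed (root_X X \<alpha>)) v \<noteq> 0"
  proof
    assume 0: "\<pi> (cembed (root_X X \<alpha>)) v = 0"
    define c where "c \<beta> = (if \<beta> = \<alpha> then 1 else - 1 :: complex)" for \<beta>
    have c: "c \<alpha> = 1" "c (fneg \<alpha>) = - 1" using root_neq_neg[OF \<alpha>] by (auto simp: c_def)
    have "(\<Sum>\<beta>\<in>?A. sc (c \<beta>) (\<pi> (X \<beta>) v)) = 0" using 0 unfolding s c rho_root[OF \<alpha>] by simp
    from X_faithful[OF A v(1) this, of \<alpha>] show False using v(2) c by simp
  qed
  show "\<pi> (cembed (root_Y X \<alpha>)) v \<noteq> 0"
  proof
    assume 0: "\<pi> (cembed (root_Y X \<alpha>)) v = 0"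
    then have "(\<Sum>\<beta>\<in>?A. sc 1 (\<pi> (X \<beta>) v)) = 0" unfolding s rho_root[OF \<alpha>] by simp
    from X_faithful[OF A v(1) this, of \<alpha>] show False using v(2) by simp
  qed
qed

lemma rho_root_V2:
  assumes \<alpha>: "\<alpha> \<in> \<Delta>" and v: "v \<in> V1"
  shows "\<pi> (cembed (root_X X \<alpha>)) v \<in> V2" "\<pi> (cembed (root_Y X \<alpha>)) v \<in> V2"
  unfolding rho_root[OF \<alpha>]
  by (intro V.subspace_diff[OF V2_subspace] V.subspace_add[OF V2_subspace] V.subspace_scale[OF V2_subspace] X_V2 \<alpha> neg_root v)+

lemma dual_ext:
  assumes "\<mu> \<in> dual_on \<hh>" "\<nu> \<in> dual_on \<hh>" "\<And>\<alpha>. \<alpha> \<in> \<Delta> \<Longrightarrow> \<mu> (D \<alpha>) = \<nu> (D \<alpha>)"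
  shows "\<mu> = \<nu>"
proof
  fix H
  show "\<mu> H = \<nu> H"
  proof (cases "H \<in> \<hh>")
    case True
    have "H \<in> C.span (D ` \<Delta>)" using True h_span by simp
    also have "C.span (D ` \<Delta>) \<subseteq> {H \<in> \<hh>. \<mu> H = \<nu> H}"
    proof (rule C.span_minimal)
      show "D ` \<Delta> \<subseteq> {H \<in> \<hh>. \<mu> H = \<nu> H}" using D_in assms(3) by blast
      have z: "\<mu> 0 = 0" "\<nu> 0 = 0"
        using dual_onD(2)[OF assms(1), of 0 0] dual_onD(2)[OF assms(2), of 0 0] C.subspace_0[OF h_sub] by simp_all
      show "C.subspace {H \<in> \<hh>. \<mu> H = \<nu> H}"
      proof (rule C.subspaceI)
        show "x + y \<in> {H \<in> \<hh>. \<mu> H = \<nu> H}" if "x \<in> {H \<in> \<hh>. \<mu> H = \<nu> H}" "y \<in> {H \<in> \<hh>. \<mu> H = \<nu> H}" for x y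
          using that dual_onD(1)[OF assms(1), of x y] dual_onD(1)[OF assms(2), of x y] C.subspace_add[OF h_sub, of x y] by simp
        show "cscale c x \<in> {H \<in> \<hh>. \<mu> H = \<nu> H}" if "x \<in> {H \<in> \<hh>. \<mu> H = \<nu> H}" for c x
          using that dual_onD(2)[OF assms(1), of x c] dual_onD(2)[OF assms(2), of x c] C.subspace_scale[OF h_sub, of x c] by simp
      qed (use C.subspace_0[OF h_sub] z in simp)
    qed
    finally show ?thesis by simp
  next
    case False
    then show ?thesis using dual_on_outside assms(1,2) by metis
  qed
qed

section \<open>The six properties\<close>

text \<open>For an invariant Hermitian product \<open>\<i> H\<^sub>\<alpha>\<close> acts by a skew operator, so weights are real on the \<open>H\<^sub>\<alpha>\<close> and distinct
  weight spaces are orthogonal. The trace in the last property is \<open>\<Sum> \<langle>\<rho>(B) e, \<rho>(A) e\<rangle>\<close> over a frame of \<open>V1\<close>, and every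
  summand vanishes: if \<open>A\<close> and \<open>B\<close> belong to different positive roots, only different weight spaces
  meet; for \<open>X\<^sup>\<alpha>\<close> and \<open>Y\<^sup>\<alpha>\<close> what remains is \<open>\<i>\<close> times a real number.\<close>

lemma six_properties_hold:
  assumes herm: "hermitian_inner_product sc g"
    and inv: "\<And>x v w. g (\<pi> (cembed x) v) w = - g v (\<pi> (cembed x) w)"
    and P: "P \<subseteq> \<Delta>" "\<And>\<alpha>. \<alpha> \<in> P \<Longrightarrow> fneg \<alpha> \<notin> P"
  shows "six_properties (\<lambda>x. \<pi> (cembed x)) V1 V2 (\<lambda>v w. Re (g v w)) (compact_torus br \<hh>) P (root_X X) (root_Y X)"
proof -
  have g1: "g (u + v) w = g u w + g v w" "g (sc c v) w = c * g v w" and gc: "g w v = cnj (g v w)"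
    and gp: "v \<noteq> 0 \<Longrightarrow> Re (g v v) > 0" for u v w c
    using herm unfolding hermitian_inner_product_def by blast+
  have g2: "g w (u + v) = g w u + g w v" "g w (sc c v) = cnj c * g w v" for u v w c
    using gc[of w "u + v"] gc[of w u] gc[of w v] gc[of w "sc c v"] by (simp_all add: g1)
  have g0: "g 0 w = 0" "g w 0 = 0" for w using g1(2)[of 0 0 w] g2(2)[of w 0 0] by simp_all
  have gm: "g (u - v) w = g u w - g v w" "g w (u - v) = g w u - g w v" for u v w
    using g1(1)[of "u - v" v w] g2(1)[of w "u - v" v] by simp_all
  have torus: "cembed H \<in> \<hh>" if H: "H \<in> compact_torus br \<hh>" for H
  proof -
    obtain Z where Z: "Z \<in> real_cartan br \<hh>" "cembed H = cscale \<i> Z"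
      using H unfolding compact_torus_def by blast
    then have "Z \<in> \<hh>" using real_cartan_h by blast
    then show ?thesis unfolding Z(2) by (rule C.subspace_scale[OF h_sub])
  qed
  have skew: "(\<mu> (D \<alpha>) - cnj (\<nu> (D \<alpha>))) * g v w = 0" if vw: "v \<in> W \<mu>" "w \<in> W \<nu>" "\<alpha> \<in> \<Delta>" for \<mu> \<nu> v w \<alpha>
  proof -
    obtain z where z: "cscale \<i> (D \<alpha>) = cembed z" using real_form(1)[OF vw(3)] by blast
    have "\<pi> (cembed z) v = sc (\<i> * \<mu> (D \<alpha>)) v" "\<pi> (cembed z) w = sc (\<i> * \<nu> (D \<alpha>)) w"
      unfolding z[symmetric] using W_eigen[OF vw(1) D_in[OF vw(3)]] W_eigen[OF vw(2) D_in[OF vw(3)]]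
      by (simp_all add: pi_simps)
    then have "\<i> * ((\<mu> (D \<alpha>) - cnj (\<nu> (D \<alpha>))) * g v w) = 0"
      using inv[of z v w] by (simp add: g1 g2 algebra_simps)
    then show ?thesis by simp
  qed
  have orth: "g v w = 0" if o: "\<mu> \<in> dual_on \<hh>" "\<nu> \<in> dual_on \<hh>" "\<mu> \<noteq> \<nu>" "v \<in> W \<mu>" "w \<in> W \<nu>" for \<mu> \<nu> v w
  proof (cases "w = 0")
    case False
    obtain \<alpha> where \<alpha>: "\<alpha> \<in> \<Delta>" "\<mu> (D \<alpha>) \<noteq> \<nu> (D \<alpha>)" using dual_ext[OF o(1,2)] o(3) by blast
    have "g w w \<noteq> 0" using gp[OF False] by auto
    then have "cnj (\<nu> (D \<alpha>)) = \<nu> (D \<alpha>)" using skew[OF o(5,5) \<alpha>(1)] by simp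
    then show ?thesis using skew[OF o(4,5) \<alpha>(1)] \<alpha>(2) by simp
  qed (simp add: g0)
  have ip: "pos_on (\<lambda>v w. Re (g v w)) V1"
    unfolding pos_on_def
  proof (intro conjI allI ballI impI)
    show "bilinear (\<lambda>v w. Re (g v w))" by (intro bilinearI) (simp_all add: g1 g2 sc_real[symmetric])
    show "Re (g v w) = Re (g w v)" for v w using gc[of v w] by simp
  qed (rule gp)
  note ipb = pos_onD(1)[OF ip]
  have ip_sym: "Re (g v w) = Re (g w v)" for v w using gc[of v w] by simp
  obtain E where E: "frame (\<lambda>v w. Re (g v w)) V1 E (\<lambda>e. e)"
    by (rule pos_on_frame[OF ip _ _ real_subspace[OF W_subspace], of Basis]) auto
  have lin: "linear (\<pi> Z)" for Z by (simp add: linear_iff pi_simps pi_real)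
  have S1: "subspace V1" by (rule real_subspace[OF W_subspace])
  have EV: "e \<in> V1" if "e \<in> E" for e using E that by (simp add: frame_def)
  define tp where "tp F w = (\<Sum>e\<in>E. Re (g (F e) w) *\<^sub>R e)" for F w
  have tp_in: "tp F w \<in> V1" for F w
    unfolding tp_def using S1 EV by (intro subspace_sum subspace_scale) auto
  have tp_prop: "Re (g (F x) w) = Re (g x (tp F w))" if "linear F" "x \<in> V1" for F x w
  proof -
    have "F x = F (\<Sum>e\<in>E. Re (g x e) *\<^sub>R e)" using E that(2) by (simp add: frame_def)
    then have "Re (g (F x) w) = Re (g (\<Sum>e\<in>E. Re (g x e) *\<^sub>R F e) w)"
      by (simp add: linear_sum[OF that(1)] linear_scale[OF that(1)])
    also have "\<dots> = (\<Sum>e\<in>E. Re (g x e) * Re (g (F e) w))"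
      by (rule bilinear_left_sum[OF ipb])
    also have "\<dots> = (\<Sum>e\<in>E. Re (g (F e) w) * Re (g x e))" by (simp add: mult.commute)
    also have "\<dots> = Re (g x (tp F w))"
      unfolding tp_def by (rule bilinear_right_sum[OF ipb, symmetric])
    finally show ?thesis .
  qed
  have tp: "transpose_on (\<lambda>v w. Re (g v w)) V1 F w = tp F w" if F: "linear F" for F w
    unfolding transpose_on_def
  proof (rule the_equality)
    show "tp F w \<in> V1 \<and> (\<forall>x\<in>V1. Re (g (F x) w) = Re (g x (tp F w)))"
      using tp_in tp_prop[OF F] by blast
    fix v assume v: "v \<in> V1 \<and> (\<forall>x\<in>V1. Re (g (F x) w) = Re (g x v))"
    have d: "v - tp F w \<in> V1" using v tp_in subspace_diff[OF S1] by blast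
    then have "Re (g (v - tp F w) (v - tp F w)) = 0"
      using v tp_prop[OF F d, of w] by (simp add: gm(2))
    then show "v = tp F w" using gp[of "v - tp F w"] by force
  qed
  have tr: "trace_on scaleR V1 (\<lambda>v. transpose_on (\<lambda>v w. Re (g v w)) V1 F (F' v)) = (\<Sum>e\<in>E. Re (g (F e) (F' e)))"
    if F: "linear F" "linear F'" for F F'
  proof -
    have "endo_on scaleR V1 (\<lambda>v. tp F (F' v))"
      unfolding endo_on_def
    proof (intro conjI ballI allI tp_in)
      show "tp F (F' (x + y)) = tp F (F' x) + tp F (F' y)" for x y
        by (simp add: tp_def linear_add[OF F(2)] g2 scaleR_left_distrib sum.distrib)
      show "tp F (F' (c *\<^sub>R x)) = c *\<^sub>R tp F (F' x)" for c x
        by (simp add: tp_def linear_scale[OF F(2)] sc_real[symmetric, of c "F' x"] g2 scaleR_sum_right)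
    qed
    from real_vector.trace_on_resolves[OF frame_resolves[OF ipb E] this]
    have "trace_on scaleR V1 (\<lambda>v. tp F (F' v)) = (\<Sum>e\<in>E. Re (g (tp F (F' e)) e))" .
    also have "\<dots> = (\<Sum>e\<in>E. Re (g (F e) (F' e)))"
      using tp_prop[OF F(1) EV] ip_sym by (intro sum.cong refl) metis
    finally show ?thesis by (simp add: tp[OF F(1)])
  qed
  have zero: "Re (g (\<pi> (cembed b) v) (\<pi> (cembed a) v)) = 0"
    if a: "a \<in> root_X X ` P \<union> root_Y X ` P" and b: "b \<in> root_X X ` P \<union> root_Y X ` P" and ab: "a \<noteq> b" and v: "v \<in> V1" for a b v
  proof -
    define p where "p \<gamma> = \<pi> (X \<gamma>) v" for \<gamma>
    obtain \<alpha> where \<alpha>: "\<alpha> \<in> P" "a = root_X X \<alpha> \<or> a = root_Y X \<alpha>" using a by blast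
    obtain \<beta> where \<beta>: "\<beta> \<in> P" "b = root_X X \<beta> \<or> b = root_Y X \<beta>" using b by blast
    have d: "\<alpha> \<in> \<Delta>" "\<beta> \<in> \<Delta>" using \<alpha> \<beta> P(1) by auto
    have o: "g (p \<gamma>) (p \<delta>) = 0" if "\<gamma> \<in> \<Delta>" "\<delta> \<in> \<Delta>" "\<gamma> \<noteq> \<delta>" for \<gamma> \<delta>
    proof (rule orth[OF shift_dual[OF that(1)] shift_dual[OF that(2)]])
      show "fadd \<mu>0 \<gamma> \<noteq> fadd \<mu>0 \<delta>" using that(3) by (simp add: fun_eq_iff)
      show "p \<gamma> \<in> W (fadd \<mu>0 \<gamma>)" "p \<delta> \<in> W (fadd \<mu>0 \<delta>)"
        unfolding p_def using X_shift[OF v] that by blast+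
    qed
    note r = rho_root[OF d(1), of v, folded p_def] rho_root[OF d(2), of v, folded p_def]
    show ?thesis
    proof (cases "\<alpha> = \<beta>")
      case True
      have im: "Im (g (p \<gamma>) (p \<gamma>)) = 0" for \<gamma> using gc[of "p \<gamma>" "p \<gamma>"] by (simp add: complex_eq_iff)
      have "g (p \<alpha>) (p (fneg \<alpha>)) = 0" "g (p (fneg \<alpha>)) (p \<alpha>) = 0"
        using o[OF d(1) neg_root[OF d(1)]] o[OF neg_root[OF d(1)] d(1)] root_neq_neg[OF d(1)] by auto
      then show ?thesis using \<alpha>(2) \<beta>(2) ab True im by (auto simp: r g1 g2 gm)
    next
      case False
      have ne: "\<alpha> \<noteq> fneg \<beta>" "fneg \<alpha> \<noteq> \<beta>" using P(2) \<alpha>(1) \<beta>(1) by metis+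
      have "fneg \<alpha> \<noteq> fneg \<beta>" using False by (simp add: fun_eq_iff)
      then have "g (p \<beta>) (p \<alpha>) = 0" "g (p (fneg \<beta>)) (p \<alpha>) = 0" "g (p \<beta>) (p (fneg \<alpha>)) = 0" "g (p (fneg \<beta>)) (p (fneg \<alpha>)) = 0"
        using o d neg_root[OF d(1)] neg_root[OF d(2)] False ne by metis+
      then show ?thesis using \<alpha>(2) \<beta>(2) by (auto simp: r g1 g2 gm)
    qed
  qed
  obtain v1 where v1: "v1 \<in> V1" "v1 \<noteq> 0" by (rule V1_nonzero)
  show ?thesis
    unfolding six_properties_def
  proof (intro conjI ballI allI impI)
    show "\<pi> (cembed H) ` V1 \<subseteq> V1" "\<pi> (cembed H) ` V2 \<subseteq> V2" if "H \<in> compact_torus br \<hh>" for H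
      using h_V1[OF torus[OF that]] h_V2[OF torus[OF that]] by blast+
    show "\<pi> (cembed (root_X X \<alpha>)) ` V1 \<subseteq> V2" "\<pi> (cembed (root_Y X \<alpha>)) ` V1 \<subseteq> V2" if "\<alpha> \<in> P" for \<alpha>
      using rho_root_V2 P(1) that by blast+
    show "Re (g v w) = 0" if v: "v \<in> V1" and w: "w \<in> V2" for v w
    proof -
      have "w \<in> {w. g v w = 0}"
      proof (rule V2_induct[OF w])
        show "V.subspace {w. g v w = 0}" by (rule V.subspaceI) (auto simp: g0 g2)
        show "x \<in> {w. g v w = 0}" if "\<mu> \<in> weights sc \<pi> \<hh>" "\<mu> \<noteq> \<mu>0" "x \<in> W \<mu>" for \<mu> x
          using orth[OF weight_dual[OF \<mu>0] weight_dual[OF that(1)] that(2)[symmetric] v that(3)] by simp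
      qed
      then show ?thesis by simp
    qed
    show "Re (g (\<pi> (cembed H) v) w) = - Re (g v (\<pi> (cembed H) w))" for H v w by (simp add: inv)
    show "\<exists>v\<in>V1. \<pi> (cembed (root_X X \<alpha>)) v \<noteq> 0" "\<exists>v\<in>V1. \<pi> (cembed (root_Y X \<alpha>)) v \<noteq> 0" if "\<alpha> \<in> P" for \<alpha>
      using rho_root_nonzero[of \<alpha>, OF _ v1] P(1) that v1(1) by blast+
    show "trace_on scaleR V1 (\<lambda>v. transpose_on (\<lambda>v w. Re (g v w)) V1 (\<pi> (cembed b)) (\<pi> (cembed a) v)) = 0"
      if "a \<in> root_X X ` P \<union> root_Y X ` P" "b \<in> root_X X ` P \<union> root_Y X ` P" "a \<noteq> b" for a b
      unfolding tr[OF lin lin] using zero[OF that] EV by simp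
  qed
qed

section \<open>A metric of negative Ricci curvature from a regular weight\<close>

text \<open>The algebra \<open>\<uu>\<^sub>\<complex>\<close> is spanned by brackets: \<open>H\<^sub>\<alpha> = [X\<^sub>\<alpha>, X\<^sub>-\<^sub>\<alpha>]\<close> and \<open>\<alpha>(H\<^sub>\<alpha>) X\<^sub>\<alpha> = [H\<^sub>\<alpha>, X\<^sub>\<alpha>]\<close>.\<close>

lemma trace_pi: "trace_on scaleR UNIV (\<pi> Z) = 0"
proof -
  have bl: "bilinear (inner :: 'v \<Rightarrow> 'v \<Rightarrow> real)" by (intro bilinearI) (simp_all add: inner_simps)
  have fr: "frame inner UNIV Basis (\<lambda>i::'v. i)" by (simp add: frame_def euclidean_representation)
  note res = frame_resolves[OF bl fr]
  have e: "endo_on scaleR UNIV (\<pi> Z)" for Z by (simp add: endo_on_def pi_simps pi_real)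
  define t where "t Z = trace_on scaleR UNIV (\<pi> Z)" for Z
  have t: "t Z = (\<Sum>i\<in>Basis. \<pi> Z i \<bullet> i)" for Z
    unfolding t_def by (rule real_vector.trace_on_resolves[OF res e])
  have t_add: "t (Z + Z') = t Z + t Z'" for Z Z' by (simp add: t pi_simps inner_simps sum.distrib)
  have t_sum: "t (sum f A) = (\<Sum>a\<in>A. t (f a))" for f :: "('u cplx \<Rightarrow> complex) \<Rightarrow> 'u cplx" and A
    by (simp add: t pi_sum inner_sum_left sum.swap[of _ A])
  have t_cb: "t (cb Z Z') = 0" for Z Z'
  proof -
    have "t (cb Z Z') = trace_on scaleR UNIV (\<lambda>v. \<pi> Z (\<pi> Z' v) - \<pi> Z' (\<pi> Z v))"
      unfolding t_def pi_bracket[abs_def] ..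
    also have "\<dots> = trace_on scaleR UNIV (\<lambda>v. \<pi> Z (\<pi> Z' v)) - trace_on scaleR UNIV (\<lambda>v. \<pi> Z' (\<pi> Z v))"
      by (rule real_vector.trace_on_diff[OF res endo_on_comp[OF e e] endo_on_comp[OF e e]])
    also have "\<dots> = 0" using real_vector.trace_on_commute[OF res e e, of Z Z'] by simp
    finally show ?thesis .
  qed
  have tX: "t (cscale c (X \<alpha>)) = 0" if \<alpha>: "\<alpha> \<in> \<Delta>" for c \<alpha>
  proof -
    have nz: "\<alpha> (D \<alpha>) \<noteq> 0" using root_pos[OF \<alpha>] by auto
    have "cscale c (X \<alpha>) = cb (cscale (c / \<alpha> (D \<alpha>)) (D \<alpha>)) (X \<alpha>)"
      using nz by (simp add: cl(4) X_root[OF \<alpha> D_in[OF \<alpha>]])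
    then show ?thesis by (simp add: t_cb)
  qed
  obtain k c where k: "k \<in> C.span (D ` \<Delta>)" "Z = k + (\<Sum>\<alpha>\<in>\<Delta>. cscale (c \<alpha>) (X \<alpha>))" by (rule decomposition)
  from k(1) have "t k = 0"
  proof (induction rule: C.span_induct_alt)
    case base
    show ?case by (simp add: t pi_simps)
  next
    case (step a x y)
    then obtain \<alpha> where \<alpha>: "\<alpha> \<in> \<Delta>" "x = D \<alpha>" by blast
    have "cscale a x = cb (cscale a (X \<alpha>)) (X (fneg \<alpha>))" by (simp add: \<alpha>(2) cl(4) X_bracket[OF \<alpha>(1)])
    then show ?case using step by (simp add: t_add t_cb)
  qed
  then have "t Z = 0" by (simp add: k(2) t_add t_sum tX)
  then show ?thesis by (simp add: t_def)
qed

text \<open>By \<open>B_pair_1\<close> this is the coefficient of \<open>X\<^sub>\<alpha>\<close> in \<open>x\<close>. The Killing form supplies coordinates on \<open>\<uu>\<close>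
  without a choice of basis.\<close>

definition coord :: "('u cplx \<Rightarrow> complex) \<Rightarrow> 'u \<Rightarrow> complex" where
  "coord \<alpha> x = B (cembed x) (X (fneg \<alpha>))"

definition torus_coord :: "('u cplx \<Rightarrow> complex) \<Rightarrow> 'u \<Rightarrow> real" where
  "torus_coord \<alpha> x = Re (B (cembed x) (cscale \<i> (D \<alpha>)))"

definition torus :: "'u set" where "torus = {x. cembed x \<in> \<hh>}"

definition root_part :: "'u set" where "root_part = {x. cembed x \<in> C.span (X ` \<Delta>)}"

definition torus_form :: "'u \<Rightarrow> 'u \<Rightarrow> real" where
  "torus_form x y = (\<Sum>\<alpha>\<in>\<Delta>. torus_coord \<alpha> x * torus_coord \<alpha> y)"

text \<open>The coefficients of \<open>X\<^sup>\<alpha>\<close> and \<open>Y\<^sup>\<alpha>\<close> are the real and imaginary parts of \<open>coord \<alpha> x\<close>. The factor \<open>4\<close> gives the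
  two vectors different lengths; any factor other than \<open>1\<close> would do.\<close>

definition root_form :: "'u \<Rightarrow> 'u \<Rightarrow> real" where
  "root_form x y = (\<Sum>\<alpha>\<in>\<Delta>. Re (coord \<alpha> x) * Re (coord \<alpha> y) + 4 * (Im (coord \<alpha> x) * Im (coord \<alpha> y)))"

lemma cembed_simps: "cembed (x + y) = cembed x + cembed y" "cembed (r *\<^sub>R x) = cscale (complex_of_real r) (cembed x)"
  "cembed 0 = 0" "cembed (br x y) = cb (cembed x) (cembed y)"
  by (simp_all add: cembed_def cscale_real cbracket_def real_lie(8,9) zero_prod_def)

lemma cembed_0: "cembed x = 0 \<longleftrightarrow> x = 0" by (simp add: cembed_def zero_prod_def)

lemma coord_linear: "coord \<alpha> (x + y) = coord \<alpha> x + coord \<alpha> y" "coord \<alpha> (r *\<^sub>R x) = r * coord \<alpha> x"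
  by (simp_all add: coord_def cembed_simps B_add B_scale)

lemma root_part_expand:
  assumes "q \<in> root_part"
  shows "cembed q = (\<Sum>\<alpha>\<in>\<Delta>. cscale (coord \<alpha> q) (X \<alpha>))"
proof -
  have "cembed q \<in> C.span (X ` \<Delta>)" using assms by (simp add: root_part_def)
  then have "\<exists>d. cembed q = (\<Sum>\<alpha>\<in>\<Delta>. cscale (d \<alpha>) (X \<alpha>))"
  proof (induction rule: C.span_induct_alt)
    case base
    show ?case by (intro exI[of _ "\<lambda>_. 0"]) simp
  next
    case (step c x y)
    then obtain d \<alpha> where d: "y = (\<Sum>\<alpha>\<in>\<Delta>. cscale (d \<alpha>) (X \<alpha>))" and \<alpha>: "\<alpha> \<in> \<Delta>" "x = X \<alpha>" by blast
    have "(\<Sum>\<beta>\<in>\<Delta>. cscale (if \<beta> = \<alpha> then c else 0) (X \<beta>)) = cscale c x"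
      using \<alpha> finite_roots by (simp add: if_distrib[of "\<lambda>c. cscale c _"] sum.delta cong: if_cong)
    then show ?case using d
      by (intro exI[of _ "\<lambda>\<beta>. (if \<beta> = \<alpha> then c else 0) + d \<beta>"]) (simp add: C.scale_left_distrib sum.distrib)
  qed
  then obtain d where d: "cembed q = (\<Sum>\<alpha>\<in>\<Delta>. cscale (d \<alpha>) (X \<alpha>))" by blast
  have "coord \<alpha> q = d \<alpha>" if \<alpha>: "\<alpha> \<in> \<Delta>" for \<alpha>
  proof -
    have "B (X \<beta>) (X (fneg \<alpha>)) = (if \<beta> = \<alpha> then 1 else 0)" if "\<beta> \<in> \<Delta>" for \<beta>
    proof (cases "\<beta> = \<alpha>")
      case False
      have "fneg \<alpha> \<noteq> fneg \<beta>"
      proof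
        assume "fneg \<alpha> = fneg \<beta>"
        then have "- \<alpha> H = - \<beta> H" for H by (rule fun_cong)
        then show False using \<open>\<beta> \<noteq> \<alpha>\<close> by auto
      qed
      then show ?thesis using False B_X_X[OF that neg_root[OF \<alpha>]] by simp
    qed (use B_pair_1[OF \<alpha>] in simp)
    then have "coord \<alpha> q = (\<Sum>\<beta>\<in>\<Delta>. d \<beta> * (if \<beta> = \<alpha> then 1 else 0))"
      by (simp add: coord_def d B_sum B_scale)
    then show ?thesis using \<alpha> finite_roots by (simp add: if_distrib[of "(*) _"] sum.delta cong: if_cong)
  qed
  then show ?thesis using d by simp
qed

lemma coord_neg: "\<alpha> \<in> \<Delta> \<Longrightarrow> coord (fneg \<alpha>) x = - cnj (coord \<alpha> x)"
proof -
  assume \<alpha>: "\<alpha> \<in> \<Delta>"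
  have "cnj (coord \<alpha> x) = B (conj_pair (cembed x)) (conj_pair (X (fneg \<alpha>)))"
    by (simp add: coord_def B_conj)
  also have "conj_pair (cembed x) = cembed x" by (simp add: conj_pair_def cembed_def)
  also have "conj_pair (X (fneg \<alpha>)) = - X \<alpha>" by (rule X_conj[OF \<alpha>])
  also have "B (cembed x) (- X \<alpha>) = - B (cembed x) (X \<alpha>)"
    using B_scale(1)[of "cembed x" "-1" "X \<alpha>"] by simp
  finally show ?thesis by (simp add: coord_def)
qed

lemma coord_torus: "t \<in> torus \<Longrightarrow> \<alpha> \<in> \<Delta> \<Longrightarrow> coord \<alpha> t = 0"
  unfolding torus_def coord_def using B_h_X neg_root by blast

lemma torus_coord_root_part: "q \<in> root_part \<Longrightarrow> \<alpha> \<in> \<Delta> \<Longrightarrow> torus_coord \<alpha> q = 0"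
proof -
  assume q: "q \<in> root_part" and \<alpha>: "\<alpha> \<in> \<Delta>"
  have "B (X \<beta>) (D \<alpha>) = 0" if "\<beta> \<in> \<Delta>" for \<beta>
    using B_h_X[OF D_in[OF \<alpha>] that] B_sym[of "X \<beta>" "D \<alpha>"] by simp
  then show ?thesis unfolding torus_coord_def root_part_expand[OF q] by (simp add: B_sum B_scale)
qed

lemma root_form_pos: "pos_on root_form root_part"
  unfolding pos_on_def
proof (intro conjI allI ballI impI)
  show "bilinear root_form"
    by (intro bilinearI) (simp_all add: root_form_def coord_linear algebra_simps sum.distrib sum_distrib_left)
  show "root_form x y = root_form y x" for x y by (simp add: root_form_def mult.commute)
  fix q assume q: "q \<in> root_part" "q \<noteq> 0"
  let ?f = "\<lambda>\<alpha>. Re (coord \<alpha> q) * Re (coord \<alpha> q) + 4 * (Im (coord \<alpha> q) * Im (coord \<alpha> q))"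
  have nn: "?f \<alpha> \<ge> 0" for \<alpha> by simp
  obtain \<alpha> where \<alpha>: "\<alpha> \<in> \<Delta>" "coord \<alpha> q \<noteq> 0"
  proof (rule ccontr)
    assume "\<not> thesis"
    then have "cembed q = 0" using that root_part_expand[OF q(1)] by (metis (no_types, lifting) C.scale_zero_left sum.neutral)
    then show False using q(2) cembed_0 by blast
  qed
  have "?f \<alpha> > 0"
  proof (cases "Re (coord \<alpha> q) = 0")
    case True
    then have "Im (coord \<alpha> q) \<noteq> 0" using \<alpha>(2) by (simp add: complex_eq_iff)
    then have "Im (coord \<alpha> q) * Im (coord \<alpha> q) > 0" by (metis not_real_square_gt_zero)
    then show ?thesis using True by simp
  next
    case False
    then have "Re (coord \<alpha> q) * Re (coord \<alpha> q) > 0" by (metis not_real_square_gt_zero)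
    then show ?thesis by (simp add: add_pos_nonneg)
  qed
  also have "?f \<alpha> \<le> sum ?f \<Delta>" by (rule member_le_sum[OF \<alpha>(1) nn finite_roots])
  finally show "root_form q q > 0" by (simp add: root_form_def)
qed

lemma torus_form_pos: "pos_on torus_form torus"
  unfolding pos_on_def
proof (intro conjI allI ballI impI)
  show "bilinear torus_form"
    by (intro bilinearI)
       (simp_all add: torus_form_def torus_coord_def cembed_simps B_add B_scale algebra_simps sum.distrib sum_distrib_left)
  show "torus_form x y = torus_form y x" for x y by (simp add: torus_form_def mult.commute)
  fix t assume t: "t \<in> torus" "t \<noteq> 0"
  have th: "cembed t \<in> \<hh>" using t by (simp add: torus_def)
  have D: "B (cembed t) (D \<alpha>) = - \<i> * torus_coord \<alpha> t" if "\<alpha> \<in> \<Delta>" for \<alpha>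
    using D_imag[OF that] by (simp add: torus_coord_def ckilling_eq cembed_def complex_eq_iff Ks cscale_simps)
  obtain \<alpha> where \<alpha>: "\<alpha> \<in> \<Delta>" "torus_coord \<alpha> t \<noteq> 0"
  proof (rule ccontr)
    assume n: "\<not> thesis"
    have "cembed t = 0"
    proof (rule B_h_nondegenerate[OF th])
      fix J assume "J \<in> \<hh>"
      then have "J \<in> C.span (D ` \<Delta>)" using h_span by simp
      then show "B J (cembed t) = 0"
      proof (induction rule: C.span_induct_alt)
        case (step c x y)
        then obtain \<beta> where "\<beta> \<in> \<Delta>" "x = D \<beta>" by blast
        then have "B x (cembed t) = 0" using n that D[of \<beta>] B_sym[of x "cembed t"] by fastforce
        then show ?case using step by (simp add: B_add B_scale)
      qed (simp add: B_zero)
    qed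
    then show False using t(2) cembed_0 by blast
  qed
  have "torus_coord \<alpha> t * torus_coord \<alpha> t > 0" using \<alpha>(2) by (metis not_real_square_gt_zero)
  also have "\<dots> \<le> torus_form t t" unfolding torus_form_def
    by (rule member_le_sum[OF \<alpha>(1) _ finite_roots]) simp
  finally show "torus_form t t > 0" .
qed

lemma bracket_root_part:
  assumes t: "t \<in> torus" and q: "q \<in> root_part"
  shows "br t q \<in> root_part" "\<alpha> \<in> \<Delta> \<Longrightarrow> coord \<alpha> (br t q) = \<alpha> (cembed t) * coord \<alpha> q"
proof -
  have th: "cembed t \<in> \<hh>" using t by (simp add: torus_def)
  have "cb (cembed t) (cembed q) = (\<Sum>\<alpha>\<in>\<Delta>. cscale (coord \<alpha> q * \<alpha> (cembed t)) (X \<alpha>))"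
  proof -
    have l: "C.lin (cb (cembed t))" by (simp add: C.lin_def cl(1,2))
    show ?thesis unfolding root_part_expand[OF q]
      by (simp add: C.lin_sum[OF l] cl(2) X_root[OF _ th])
  qed
  also have "\<dots> \<in> C.span (X ` \<Delta>)" by (intro C.span_sum C.span_scale C.span_base) blast
  finally show "br t q \<in> root_part" by (simp add: root_part_def cembed_simps)
  show "coord \<alpha> (br t q) = \<alpha> (cembed t) * coord \<alpha> q" if \<alpha>: "\<alpha> \<in> \<Delta>"
    using B_move[of "cembed t" "cembed q" "X (fneg \<alpha>)"]
    by (simp only: coord_def cembed_simps X_root[OF neg_root[OF \<alpha>] th] B_scale) simp
qed

lemma real_subspaces: "subspace torus" "subspace root_part"
  unfolding torus_def root_part_def
  by (rule subspaceI; simp add: cembed_simps C.subspace_0[OF h_sub] C.subspace_add[OF h_sub] C.subspace_scale[OF h_sub]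
      C.span_zero C.span_add C.span_scale)+

lemma torus_root_decomposition: "\<exists>t\<in>torus. \<exists>q\<in>root_part. x = t + q"
proof -
  let ?S = "{t + q | t q. t \<in> torus \<and> q \<in> root_part}"
  have S: "subspace ?S" by (rule subspace_sums[OF real_subspaces])
  have l: "linear (cembed :: 'u \<Rightarrow> _)" by (simp add: linear_iff cembed_simps cscale_real)
  have "range cembed \<subseteq> cembed ` ?S"
    unfolding u_span
  proof (rule span_minimal)
    show "subspace (cembed ` ?S)" by (rule linear_subspace_image[OF l S])
    have tS: "t \<in> ?S" if "t \<in> torus" for t
    proof -
      have "t = t + 0" "0 \<in> root_part" using subspace_0[OF real_subspaces(2)] by auto
      then show ?thesis using that by blast
    qed
    have qS: "q \<in> ?S" if "q \<in> root_part" for q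
    proof -
      have "q = 0 + q" "0 \<in> torus" using subspace_0[OF real_subspaces(1)] by auto
      then show ?thesis using that by blast
    qed
    have "{cscale \<i> (D \<alpha>), X \<alpha> - X (fneg \<alpha>), cscale \<i> (X \<alpha> + X (fneg \<alpha>))} \<subseteq> cembed ` ?S" if \<alpha>: "\<alpha> \<in> \<Delta>" for \<alpha>
    proof -
      have Xs: "X \<alpha> \<in> C.span (X ` \<Delta>)" "X (fneg \<alpha>) \<in> C.span (X ` \<Delta>)"
        using \<alpha> neg_root[OF \<alpha>] by (auto intro!: C.span_base)
      obtain z where z: "cembed z = cscale \<i> (D \<alpha>)" using real_form(1)[OF \<alpha>] by (metis imageE)
      have "z \<in> torus" using C.subspace_scale[OF h_sub D_in[OF \<alpha>]] by (simp add: torus_def z)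
      then have 1: "cscale \<i> (D \<alpha>) \<in> cembed ` ?S" unfolding z[symmetric] by (intro imageI tS)
      have rp: "root_X X \<alpha> \<in> root_part" "root_Y X \<alpha> \<in> root_part"
        unfolding root_part_def mem_Collect_eq cembed_root[OF \<alpha>]
        by (intro C.span_diff C.span_scale C.span_add Xs)+
      have "cembed (root_X X \<alpha>) \<in> cembed ` ?S" "cembed (root_Y X \<alpha>) \<in> cembed ` ?S"
        by (rule imageI[OF qS[OF rp(1)]], rule imageI[OF qS[OF rp(2)]])
      then show ?thesis using 1 unfolding cembed_root[OF \<alpha>] by simp
    qed
    then show "(\<Union>\<alpha>\<in>\<Delta>. {cscale \<i> (D \<alpha>), X \<alpha> - X (fneg \<alpha>), cscale \<i> (X \<alpha> + X (fneg \<alpha>))}) \<subseteq> cembed ` ?S"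
      by blast
  qed
  then have "cembed x \<in> cembed ` ?S" by blast
  then obtain y where "y \<in> ?S" "cembed x = cembed y" by blast
  moreover from this(2) have "x = y" by (simp add: cembed_def)
  ultimately have "x \<in> ?S" by simp
  then show ?thesis by blast
qed

text \<open>Choose a root \<open>\<gamma>\<close> with \<open>\<gamma>(t) = \<i> r \<noteq> 0\<close>. In the plane of \<open>X\<^sup>\<gamma>\<close>, \<open>Y\<^sup>\<gamma>\<close> the element \<open>t\<close> acts as an infinitesimal rotation,
  which is not skew for an inner product that gives the two axes different lengths.\<close>

lemma torus_not_skew:
  assumes t: "t \<in> torus" "t \<noteq> 0"
  shows "\<exists>q\<in>root_part. root_form (br t q) q \<noteq> 0"
proof -
  have th: "cembed t \<in> \<hh>" using t by (simp add: torus_def)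
  have "\<exists>\<gamma>\<in>\<Delta>. \<gamma> (cembed t) \<noteq> 0"
  proof (rule ccontr)
    assume n: "\<not> ?thesis"
    have "torus_coord \<alpha> t = 0" if "\<alpha> \<in> \<Delta>" for \<alpha>
    proof -
      have "\<alpha> (cembed t) = 0" using n that by blast
      then show ?thesis using B_D[OF that th] by (simp add: torus_coord_def B_scale)
    qed
    then have "torus_form t t = 0" by (simp add: torus_form_def)
    then show False using pos_onD(3)[OF torus_form_pos t] by simp
  qed
  then obtain \<gamma> where \<gamma>: "\<gamma> \<in> \<Delta>" "\<gamma> (cembed t) \<noteq> 0" by blast
  define r where "r = Im (\<gamma> (cembed t))"
  have g: "\<gamma> (cembed t) = \<i> * r"
    using B_D[OF \<gamma>(1) th] D_imag[OF \<gamma>(1)] by (simp add: r_def ckilling_eq cembed_def complex_eq_iff Ks)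
  then have r: "r \<noteq> 0" using \<gamma>(2) by auto
  define q where "q = root_X X \<gamma> + root_Y X \<gamma>"
  have cq: "cembed q = cscale (1 + \<i>) (X \<gamma>) + cscale (- 1 + \<i>) (X (fneg \<gamma>))"
    by (simp add: q_def cembed_simps cembed_root[OF \<gamma>(1)] C.scale_left_distrib C.scale_right_distrib C.scale_left_diff_distrib C.scale_minus_left)
  have Xs: "X \<gamma> \<in> C.span (X ` \<Delta>)" "X (fneg \<gamma>) \<in> C.span (X ` \<Delta>)"
    using \<gamma>(1) neg_root[OF \<gamma>(1)] by (auto intro!: C.span_base)
  have q: "q \<in> root_part" unfolding root_part_def mem_Collect_eq cq by (intro C.span_add C.span_scale Xs)
  note ne = root_neq_neg[OF \<gamma>(1)]
  have p1: "B (X (fneg \<gamma>)) (X \<gamma>) = 1" using B_pair_1[OF \<gamma>(1)] B_sym by metis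
  have p0: "B (X \<gamma>) (X \<gamma>) = 0" "B (X (fneg \<gamma>)) (X (fneg \<gamma>)) = 0"
    using B_X_X[OF \<gamma>(1) \<gamma>(1) ne] B_X_X[OF neg_root[OF \<gamma>(1)] neg_root[OF \<gamma>(1)]] ne by auto
  have c1: "coord \<gamma> q = 1 + \<i>" by (simp add: coord_def cq B_add B_scale B_pair_1[OF \<gamma>(1)] p0)
  have c2: "coord (fneg \<gamma>) q = - 1 + \<i>" by (simp add: coord_def cq B_add B_scale p1 p0)
  have c0: "coord \<alpha> q = 0" if "\<alpha> \<in> \<Delta>" "\<alpha> \<noteq> \<gamma>" "\<alpha> \<noteq> fneg \<gamma>" for \<alpha>
  proof -
    have "B (X \<gamma>) (X (fneg \<alpha>)) = 0"
      using that by (intro B_X_X \<gamma>(1) neg_root) (auto simp: fun_eq_iff)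
    moreover have "B (X (fneg \<gamma>)) (X (fneg \<alpha>)) = 0"
      using that by (intro B_X_X neg_root \<gamma>(1)) (auto simp: fun_eq_iff, metis minus_minus)
    ultimately show ?thesis by (simp add: coord_def cq B_add B_scale)
  qed
  let ?f = "\<lambda>\<alpha>. Re (coord \<alpha> (br t q)) * Re (coord \<alpha> q) + 4 * (Im (coord \<alpha> (br t q)) * Im (coord \<alpha> q))"
  have "root_form (br t q) q = sum ?f {\<gamma>, fneg \<gamma>}"
    unfolding root_form_def
  proof (rule sum.mono_neutral_right[OF finite_roots])
    show "{\<gamma>, fneg \<gamma>} \<subseteq> \<Delta>" using \<gamma>(1) neg_root by blast
    show "\<forall>\<alpha>\<in>\<Delta> - {\<gamma>, fneg \<gamma>}. ?f \<alpha> = 0" using c0 by simp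
  qed
  also have "\<dots> = ?f \<gamma> + ?f (fneg \<gamma>)" using ne by simp
  also have "\<dots> = 6 * r"
    by (simp add: bracket_root_part(2)[OF t(1) q \<gamma>(1)] bracket_root_part(2)[OF t(1) q neg_root[OF \<gamma>(1)]] c1 c2 g)
  finally show ?thesis using r q by (intro bexI[of _ q]) simp_all
qed

lemma rho_split_representation: "split_representation br (\<lambda>x. \<pi> (cembed x)) torus root_part V1 V2 torus_form root_form G"
  if G: "finite G" "span G = (UNIV :: 'u set)" for G
proof
  show "bilinear br" by (intro bilinearI) (simp_all add: real_lie(1-4))
  show "br x x = 0" for x by (rule real_lie(5))
  show "bilinear (\<lambda>x. \<pi> (cembed x))"
    by (intro bilinearI) (simp_all add: cembed_simps pi_simps pi_real sc_real)
  show "trace_on scaleR UNIV (br x) = 0" for x by (rule trace_ad)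
  show "trace_on scaleR UNIV (\<pi> (cembed x)) = 0" for x by (rule trace_pi)
  show "direct_sum_decomposition V1 V2" by (rule direct_sum)
  show "\<pi> (cembed t) v \<in> V1" if "t \<in> torus" "v \<in> V1" for t v using that h_V1 by (simp add: torus_def)
  show "\<pi> (cembed t) w \<in> V2" if "t \<in> torus" "w \<in> V2" for t w using that h_V2 by (simp add: torus_def)
  show "\<pi> (cembed q) v \<in> V2" if "q \<in> root_part" "v \<in> V1" for q v
    unfolding root_part_expand[OF that(1)] pi_sum pi_simps
    using X_V2[OF _ that(2)] by (intro V.subspace_sum[OF V2_subspace] V.subspace_scale[OF V2_subspace])
  show "q = 0" if q: "q \<in> root_part" and k: "\<And>v. v \<in> V1 \<Longrightarrow> \<pi> (cembed q) v = 0" for q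
  proof (rule ccontr)
    assume "q \<noteq> 0"
    have "\<exists>\<alpha>\<in>\<Delta>. coord \<alpha> q \<noteq> 0"
    proof (rule ccontr)
      assume "\<not> ?thesis"
      then have "cembed q = 0" unfolding root_part_expand[OF q] by (intro sum.neutral) simp
      then show False using \<open>q \<noteq> 0\<close> cembed_0 by blast
    qed
    then obtain \<alpha> where \<alpha>: "\<alpha> \<in> \<Delta>" "coord \<alpha> q \<noteq> 0" by blast
    obtain v where v: "v \<in> V1" "v \<noteq> 0" by (rule V1_nonzero)
    have "(\<Sum>\<alpha>\<in>\<Delta>. sc (coord \<alpha> q) (\<pi> (X \<alpha>) v)) = 0"
      using k[OF v(1)] unfolding root_part_expand[OF q] by (simp add: pi_sum pi_simps)
    from X_faithful[OF order_refl v(1) this \<alpha>(1) neg_root[OF \<alpha>(1)] \<alpha>(2)]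
    show False using v(2) \<alpha> by (simp add: coord_neg)
  qed
  show "br s t = 0" if "s \<in> torus" "t \<in> torus" for s t
  proof -
    have "cembed (br s t) = 0" using that h_abelian unfolding cembed_simps torus_def by blast
    then show ?thesis by (simp only: cembed_0)
  qed
  show "torus_form x q = 0" if "q \<in> root_part" for x q
    using torus_coord_root_part[OF that] by (simp add: torus_form_def)
  show "root_form x t = 0" if "t \<in> torus" for x t
    using coord_torus[OF that] by (simp add: root_form_def)
qed (fact G real_subspaces torus_root_decomposition bracket_root_part torus_form_pos root_form_pos torus_not_skew)+

lemma negative_ricci_exists:
  "\<exists>ip. inner_product ip \<and> negative_ricci (semidirect_bracket br (\<lambda>x. \<pi> (cembed x))) ip"
proof -
  obtain G where "finite G" "span G = (UNIV :: 'u set)" using finite_span by blast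
  from split_representation.negative_ricci_metric[OF rho_split_representation[OF this]] show ?thesis .
qed

end
end
end

theorem theorem3p4:
  fixes br :: "'u::real_vector \<Rightarrow> 'u \<Rightarrow> 'u"
    and \<hh> :: "'u cplx set"
    and P C :: "('u cplx \<Rightarrow> complex) set"
    and X :: "('u cplx \<Rightarrow> complex) \<Rightarrow> 'u cplx"
    and sc :: "complex \<Rightarrow> 'v::euclidean_space \<Rightarrow> 'v"
    and \<pi> :: "'u cplx \<Rightarrow> 'v \<Rightarrow> 'v"
    and \<mu>0 :: "'u cplx \<Rightarrow> complex"
  assumes "compact_semisimple br"
    and "cartan_subalgebra cscale (cbracket br) \<hh>"
    and "positive_system br \<hh> P"
    and "adapted_root_vectors br \<hh> X"
    and "complex_structure sc"
    and "lie_representation cscale (cbracket br) sc \<pi>"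
    and "\<mu>0 \<in> weights sc \<pi> \<hh>"
    and "weyl_chamber br \<hh> C" and "\<mu>0 \<in> C"
  shows "let V1 = weight_space sc \<pi> \<hh> \<mu>0;
             V2 = other_weight_spaces sc \<pi> \<hh> \<mu>0;
             \<rho> = (\<lambda>x. \<pi> (cembed x))
    in direct_sum_decomposition V1 V2 \<and>
      (\<forall>h. hermitian_inner_product sc h \<and>
           (\<forall>x v w. h (\<rho> x v) w = - h v (\<rho> x w)) \<longrightarrow>
         six_properties \<rho> V1 V2 (\<lambda>v w. Re (h v w))
           (compact_torus br \<hh>) P (root_X X) (root_Y X)) \<and>
      (\<exists>ip. inner_product ip \<and> negative_ricci (semidirect_bracket br \<rho>) ip)"
proof -
  interpret R: root_representation br \<hh> X sc \<pi>
    using assms by unfold_locales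
  note \<mu>0 = assms(7)
  have P: "P \<subseteq> roots br \<hh>" "\<And>\<alpha>. \<alpha> \<in> P \<Longrightarrow> fneg \<alpha> \<notin> P"
    using assms(3) unfolding positive_system_def by blast+
  have regular: "\<mu>0 (dual_vector br \<hh> \<alpha>) \<noteq> 0" if \<alpha>: "\<alpha> \<in> roots br \<hh>" for \<alpha>
  proof -
    have "C \<subseteq> real_dual br \<hh> - (\<Union>\<alpha>\<in>roots br \<hh>. {\<mu> \<in> real_dual br \<hh>. dual_inner br \<hh> \<mu> \<alpha> = 0})"
      using assms(8) in_components_subset unfolding weyl_chamber_def by blast
    then have "dual_inner br \<hh> \<mu>0 \<alpha> \<noteq> 0" using assms(9) \<alpha> by blast
    moreover have "ckilling br (dual_vector br \<hh> \<mu>0) (dual_vector br \<hh> \<alpha>) = \<mu>0 (dual_vector br \<hh> \<alpha>)"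
      using R.dual_vector_represents(2)[OF R.weight_dual[OF \<mu>0] R.D_in[OF \<alpha>]] R.B_sym by metis
    ultimately show ?thesis by (auto simp: dual_inner_def)
  qed
  show ?thesis
    unfolding Let_def
    using R.direct_sum[OF \<mu>0] R.six_properties_hold[OF \<mu>0 regular _ _ P] R.negative_ricci_exists[OF \<mu>0 regular] by blast
qed

end
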